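(* Let $m\ge 3$ and $n\ge 1$ be integers, and let $M$ be a connected compact smooth manifold of dimension $n+1$ with boundary $\partial M$, where $\partial M$ is a compact $n$-dimensional submanifold of $M$. Let $\mathscr{M}^{m}$ be the set of all $C^{m}$ Riemannian metrics on $M$, with the topology induced by the $C^{m}$ norm on the space $\mathscr{S}^{m}$ of $C^{m}$ symmetric covariant $2$-tensors on $M$. For $g\in\mathscr{M}^{m}$ let $H^{g}:\partial M\to\mathbb{R}$ denote the mean curvature of the boundary of $(M,g)$. Then the set $$\mathscr{A}=\left\{g\in\mathscr{M}^{m}\ :\ \text{all the critical points of } H^{g}:\partial M\to\mathbb{R} \text{ are nondegenerate}\right\}$$ is an open dense subset of $\mathscr{M}^{m}$.
   Context: $\mathscr{S}^{m}$ is the Banach space of all $C^{m}$ symmetric covariant $2$-tensors on $M$ ($C^m$ up to the boundary), with a norm defined as follows: fix a finite covering $\{V_\alpha\}_{\alpha\in L}$ of $M$ with $\overline{V_\alpha}$ contained in a coordinate neighborhood $(U_\alpha,\psi_\alpha)$ (boundary charts where $V_\alpha$ meets $\partial M$), and set $$\|k\|_m=\sum_{\alpha\in L}\sum_{|\beta|\le m}\sum_{i,j=1}^{n+1}\sup_{\psi_\alpha(V_\alpha)}\left|\partial^{\beta}k_{ij}\right|,$$ where $k_{ij}$ are the components of $k$ in the coordinates of $U_\alpha$. The set $\mathscr{M}^m$ is an open subset of $\mathscr{S}^m$. Mean curvature: for $g\in\mathscr{M}^m$, let $\nu_g$ be the inward unit normal to $\partial M$ and let $h(X,Y)=g(\nabla^g_XY,\nu_g)$,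 for $X,Y$ tangent to $\partial M$, be the second fundamental form. The mean curvature $H^g$ is the trace of $h$ with respect to the metric induced by $g$ on $\partial M$, that is $H^g=g^{ij}h_{ij}$ (sum over $i,j=1,\dots,n$; no division by $n$). Equivalently, in Fermi coordinates $(x_1,\dots,x_n,t)$ of $g$, where $t$ is arclength along the inward geodesics orthogonal to $\partial M$ and $ds^2=dt^2+g_{ij}(x,t)dx_idx_j$, one has $h_{ij}=-\tfrac12\partial_t g_{ij}$ at $t=0$. Since $m\ge3$, $H^g$ is at least of class $C^2$ on $\partial M$. A critical point $\xi\in\partial M$ of $H^g$ is nondegenerate if the Hessian of $H^g$ at $\xi$ (computed in any local coordinates on $\partial M$) is invertible. *)

theory Defs
  imports "HOL-Analysis.Analysis"
begin

section \<open>Partial derivatives and C^k maps up to the boundary\<close>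

text \<open>
  The model space of an (n+1)-manifold with boundary is \<open>real ^ 'n option\<close> with n = CARD('n) \<ge> 1.
  The coordinate \<open>None\<close> is the one transversal to the boundary, \<open>Some i\<close> are the n tangential ones.
\<close>

definition halfspace :: "(real ^ 'n::finite option) set" where
  "halfspace = {x. 0 \<le> x $ None}"

text \<open>
  The sets S used below are open in \<open>halfspace\<close>, or in \<open>real ^ 'n\<close> for the boundary. The derivative
  within such an S is unique, and at a point with \<open>x $ None = 0\<close> it is one-sided. So \<open>Ck_on k S\<close> is
  the class C^k up to the boundary.
\<close>

definition partial :: "(real ^ 'k) set \<Rightarrow> 'k \<Rightarrow> (real ^ 'k \<Rightarrow> 'b) \<Rightarrow> real ^ 'k \<Rightarrow> 'b::real_normed_vector" where
  "partial S i f x = frechet_derivative f (at x within S) (axis i 1)"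

fun Ck_on :: "nat \<Rightarrow> (real ^ 'k) set \<Rightarrow> (real ^ 'k \<Rightarrow> 'b::real_normed_vector) \<Rightarrow> bool" where
  "Ck_on 0 S f \<longleftrightarrow> continuous_on S f"
| "Ck_on (Suc k) S f \<longleftrightarrow> f differentiable_on S \<and> (\<forall>i. Ck_on k S (partial S i f))"

fun partials :: "(real ^ 'k) set \<Rightarrow> 'k list \<Rightarrow> (real ^ 'k \<Rightarrow> 'b) \<Rightarrow> real ^ 'k \<Rightarrow> 'b::real_normed_vector" where
  "partials S [] f = f"
| "partials S (i # is) f = partials S is (partial S i f)"

text \<open>
  The operator \<open>\<partial>\<^sup>\<beta>\<close> for a multi-index \<open>\<beta>\<close>. The order in which the derivatives are taken, which the
  choice operator leaves open, is immaterial for a function with continuous partial derivatives up to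
  the order of \<open>\<beta>\<close>.
\<close>

definition multi_partial :: "(real ^ 'k) set \<Rightarrow> ('k \<Rightarrow> nat) \<Rightarrow> (real ^ 'k \<Rightarrow> real) \<Rightarrow> real ^ 'k \<Rightarrow> real" where
  "multi_partial S \<beta> f = partials S (SOME is. \<forall>i. count_list is i = \<beta> i) f"


section \<open>Smooth manifolds with boundary\<close>

text \<open>
  A chart is a pair of a domain U and a coordinate map, which is relevant on U only. All charts, also
  those of interior points, take values in the half space; this is no restriction, as a relatively
  compact part of an interior chart can be translated into it.
\<close>

type_synonym ('a, 'n) chart = "'a set \<times> ('a \<Rightarrow> real ^ 'n option)"

abbreviation chart_image :: "('a, 'n::finite) chart \<Rightarrow> (real ^ 'n option) set" where
  "chart_image c \<equiv> snd c ` fst c"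

definition is_chart :: "'a topology \<Rightarrow> ('a, 'n::finite) chart \<Rightarrow> bool" where
  "is_chart M c \<longleftrightarrow>
     openin M (fst c) \<and>
     openin (top_of_set halfspace) (chart_image c) \<and>
     homeomorphic_map (subtopology M (fst c)) (top_of_set (chart_image c)) (snd c)"

definition chart_inv :: "('a, 'n::finite) chart \<Rightarrow> real ^ 'n option \<Rightarrow> 'a" where
  "chart_inv c = inv_into (fst c) (snd c)"

definition transition :: "('a, 'n::finite) chart \<Rightarrow> ('a, 'n) chart \<Rightarrow> real ^ 'n option \<Rightarrow> real ^ 'n option" where
  "transition c d = snd d \<circ> chart_inv c"

definition overlap :: "('a, 'n::finite) chart \<Rightarrow> ('a, 'n) chart \<Rightarrow> (real ^ 'n option) set" where
  "overlap c d = snd c ` (fst c \<inter> fst d)"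

definition smooth_manifold_with_boundary :: "'a topology \<Rightarrow> ('a, 'n::finite) chart set \<Rightarrow> bool" where
  "smooth_manifold_with_boundary M A \<longleftrightarrow>
     Hausdorff_space M \<and> second_countable M \<and>
     (\<forall>c\<in>A. is_chart M c) \<and>
     (\<Union>c\<in>A. fst c) = topspace M \<and>
     (\<forall>c\<in>A. \<forall>d\<in>A. \<forall>k. Ck_on k (overlap c d) (transition c d))"

text \<open>By invariance of the boundary, "some chart" could equivalently be "every chart around p".\<close>

definition mboundary :: "('a, 'n::finite) chart set \<Rightarrow> 'a set" where
  "mboundary A = {p. \<exists>c\<in>A. p \<in> fst c \<and> snd c p $ None = 0}"


section \<open>Symmetric covariant 2-tensors and Riemannian metrics\<close>

text \<open>
  A covariant 2-tensor field is given by its component matrices in all charts of the atlas, subject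
  to the transformation law. The value \<open>k c x\<close> is the matrix of components in the chart c at the
  point with coordinates x. It is set to 0 where it has no meaning, so that equality of tensor
  fields is equality of functions.
\<close>

type_synonym ('a, 'n) tensor2 =
  "('a, 'n::finite) chart \<Rightarrow> real ^ 'n option \<Rightarrow> real ^ 'n option ^ 'n option"

definition jacobian_transition ::
  "('a, 'n::finite) chart \<Rightarrow> ('a, 'n::finite) chart \<Rightarrow> real ^ 'n option \<Rightarrow> real ^ 'n option ^ 'n option" where
  "jacobian_transition c d x = matrix (frechet_derivative (transition c d) (at x within overlap c d))"

definition sym_tensors :: "nat \<Rightarrow> ('a, 'n::finite) chart set \<Rightarrow> ('a, 'n) tensor2 set" where
  "sym_tensors m A =
     {k. (\<forall>c\<in>A. Ck_on m (chart_image c) (k c)) \<and>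
         (\<forall>c\<in>A. \<forall>x\<in>chart_image c. transpose (k c x) = k c x) \<and>
         (\<forall>c\<in>A. \<forall>d\<in>A. \<forall>p\<in>fst c \<inter> fst d.
            k c (snd c p) = transpose (jacobian_transition c d (snd c p))
                              ** k d (snd d p) ** jacobian_transition c d (snd c p)) \<and>
         (\<forall>c x. c \<notin> A \<or> x \<notin> chart_image c \<longrightarrow> k c x = 0)}"

definition riemannian_metrics :: "nat \<Rightarrow> ('a, 'n::finite) chart set \<Rightarrow> ('a, 'n) tensor2 set" where
  "riemannian_metrics m A =
     {g \<in> sym_tensors m A. \<forall>c\<in>A. \<forall>x\<in>chart_image c. \<forall>v. v \<noteq> 0 \<longrightarrow> 0 < v \<bullet> (g c x *v v)}"


section \<open>The C^m norm\<close>

definition norm_cover ::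
  "'a topology \<Rightarrow> ('a, 'n::finite) chart set \<Rightarrow> 'l set \<Rightarrow> ('l \<Rightarrow> 'a set) \<Rightarrow> ('l \<Rightarrow> ('a, 'n) chart) \<Rightarrow> bool" where
  "norm_cover M A L V \<phi> \<longleftrightarrow>
     finite L \<and> (\<Union>\<alpha>\<in>L. V \<alpha>) = topspace M \<and>
     (\<forall>\<alpha>\<in>L. \<phi> \<alpha> \<in> A \<and> M closure_of V \<alpha> \<subseteq> fst (\<phi> \<alpha>))"

text \<open>
  The inserted 0 affects the supremum of the nonnegative values only for empty \<open>V \<alpha>\<close>, where
  \<open>Sup {}\<close> is unspecified on the reals.
\<close>

definition Cm_norm ::
  "nat \<Rightarrow> 'l set \<Rightarrow> ('l \<Rightarrow> 'a set) \<Rightarrow> ('l \<Rightarrow> ('a, 'n::finite) chart) \<Rightarrow> ('a, 'n) tensor2 \<Rightarrow> real" where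
  "Cm_norm m L V \<phi> k =
     (\<Sum>\<alpha>\<in>L. \<Sum>\<beta> | (\<Sum>i\<in>UNIV. \<beta> i) \<le> m. \<Sum>i\<in>UNIV. \<Sum>j\<in>UNIV.
        Sup (insert 0 ((\<lambda>x. \<bar>multi_partial (chart_image (\<phi> \<alpha>)) \<beta> (\<lambda>y. k (\<phi> \<alpha>) y $ i $ j) x\<bar>)
                         ` snd (\<phi> \<alpha>) ` V \<alpha>)))"

text \<open>\<open>Metric_space\<close> requires a distance that is nonnegative and symmetric also outside the carrier.\<close>

definition Cm_dist ::
  "nat \<Rightarrow> ('a, 'n::finite) chart set \<Rightarrow> 'l set \<Rightarrow> ('l \<Rightarrow> 'a set) \<Rightarrow> ('l \<Rightarrow> ('a, 'n) chart) \<Rightarrow>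
     ('a, 'n) tensor2 \<Rightarrow> ('a, 'n) tensor2 \<Rightarrow> real" where
  "Cm_dist m A L V \<phi> k k' =
     (if k \<in> sym_tensors m A \<and> k' \<in> sym_tensors m A
      then Cm_norm m L V \<phi> (\<lambda>c x. k c x - k' c x) else 0)"

definition tensor_topology ::
  "nat \<Rightarrow> ('a, 'n::finite) chart set \<Rightarrow> 'l set \<Rightarrow> ('l \<Rightarrow> 'a set) \<Rightarrow> ('l \<Rightarrow> ('a, 'n) chart) \<Rightarrow>
     ('a, 'n) tensor2 topology" where
  "tensor_topology m A L V \<phi> = Metric_space.mtopology (sym_tensors m A) (Cm_dist m A L V \<phi>)"

definition metric_topology ::
  "nat \<Rightarrow> ('a, 'n::finite) chart set \<Rightarrow> 'l set \<Rightarrow> ('l \<Rightarrow> 'a set) \<Rightarrow> ('l \<Rightarrow> ('a, 'n) chart) \<Rightarrow>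
     ('a, 'n) tensor2 topology" where
  "metric_topology m A L V \<phi> = subtopology (tensor_topology m A L V \<phi>) (riemannian_metrics m A)"


section \<open>Mean curvature of the boundary\<close>

text \<open>In this section G is the component matrix of a metric in a chart with image S.\<close>

definition christoffel ::
  "(real ^ 'k) set \<Rightarrow> (real ^ 'k \<Rightarrow> real ^ 'k ^ 'k) \<Rightarrow> 'k \<Rightarrow> 'k \<Rightarrow> 'k \<Rightarrow> real ^ 'k \<Rightarrow> real" where
  "christoffel S G k i j x =
     1/2 * (\<Sum>l\<in>UNIV. matrix_inv (G x) $ k $ l *
       (partial S i (\<lambda>y. G y $ j $ l) x + partial S j (\<lambda>y. G y $ i $ l) x
          - partial S l (\<lambda>y. G y $ i $ j) x))"

definition levi_civita ::
  "(real ^ 'k) set \<Rightarrow> (real ^ 'k \<Rightarrow> real ^ 'k ^ 'k) \<Rightarrow> (real ^ 'k \<Rightarrow> real ^ 'k) \<Rightarrow> (real ^ 'k \<Rightarrow> real ^ 'k) \<Rightarrow>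
     real ^ 'k \<Rightarrow> real ^ 'k" where
  "levi_civita S G X Y x =
     frechet_derivative Y (at x within S) (X x)
       + (\<chi> k. \<Sum>i\<in>UNIV. \<Sum>j\<in>UNIV. christoffel S G k i j x * X x $ i * Y x $ j)"

definition inward_normal :: "real ^ 'n option ^ 'n option \<Rightarrow> real ^ 'n::finite option" where
  "inward_normal B = (THE v. v \<bullet> (B *v v) = 1 \<and> (\<forall>i. axis (Some i) 1 \<bullet> (B *v v) = 0) \<and> 0 < v $ None)"

definition second_fundamental_form ::
  "(real ^ 'n option) set \<Rightarrow> (real ^ 'n option \<Rightarrow> real ^ 'n option ^ 'n option) \<Rightarrow>
     real ^ 'n option \<Rightarrow> real ^ 'n ^ 'n::finite" where
  "second_fundamental_form S G x =
     (\<chi> i j. levi_civita S G (\<lambda>_. axis (Some i) 1) (\<lambda>_. axis (Some j) 1) x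
               \<bullet> (G x *v inward_normal (G x)))"

definition induced_metric :: "real ^ 'n option ^ 'n option \<Rightarrow> real ^ 'n ^ 'n::finite" where
  "induced_metric B = (\<chi> i j. B $ Some i $ Some j)"

definition local_mean_curvature ::
  "(real ^ 'n::finite option) set \<Rightarrow> (real ^ 'n option \<Rightarrow> real ^ 'n option ^ 'n option) \<Rightarrow>
     real ^ 'n option \<Rightarrow> real" where
  "local_mean_curvature S G x =
     (\<Sum>i\<in>UNIV. \<Sum>j\<in>UNIV.
        matrix_inv (induced_metric (G x)) $ i $ j * second_fundamental_form S G x $ i $ j)"

text \<open>The value at a boundary point does not depend on the chosen chart.\<close>

definition mean_curvature :: "('a, 'n::finite) chart set \<Rightarrow> ('a, 'n) tensor2 \<Rightarrow> 'a \<Rightarrow> real" where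
  "mean_curvature A g p =
     (let c = (SOME c. c \<in> A \<and> p \<in> fst c) in local_mean_curvature (chart_image c) (g c) (snd c p))"


section \<open>Nondegenerate critical points of functions on the boundary\<close>

definition bd_embed :: "real ^ 'n \<Rightarrow> real ^ 'n::finite option" where
  "bd_embed y = (\<chi> k. case k of None \<Rightarrow> 0 | Some i \<Rightarrow> y $ i)"

definition bd_coord :: "('a, 'n::finite) chart \<Rightarrow> 'a \<Rightarrow> real ^ 'n" where
  "bd_coord c p = (\<chi> i. snd c p $ Some i)"

text \<open>
  The expression of f in the coordinates that c induces on the boundary. It is meaningful on the open
  set of those y with \<open>bd_embed y \<in> chart_image c\<close>, and only germs at points of that set are used.
\<close>

definition bd_local :: "('a, 'n::finite) chart \<Rightarrow> ('a \<Rightarrow> real) \<Rightarrow> real ^ 'n \<Rightarrow> real" where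
  "bd_local c f y = f (chart_inv c (bd_embed y))"

definition critical_point :: "('a, 'n::finite) chart set \<Rightarrow> ('a \<Rightarrow> real) \<Rightarrow> 'a \<Rightarrow> bool" where
  "critical_point A f \<xi> \<longleftrightarrow> \<xi> \<in> mboundary A \<and>
     (\<forall>c\<in>A. \<xi> \<in> fst c \<longrightarrow> (bd_local c f has_derivative (\<lambda>_. 0)) (at (bd_coord c \<xi>)))"

definition hessian :: "(real ^ 'n \<Rightarrow> real) \<Rightarrow> real ^ 'n \<Rightarrow> real ^ 'n ^ 'n" where
  "hessian F y = (\<chi> i j. partial UNIV i (partial UNIV j F) y)"

definition nondegenerate_at :: "('a, 'n::finite) chart set \<Rightarrow> ('a \<Rightarrow> real) \<Rightarrow> 'a \<Rightarrow> bool" where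
  "nondegenerate_at A f \<xi> \<longleftrightarrow>
     (\<forall>c\<in>A. \<xi> \<in> fst c \<longrightarrow> invertible (hessian (bd_local c f) (bd_coord c \<xi>)))"

definition nondegenerate_metrics :: "nat \<Rightarrow> ('a, 'n::finite) chart set \<Rightarrow> ('a, 'n) tensor2 set" where
  "nondegenerate_metrics m A =
     {g \<in> riemannian_metrics m A.
        \<forall>\<xi>. critical_point A (mean_curvature A g) \<xi> \<longrightarrow> nondegenerate_at A (mean_curvature A g) \<xi>}"

end

theory Submission
  imports Defs
begin

text \<open>
  Openness. If metrics converge in C^m and each has a degenerate critical point of its mean curvature,
  then a subsequence of these points converges inside one chart, all jets of order at most 3 of the
  metrics converge along it, and so do the jets of order at most 2 of the mean curvatures; the limit
  is a degenerate critical point of the limiting mean curvature.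

  Density. If s vanishes on the boundary, the conformal change (1 + s) g leaves the induced metric
  and the normal \<open>\<nu>\<close> fixed and changes H by -(n/2) ds(\<open>\<nu>\<close>). With s suitably cut off in a
  chart, H therefore becomes H - a . x near a given point, for any small covector a, and by Sard's
  theorem applied to the gradient of H almost every a leaves no degenerate critical point there.
  Finitely many such steps suffice, since each achieved condition is open.
\<close>

section \<open>Calculus on sets with corners\<close>

text \<open>A metric is only of class C^m, so Fermi coordinates of g would lose derivatives and a
  perturbation written in them could leave the space. The conformal factor therefore lives in a
  fixed chart: s = x_0 w, with w built from the coefficient g^00, is again C^m, and a C^m cut-off
  suffices for it. H is defined through a chart picked by choice, while criticality and
  nondegeneracy refer to every chart. This forces the transformation law of H under transition maps,
  with one-sided derivatives, and the law of the Hessian at critical points; after that a single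
  chart decides both properties. The regularity of H and the convergence of its jets are both read
  off from one explicit formula in the coefficients of g and their first derivatives, whence the
  common calculus of families. Since H loses one derivative, m \<ge> 3 makes it C^2 and its
  tangential gradient C^1. This gradient maps an open part of R^n to R^n, and between spaces of
  equal dimension differentiability is all that Sard's theorem asks for.\<close>

definition corner_open :: "(real ^ 'k) set \<Rightarrow> bool" where
  "corner_open S \<longleftrightarrow> (\<forall>x\<in>S. \<exists>e>0. \<forall>v. (\<forall>i. 0 \<le> v $ i \<and> v $ i < e) \<longrightarrow> x + v \<in> S)"

lemma corner_openD:
  assumes "corner_open S" "x \<in> S"
  obtains e where "e > 0" "\<And>v. (\<And>i. 0 \<le> v $ i \<and> v $ i < e) \<Longrightarrow> x + v \<in> S"
  using assms unfolding corner_open_def by blast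

lemma corner_open_Int:
  assumes "corner_open S" "corner_open T"
  shows "corner_open (S \<inter> T)"
  unfolding corner_open_def
proof
  fix x assume "x \<in> S \<inter> T"
  then obtain e d where "e > 0" "\<And>v. (\<And>i. 0 \<le> v $ i \<and> v $ i < e) \<Longrightarrow> x + v \<in> S"
     "d > 0" "\<And>v. (\<And>i. 0 \<le> v $ i \<and> v $ i < d) \<Longrightarrow> x + v \<in> T"
    using assms corner_openD by (metis IntD1 IntD2)
  then show "\<exists>e>0. \<forall>v. (\<forall>i. 0 \<le> v $ i \<and> v $ i < e) \<longrightarrow> x + v \<in> S \<inter> T"
    by (intro exI[of _ "min e d"]) auto
qed

lemma open_imp_corner_open:
  assumes "open S" shows "corner_open (S :: (real ^ 'k::finite) set)"
  unfolding corner_open_def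
proof
  fix x assume "x \<in> S"
  then obtain r where r: "r > 0" "ball x r \<subseteq> S" using assms open_contains_ball by blast
  have "x + v \<in> S" if v: "\<forall>i. 0 \<le> v $ i \<and> v $ i < r / CARD('k)" for v :: "real ^ 'k"
  proof -
    have "norm v \<le> (\<Sum>i\<in>UNIV. \<bar>v $ i\<bar>)" by (rule norm_le_l1_cart)
    also have "\<dots> < (\<Sum>i\<in>(UNIV::'k set). r / CARD('k))"
      using v by (intro sum_strict_mono) auto
    also have "\<dots> = r" by simp
    finally show ?thesis using r by (auto simp: dist_norm)
  qed
  then show "\<exists>e>0. \<forall>v. (\<forall>i. 0 \<le> v $ i \<and> v $ i < e) \<longrightarrow> x + v \<in> S"
    using r(1) by (intro exI[of _ "r / CARD('k)"]) auto
qed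

lemma corner_open_halfspace: "corner_open halfspace"
  unfolding corner_open_def halfspace_def by (auto intro!: exI[of _ 1])

lemma openin_corner_open:
  assumes "openin (top_of_set S) T" "corner_open S"
  shows "corner_open T"
  using assms corner_open_Int open_imp_corner_open unfolding openin_open by blast

lemmas openin_halfspace_corner_open = openin_corner_open[OF _ corner_open_halfspace]

text \<open>A derivative is determined by its values on the axis vectors, and for those it is enough
  that a small positive step along each axis stays in S. This is what \<open>corner_open\<close>
  provides, at interior points and at points of the bounding hyperplane alike.\<close>

lemma has_derivative_unique_corner:
  assumes "corner_open S" "x \<in> S"
    "(f has_derivative f') (at x within S)" "(f has_derivative f'') (at x within S)"
  shows "f' = f''"
proof (rule frechet_derivative_unique_within[OF assms(3,4)])
  fix b :: "real ^ 'a" and e :: real assume b: "b \<in> Basis" "0 < e"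
  then obtain i where i: "b = axis i 1" by (auto simp: Basis_vec_def)
  obtain d where d: "d > 0" "\<And>v. (\<And>i. 0 \<le> v $ i \<and> v $ i < d) \<Longrightarrow> x + v \<in> S"
    using corner_openD[OF assms(1,2)] by blast
  have "x + (min e d / 2) *\<^sub>R b \<in> S"
    using d(1) b by (intro d(2)) (auto simp: i axis_def)
  then show "\<exists>d. 0 < \<bar>d\<bar> \<and> \<bar>d\<bar> < e \<and> x + d *\<^sub>R b \<in> S"
    using d(1) b(2) by (intro exI[of _ "min e d / 2"]) auto
qed

lemma partial_eqI:
  assumes "corner_open S" "x \<in> S" "(f has_derivative f') (at x within S)"
  shows "partial S i f x = f' (axis i 1)"
proof -
  have "(f has_derivative frechet_derivative f (at x within S)) (at x within S)"
    using assms(3) frechet_derivative_works differentiableI by blast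
  then show ?thesis
    using has_derivative_unique_corner[OF assms(1,2) _ assms(3)] by (simp add: partial_def)
qed

lemma partial_cong:
  assumes "\<And>x. x \<in> S \<Longrightarrow> f x = g x" "x \<in> S"
  shows "partial S i f x = partial S i g x"
proof -
  have "(f has_derivative f') (at x within S) \<longleftrightarrow> (g has_derivative f') (at x within S)" for f'
    using assms has_derivative_transform by metis
  then show ?thesis by (simp add: partial_def frechet_derivative_def)
qed

lemma at_within_openin:
  assumes "openin (top_of_set S) T" "x \<in> T"
  shows "at x within T = at x within S"
proof -
  obtain U where "open U" "T = S \<inter> U" using assms(1) by (auto simp: openin_open)
  then show ?thesis using assms(2) by (intro at_within_nhd[of x U]) auto
qed

lemma partial_openin:
  assumes "openin (top_of_set S) T" "x \<in> T"
  shows "partial T i f x = partial S i f x"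
  by (simp add: partial_def at_within_openin[OF assms])

lemma has_derivative_partials:
  fixes f :: "real ^ 'k \<Rightarrow> 'b::real_normed_vector"
  assumes "f differentiable (at x within S)"
  shows "(f has_derivative (\<lambda>v. \<Sum>i\<in>UNIV. v $ i *\<^sub>R partial S i f x)) (at x within S)"
proof -
  let ?D = "frechet_derivative f (at x within S)"
  have D: "(f has_derivative ?D) (at x within S)" using assms frechet_derivative_works by blast
  then interpret linear ?D by (rule has_derivative_linear)
  have "?D v = (\<Sum>i\<in>UNIV. v $ i *\<^sub>R partial S i f x)" for v
  proof -
    have "?D v = ?D (\<Sum>i\<in>UNIV. v $ i *\<^sub>R axis i 1)"
      using basis_expansion[of v] by (simp add: scalar_mult_eq_scaleR)
    then show ?thesis by (simp add: sum scale partial_def)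
  qed
  then have "?D = (\<lambda>v. \<Sum>i\<in>UNIV. v $ i *\<^sub>R partial S i f x)" by blast
  with D show ?thesis by simp
qed

lemma differentiable_on_cong:
  assumes "\<And>x. x \<in> S \<Longrightarrow> f x = g x"
  shows "f differentiable_on S \<longleftrightarrow> g differentiable_on S"
  unfolding differentiable_on_def differentiable_def
  using assms by (metis has_derivative_transform)

lemma sum_axis: "(\<Sum>i\<in>UNIV. axis j (1::real) $ i * g i) = g (j::'j::finite)"
  by (simp add: axis_def if_distrib[of "\<lambda>c. c * _"] cong: if_cong)

subsection \<open>Families of functions of finite smoothness\<close>

text \<open>
  \<open>Cfam P k S f\<close> says that the members of the family f are k times differentiable on S and that all
  derivatives of order at most k satisfy P as families. For a single function and P continuity this
  is \<open>Ck_on\<close>; for sequences and P convergence of the values along a given sequence of points it is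
  convergence of jets. Both obey the same calculus.
\<close>

fun Cfam :: "(('w \<Rightarrow> real ^ 'k \<Rightarrow> real) \<Rightarrow> bool) \<Rightarrow> nat \<Rightarrow> (real ^ 'k) set \<Rightarrow> ('w \<Rightarrow> real ^ 'k \<Rightarrow> real) \<Rightarrow> bool" where
  "Cfam P 0 S f \<longleftrightarrow> P f"
| "Cfam P (Suc k) S f \<longleftrightarrow> P f \<and> (\<forall>w. f w differentiable_on S) \<and> (\<forall>i. Cfam P k S (\<lambda>w. partial S i (f w)))"

text \<open>The closure properties are those that the formula of the mean curvature uses:
  polynomials, reciprocals (\<open>powr\<close> with exponent -1, for Cramer's rule) and the root in
  the length of the normal (exponent -1/2).\<close>

locale smooth_families =
  fixes S :: "(real ^ 'k) set" and P :: "('w \<Rightarrow> real ^ 'k \<Rightarrow> real) \<Rightarrow> bool"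
  assumes corner: "corner_open S"
    and P_cong: "\<And>f g. P f \<Longrightarrow> (\<And>w x. x \<in> S \<Longrightarrow> f w x = g w x) \<Longrightarrow> P g"
    and P_const: "\<And>c. P (\<lambda>w x. c)"
    and P_add: "\<And>f g. P f \<Longrightarrow> P g \<Longrightarrow> P (\<lambda>w x. f w x + g w x)"
    and P_mult: "\<And>f g. P f \<Longrightarrow> P g \<Longrightarrow> P (\<lambda>w x. f w x * g w x)"
    and P_powr: "\<And>f a. P f \<Longrightarrow> (\<And>w x. x \<in> S \<Longrightarrow> 0 < f w x) \<Longrightarrow> P (\<lambda>w x. f w x powr a)"
begin

abbreviation "C k f \<equiv> Cfam P k S f"

lemma C_Suc_imp_C: "C (Suc k) f \<Longrightarrow> C k f"
  by (induction k arbitrary: f) auto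

lemma C_mono: "C k f \<Longrightarrow> j \<le> k \<Longrightarrow> C j f"
  by (induction k) (metis le_zero_eq, metis C_Suc_imp_C le_Suc_eq)

lemma C_cong:
  assumes "C k f" "\<And>w x. x \<in> S \<Longrightarrow> f w x = g w x"
  shows "C k g"
  using assms
proof (induction k arbitrary: f g)
  case 0 then show ?case using P_cong by auto
next
  case (Suc k)
  have "partial S i (f w) x = partial S i (g w) x" if "x \<in> S" for i w x
    using Suc.prems(2) that by (intro partial_cong) auto
  moreover have "f w differentiable_on S \<longleftrightarrow> g w differentiable_on S" for w
    using Suc.prems(2) by (intro differentiable_on_cong) auto
  ultimately show ?case using Suc.prems Suc.IH[of "\<lambda>w. partial S i (f w)" "\<lambda>w. partial S i (g w)" for i] P_cong[of f g]
    by auto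
qed

text \<open>By uniqueness of the derivative on S, any explicit expression D for it yields the
  partial derivatives; each rule below only has to exhibit D.\<close>

lemma C_SucI:
  assumes "P f"
    and "\<And>w x. x \<in> S \<Longrightarrow> (f w has_derivative D w x) (at x within S)"
    and "\<And>i. C k (\<lambda>w x. D w x (axis i 1))"
  shows "C (Suc k) f"
proof -
  have "f w differentiable_on S" for w
    using assms(2) by (auto simp: differentiable_on_def differentiable_def)
  moreover have "C k (\<lambda>w. partial S i (f w))" for i
    by (rule C_cong[OF assms(3)[of i]]) (simp add: partial_eqI[OF corner _ assms(2)])
  ultimately show ?thesis using assms(1) by simp
qed

lemma C_SucD:
  assumes "C (Suc k) f" "x \<in> S"
  shows "(f w has_derivative (\<lambda>v. \<Sum>i\<in>UNIV. v $ i *\<^sub>R partial S i (f w) x)) (at x within S)"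
  using assms by (intro has_derivative_partials) (auto simp: differentiable_on_def)

lemma C_partial: "C (Suc k) f \<Longrightarrow> C k (\<lambda>w. partial S i (f w))"
  by simp

lemma C_const: "C k (\<lambda>w x. c)"
proof (induction k arbitrary: c)
  case 0 then show ?case by (simp add: P_const)
next
  case (Suc k)
  show ?case
    by (rule C_SucI[where D="\<lambda>w x v. 0"]) (use Suc P_const in auto)
qed

lemma C_add: "C k f \<Longrightarrow> C k g \<Longrightarrow> C k (\<lambda>w x. f w x + g w x)"
proof (induction k arbitrary: f g)
  case 0 then show ?case by (simp add: P_add)
next
  case (Suc k)
  show ?case
    by (rule C_SucI[OF _ has_derivative_add[OF C_SucD[OF Suc.prems(1)] C_SucD[OF Suc.prems(2)]]])
      (use Suc.prems in \<open>auto intro!: Suc.IH P_add simp: sum_axis\<close>)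
qed

lemma C_mult: "C k f \<Longrightarrow> C k g \<Longrightarrow> C k (\<lambda>w x. f w x * g w x)"
proof (induction k arbitrary: f g)
  case 0 then show ?case by (simp add: P_mult)
next
  case (Suc k)
  show ?case
    by (rule C_SucI[OF _ has_derivative_mult[OF C_SucD[OF Suc.prems(1)] C_SucD[OF Suc.prems(2)]]])
      (use Suc.prems C_Suc_imp_C in \<open>auto intro!: Suc.IH C_add P_mult simp: sum_axis\<close>)
qed

lemma C_cmult: "C k f \<Longrightarrow> C k (\<lambda>w x. c * f w x)"
  by (rule C_mult[OF C_const])

lemma C_minus: "C k f \<Longrightarrow> C k (\<lambda>w x. - f w x)"
  using C_cmult[of k f "-1"] by simp

lemma C_diff: "C k f \<Longrightarrow> C k g \<Longrightarrow> C k (\<lambda>w x. f w x - g w x)"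
  using C_add[OF _ C_minus] by simp

lemma C_sum: "(\<And>j. j \<in> J \<Longrightarrow> C k (f j)) \<Longrightarrow> C k (\<lambda>w x. \<Sum>j\<in>J. f j w x)"
  by (induction J rule: infinite_finite_induct) (auto intro: C_const C_add)

lemma C_prod: "(\<And>j. j \<in> J \<Longrightarrow> C k (f j)) \<Longrightarrow> C k (\<lambda>w x. \<Prod>j\<in>J. f j w x)"
  by (induction J rule: infinite_finite_induct) (auto intro: C_const C_mult)

text \<open>Differentiation lowers the exponent by one, so the induction runs over all exponents at
  once.\<close>

lemma C_powr:
  "C k f \<Longrightarrow> (\<And>w x. x \<in> S \<Longrightarrow> 0 < f w x) \<Longrightarrow> C k (\<lambda>w x. f w x powr a)"
proof (induction k arbitrary: f a)
  case 0 then show ?case by (simp add: P_powr)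
next
  case (Suc k)
  note pos = Suc.prems(2)
  show ?case
  proof (rule C_SucI)
    show "P (\<lambda>w x. f w x powr a)" using Suc.prems by (auto intro: P_powr)
    show "((\<lambda>x. f w x powr a) has_derivative
        (\<lambda>v. a * f w x powr (a - 1) * (\<Sum>i\<in>UNIV. v $ i *\<^sub>R partial S i (f w) x))) (at x within S)"
      if "x \<in> S" for w x
      using that pos[OF that, of w]
      by (auto intro!: derivative_eq_intros C_SucD[OF Suc.prems(1)] simp: powr_diff field_simps)
    show "C k (\<lambda>w x. a * f w x powr (a - 1) * (\<Sum>j\<in>UNIV. axis i 1 $ j *\<^sub>R partial S j (f w) x))" for i
      unfolding real_scaleR_def sum_axis using Suc.prems(1)
      by (intro C_mult C_const Suc.IH pos C_partial C_Suc_imp_C[OF Suc.prems(1)])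
  qed
qed

lemma C_divide:
  assumes "C k f" "C k g" "\<And>w x. x \<in> S \<Longrightarrow> 0 < g w x"
  shows "C k (\<lambda>w x. f w x / g w x)"
  by (rule C_cong[OF C_mult[OF assms(1) C_powr[OF assms(2,3), of "-1"]]])
     (use assms(3) in \<open>auto simp: powr_minus divide_inverse less_imp_le\<close>)

lemma C_det:
  fixes G :: "'w \<Rightarrow> real ^ 'k \<Rightarrow> real ^ 'j ^ 'j::finite"
  assumes "\<And>i j. C k (\<lambda>w x. G w x $ i $ j)"
  shows "C k (\<lambda>w x. det (G w x))"
  unfolding det_def by (intro C_sum C_mult C_const C_prod assms)

end

section \<open>Inverse matrices by Cramer's rule\<close>

lemma matrix_inv_mult:
  fixes A :: "real ^ 'n ^ 'n"
  assumes "det A \<noteq> 0"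
  shows "A ** matrix_inv A = mat 1" "matrix_inv A ** A = mat 1"
proof -
  have "\<exists>B. A ** B = mat 1 \<and> B ** A = mat 1"
    using assms unfolding invertible_det_nz[symmetric] invertible_def .
  then have "A ** matrix_inv A = mat 1 \<and> matrix_inv A ** A = mat 1"
    unfolding matrix_inv_def by (rule someI_ex)
  then show "A ** matrix_inv A = mat 1" "matrix_inv A ** A = mat 1" by auto
qed

text \<open>Cramer's quotient is expanded by \<open>det A\<close>: the denominator becomes a square,
  hence positive whatever the sign of the determinant, as \<open>C_divide\<close> requires.\<close>

lemma matrix_inv_cramer:
  fixes A :: "real ^ 'n ^ 'n"
  assumes "det A \<noteq> 0"
  shows "matrix_inv A $ k $ l =
    det (\<chi> i j. if j = k then (if i = l then 1 else 0) else A $ i $ j) * det A / (det A * det A)"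
proof -
  have "A *v (matrix_inv A *v axis l 1) = axis l 1"
    by (simp add: matrix_vector_mul_assoc matrix_inv_mult[OF assms])
  then have "matrix_inv A *v axis l 1 = (\<chi> k. det (\<chi> i j. if j = k then axis l 1 $ i else A $ i $ j) / det A)"
    using cramer[OF assms] by blast
  moreover have "(matrix_inv A *v axis l 1) $ k = matrix_inv A $ k $ l"
    by (simp add: matrix_vector_mul_component inner_axis)
  moreover have "(\<chi> i j. if j = k then axis l 1 $ i else A $ i $ j) =
      (\<chi> i j. if j = k then (if i = l then 1 else 0) else A $ i $ j)"
    by (auto simp: axis_def vec_eq_iff)
  ultimately show ?thesis using assms by simp
qed

context smooth_families
begin

lemma C_matrix_inv:
  fixes G :: "'w \<Rightarrow> real ^ 'k \<Rightarrow> real ^ 'j ^ 'j::finite"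
  assumes "\<And>i j. C k (\<lambda>w x. G w x $ i $ j)" "\<And>w x. x \<in> S \<Longrightarrow> det (G w x) \<noteq> 0"
  shows "C k (\<lambda>w x. matrix_inv (G w x) $ i $ j)"
proof -
  have 1: "C k (\<lambda>w x. (\<chi> i' j'. if j' = i then if i' = j then 1 else 0 else G w x $ i' $ j') $ a $ b)" for a b
    using assms(1) C_const by (cases "b = i"; cases "a = j") simp_all
  have "C k (\<lambda>w x. det (\<chi> i' j'. if j' = i then if i' = j then 1 else 0 else G w x $ i' $ j') *
      det (G w x) / (det (G w x) * det (G w x)))"
    using assms(2) by (intro C_divide C_mult C_det assms(1) 1) (metis not_real_square_gt_zero)
  then show ?thesis
    by (rule C_cong) (simp add: matrix_inv_cramer assms(2))
qed

end

section \<open>Calculus of single C^k functions up to the boundary\<close>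

lemma Ck_on_cong:
  assumes "\<And>x. x \<in> S \<Longrightarrow> f x = g x"
  shows "Ck_on k S f \<longleftrightarrow> Ck_on k S g"
  using assms
proof (induction k arbitrary: f g)
  case 0 then show ?case by (auto intro: continuous_on_cong)
next
  case (Suc k)
  have "Ck_on k S (partial S i f) \<longleftrightarrow> Ck_on k S (partial S i g)" for i
    using Suc.prems by (intro Suc.IH partial_cong) auto
  moreover have "f differentiable_on S \<longleftrightarrow> g differentiable_on S"
    by (rule differentiable_on_cong) (use Suc.prems in auto)
  ultimately show ?case by simp
qed

lemma Ck_on_openin:
  assumes "openin (top_of_set S) T" "Ck_on k S f"
  shows "Ck_on k T f"
  using assms(2)
proof (induction k arbitrary: f)
  case 0 then show ?case using assms(1) by (auto intro: continuous_on_subset dest: openin_imp_subset)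
next
  case (Suc k)
  have "Ck_on k T (partial T i f)" for i
    using Ck_on_cong[of T "partial T i f" "partial S i f" k] partial_openin[OF assms(1)] Suc by auto
  moreover have "f differentiable_on T"
    using Suc.prems assms(1) by (auto intro: differentiable_on_subset dest: openin_imp_subset)
  ultimately show ?case by simp
qed

text \<open>Derivatives within S and within a relatively open subset coincide. This glues functions
  that are given by different formulas on two open pieces, such as extensions by zero.\<close>

lemma Ck_on_local:
  assumes "\<And>x. x \<in> S \<Longrightarrow> \<exists>T. openin (top_of_set S) T \<and> x \<in> T \<and> Ck_on k T f"
  shows "Ck_on k S f"
  using assms
proof (induction k arbitrary: f)
  case 0
  have "continuous (at x within S) f" if x: "x \<in> S" for x
  proof -
    obtain T where T: "openin (top_of_set S) T" "x \<in> T" "continuous_on T f"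
      using 0[OF x] by auto
    then have "continuous (at x within T) f" by (simp add: continuous_on_eq_continuous_within)
    then show ?thesis unfolding at_within_openin[OF T(1,2)] .
  qed
  then show ?case by (simp add: continuous_on_eq_continuous_within)
next
  case (Suc k)
  have "Ck_on k S (partial S i f)" for i
  proof (rule Suc.IH)
    fix x assume "x \<in> S"
    then obtain T where T: "openin (top_of_set S) T" "x \<in> T" "Ck_on (Suc k) T f"
      using Suc.prems by blast
    then have "Ck_on k T (partial S i f)"
      using Ck_on_cong[of T "partial T i f" "partial S i f" k] partial_openin[OF T(1)] by auto
    with T show "\<exists>T. openin (top_of_set S) T \<and> x \<in> T \<and> Ck_on k T (partial S i f)" by blast
  qed
  moreover have "f differentiable (at x within S)" if x: "x \<in> S" for x
  proof -
    obtain T where T: "openin (top_of_set S) T" "x \<in> T" "Ck_on (Suc k) T f"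
      using Suc.prems[OF x] by blast
    then have "f differentiable (at x within T)" by (simp add: differentiable_on_def)
    then show ?thesis unfolding at_within_openin[OF T(1,2)] .
  qed
  ultimately show ?case by (simp add: differentiable_on_def)
qed

lemma has_derivative_vec_iff:
  fixes f :: "'a::real_normed_vector \<Rightarrow> 'b::euclidean_space ^ 'j"
  shows "(f has_derivative f') (at x within S) \<longleftrightarrow>
    (\<forall>j. ((\<lambda>x. f x $ j) has_derivative (\<lambda>v. f' v $ j)) (at x within S))"
  unfolding has_derivative_componentwise_within[of f] has_derivative_componentwise_within[of "\<lambda>x. f x $ j" for j]
  by (auto simp: Basis_vec_def inner_axis)

lemma differentiable_vec_iff:
  fixes f :: "'a::real_normed_vector \<Rightarrow> 'b::euclidean_space ^ 'j"
  shows "f differentiable (at x within S) \<longleftrightarrow> (\<forall>j. (\<lambda>x. f x $ j) differentiable (at x within S))"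
proof
  assume "\<forall>j. (\<lambda>x. f x $ j) differentiable (at x within S)"
  then obtain f' where "\<And>j. ((\<lambda>x. f x $ j) has_derivative f' j) (at x within S)"
    unfolding differentiable_def by metis
  then have "(f has_derivative (\<lambda>v. \<chi> j. f' j v)) (at x within S)"
    by (simp add: has_derivative_vec_iff)
  then show "f differentiable (at x within S)" by (rule differentiableI)
qed (auto simp: differentiable_def has_derivative_vec_iff)

lemma partial_vec_nth:
  fixes f :: "real ^ 'k \<Rightarrow> 'b::euclidean_space ^ 'j"
  assumes "corner_open S" "x \<in> S" "f differentiable (at x within S)"
  shows "partial S i (\<lambda>x. f x $ j) x = partial S i f x $ j"
proof -
  have "(f has_derivative frechet_derivative f (at x within S)) (at x within S)"
    using assms(3) frechet_derivative_works by blast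
  then have "((\<lambda>x. f x $ j) has_derivative (\<lambda>v. frechet_derivative f (at x within S) v $ j)) (at x within S)"
    by (simp add: has_derivative_vec_iff)
  from partial_eqI[OF assms(1,2) this] show ?thesis by (simp add: partial_def[of S i f])
qed

lemma Ck_on_vec_iff:
  fixes f :: "real ^ 'k \<Rightarrow> 'b::euclidean_space ^ 'j"
  assumes "corner_open S"
  shows "Ck_on k S f \<longleftrightarrow> (\<forall>j. Ck_on k S (\<lambda>x. f x $ j))"
proof (induction k arbitrary: f)
  case 0
  have "f = (\<lambda>x. \<chi> j. f x $ j)" by simp
  then show ?case
    using continuous_on_vec_lambda[of S "\<lambda>j x. f x $ j"] by (auto intro: continuous_on_component)
next
  case (Suc k)
  have d: "f differentiable_on S \<longleftrightarrow> (\<forall>j. (\<lambda>x. f x $ j) differentiable_on S)"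
    by (auto simp: differentiable_on_def differentiable_vec_iff[of f])
  show ?case
  proof (cases "f differentiable_on S")
    case True
    then have "Ck_on k S (partial S i (\<lambda>x. f x $ j)) \<longleftrightarrow> Ck_on k S (\<lambda>x. partial S i f x $ j)" for i j
      by (intro Ck_on_cong partial_vec_nth[OF assms]) (auto simp: differentiable_on_def)
    then show ?thesis using d True by (auto simp: Suc.IH)
  qed (use d in auto)
qed

lemma Ck_on_Cfam:
  "Ck_on k S f \<longleftrightarrow> Cfam (\<lambda>f. continuous_on S (f ())) k S (\<lambda>_. f)"
  by (induction k arbitrary: f) (auto intro: differentiable_imp_continuous_on)

lemma smooth_families_continuous:
  assumes "corner_open (S :: (real ^ 'k) set)"
  shows "smooth_families S (\<lambda>f. continuous_on S (f ()))"
proof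
  fix f :: "unit \<Rightarrow> real ^ 'k \<Rightarrow> real" and a :: real
  assume "continuous_on S (f ())" and pos: "\<And>w x. x \<in> S \<Longrightarrow> 0 < f w x"
  then show "continuous_on S (\<lambda>x. f () x powr a)"
    by (intro continuous_on_powr continuous_on_const) (use pos in force)+
next
  fix f g :: "unit \<Rightarrow> real ^ 'k \<Rightarrow> real"
  assume "continuous_on S (f ())" "\<And>w x. x \<in> S \<Longrightarrow> f w x = g w x"
  then show "continuous_on S (g ())" by (rule continuous_on_eq)
qed (auto intro: assms continuous_intros)

context
  fixes S :: "(real ^ 'k) set"
  assumes S: "corner_open S"
begin

interpretation smooth_families S "\<lambda>f. continuous_on S (f ())"
  by (rule smooth_families_continuous[OF S])

lemma Ck_on_mono: "Ck_on k S (f :: _ \<Rightarrow> real) \<Longrightarrow> j \<le> k \<Longrightarrow> Ck_on j S f"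
  unfolding Ck_on_Cfam by (rule C_mono)

lemma Ck_on_SucI:
  assumes "\<And>x. x \<in> S \<Longrightarrow> (f has_derivative D x) (at x within S)"
    and "\<And>i. Ck_on k S (\<lambda>x. D x (axis i 1) :: real)"
  shows "Ck_on (Suc k) S f"
  unfolding Ck_on_Cfam
proof (rule C_SucI[where D="\<lambda>_. D"])
  show "continuous_on S f" using assms(1)
    by (meson differentiable_def differentiable_imp_continuous_on differentiable_on_def)
qed (use assms in \<open>auto simp: Ck_on_Cfam\<close>)

lemma Ck_on_const: "Ck_on k S (\<lambda>x. c :: real)"
  unfolding Ck_on_Cfam by (rule C_const)

lemma Ck_on_add: "Ck_on k S f \<Longrightarrow> Ck_on k S g \<Longrightarrow> Ck_on k S (\<lambda>x. f x + g x :: real)"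
  unfolding Ck_on_Cfam by (rule C_add)

lemma Ck_on_diff: "Ck_on k S f \<Longrightarrow> Ck_on k S g \<Longrightarrow> Ck_on k S (\<lambda>x. f x - g x :: real)"
  unfolding Ck_on_Cfam by (rule C_diff)

lemma Ck_on_mult: "Ck_on k S f \<Longrightarrow> Ck_on k S g \<Longrightarrow> Ck_on k S (\<lambda>x. f x * g x :: real)"
  unfolding Ck_on_Cfam by (rule C_mult)

lemma Ck_on_sum: "(\<And>j. j \<in> J \<Longrightarrow> Ck_on k S (f j)) \<Longrightarrow> Ck_on k S (\<lambda>x. \<Sum>j\<in>J. f j x :: real)"
  unfolding Ck_on_Cfam by (rule C_sum)

lemma Ck_on_powr: "Ck_on k S f \<Longrightarrow> (\<And>x. x \<in> S \<Longrightarrow> 0 < f x) \<Longrightarrow> Ck_on k S (\<lambda>x. f x powr a :: real)"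
  unfolding Ck_on_Cfam by (rule C_powr)

lemma Ck_on_matrix_inv:
  fixes G :: "real ^ 'k \<Rightarrow> real ^ 'j ^ 'j::finite"
  assumes "\<And>i j. Ck_on k S (\<lambda>x. G x $ i $ j)" "\<And>x. x \<in> S \<Longrightarrow> det (G x) \<noteq> 0"
  shows "Ck_on k S (\<lambda>x. matrix_inv (G x) $ i $ j)"
  using assms unfolding Ck_on_Cfam by (rule C_matrix_inv)

lemma Ck_on_vec_nth: "Ck_on k S (\<lambda>x. x $ j :: real)"
proof (cases k)
  case (Suc k')
  show ?thesis unfolding Suc
    by (rule Ck_on_SucI[where D="\<lambda>x v. v $ j"])
      (auto intro!: Ck_on_const bounded_linear_imp_has_derivative bounded_linear_vec_nth)
qed (auto intro: continuous_intros)

end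

text \<open>By the chain rule the partial derivatives of the composite are sums of products of
  derivatives of \<tau> with derivatives of f composed with the same \<tau>; the induction therefore
  varies f and keeps \<tau>.\<close>

lemma Ck_on_compose:
  fixes \<tau> :: "real ^ 'k \<Rightarrow> real ^ 'l"
  assumes "corner_open S" "corner_open T" "\<tau> ` S \<subseteq> T"
    and "Ck_on k T (f :: _ \<Rightarrow> real)" "\<And>j. Ck_on k S (\<lambda>x. \<tau> x $ j)"
  shows "Ck_on k S (\<lambda>x. f (\<tau> x))"
  using assms(4,5)
proof (induction k arbitrary: f)
  case 0
  have "continuous_on S \<tau>"
    using 0(2) continuous_on_vec_lambda[of S "\<lambda>j x. \<tau> x $ j"] by simp
  then show ?case using 0(1) assms(3) by (auto intro: continuous_on_compose2)
next
  case (Suc k)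
  show ?case
  proof (rule Ck_on_SucI[OF assms(1)])
    fix x assume x: "x \<in> S"
    have "(f has_derivative (\<lambda>v. \<Sum>a\<in>UNIV. v $ a *\<^sub>R partial T a f (\<tau> x))) (at (\<tau> x) within T)"
      using x assms(3) Suc.prems(1) by (intro has_derivative_partials) (auto simp: differentiable_on_def)
    then have 1: "(f has_derivative (\<lambda>v. \<Sum>a\<in>UNIV. v $ a *\<^sub>R partial T a f (\<tau> x))) (at (\<tau> x) within \<tau> ` S)"
      using assms(3) by (rule has_derivative_subset)
    have 2: "(\<tau> has_derivative (\<lambda>v. \<chi> a. \<Sum>i\<in>UNIV. v $ i *\<^sub>R partial S i (\<lambda>x. \<tau> x $ a) x)) (at x within S)"
      unfolding has_derivative_vec_iff
      using x Suc.prems(2) by (simp add: differentiable_on_def has_derivative_partials del: real_scaleR_def)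
    show "((\<lambda>x. f (\<tau> x)) has_derivative (\<lambda>v. \<Sum>a\<in>UNIV.
        (\<Sum>i\<in>UNIV. v $ i * partial S i (\<lambda>x. \<tau> x $ a) x) * partial T a f (\<tau> x))) (at x within S)"
      using has_derivative_in_compose[OF 2 1] by simp
  next
    fix i
    have "Ck_on k S (\<lambda>x. \<tau> x $ a)" for a
      using Suc.prems(2) by (rule Ck_on_mono[OF assms(1)]) simp
    then show "Ck_on k S (\<lambda>x. \<Sum>a\<in>UNIV.
        (\<Sum>j\<in>UNIV. axis i 1 $ j * partial S j (\<lambda>x. \<tau> x $ a) x) * partial T a f (\<tau> x))"
      unfolding sum_axis
    proof (intro Ck_on_sum[OF assms(1)] Ck_on_mult[OF assms(1)])
      show "Ck_on k S (\<lambda>x. partial T a f (\<tau> x))" for a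
        by (rule Suc.IH) (use Suc.prems(1) in simp, fact)
    qed (use Suc.prems(2) in simp)
  qed
qed

subsection \<open>Symmetry of the mixed partial derivatives\<close>

lemma has_derivative_axis_line:
  fixes f :: "real ^ 'k \<Rightarrow> real"
  assumes "f differentiable (at (p + s *\<^sub>R axis i 1) within S)"
    and "\<And>t. t \<in> I \<Longrightarrow> p + t *\<^sub>R axis i 1 \<in> S"
  shows "((\<lambda>t. f (p + t *\<^sub>R axis i 1)) has_derivative (\<lambda>t. t * partial S i f (p + s *\<^sub>R axis i 1))) (at s within I)"
proof -
  let ?D = "frechet_derivative f (at (p + s *\<^sub>R axis i 1) within S)"
  have D: "(f has_derivative ?D) (at (p + s *\<^sub>R axis i 1) within S)"
    using assms(1) frechet_derivative_works by blast
  then interpret linear ?D by (rule has_derivative_linear)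
  have "((\<lambda>t. f (p + t *\<^sub>R axis i 1)) has_derivative (\<lambda>t. ?D (t *\<^sub>R axis i 1))) (at s within I)"
    by (rule has_derivative_in_compose[where f="\<lambda>t. p + t *\<^sub>R axis i 1"])
      (use assms(2) in \<open>auto intro!: derivative_eq_intros has_derivative_subset[OF D]\<close>)
  then show ?thesis by (simp add: scale partial_def)
qed

text \<open>Two applications of the mean value theorem: along axis i to the difference of f on two
  opposite sides of the square, then along axis j to the partial derivative just obtained. Only the
  square itself has to lie in S, so x may be a boundary point.\<close>

lemma second_difference:
  fixes f :: "real ^ 'k \<Rightarrow> real"
  assumes "Ck_on 2 S f" "i \<noteq> j" "0 < h"
    and S: "\<And>s t. 0 \<le> s \<Longrightarrow> s \<le> h \<Longrightarrow> 0 \<le> t \<Longrightarrow> t \<le> h \<Longrightarrow> x + s *\<^sub>R axis i 1 + t *\<^sub>R axis j 1 \<in> S"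
  obtains s t where "0 < s" "s < h" "0 < t" "t < h"
    "f (x + h *\<^sub>R axis i 1 + h *\<^sub>R axis j 1) - f (x + h *\<^sub>R axis i 1) - f (x + h *\<^sub>R axis j 1) + f x
      = h * (h * partial S j (partial S i f) (x + s *\<^sub>R axis i 1 + t *\<^sub>R axis j 1))"
proof -
  have f: "f differentiable_on S" and f1: "partial S i f differentiable_on S"
    using assms(1) by (auto simp: numeral_2_eq_2)
  have S0: "x + s *\<^sub>R axis i 1 \<in> S" if "0 \<le> s" "s \<le> h" for s
    using S[of s 0] that assms(3) by simp
  have S1: "(x + h *\<^sub>R axis j 1) + s *\<^sub>R axis i 1 \<in> S" if "0 \<le> s" "s \<le> h" for s
    using S[of s h] that assms(3) by (simp add: algebra_simps)
  let ?y = "x + h *\<^sub>R axis j 1"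
  have "\<exists>s\<in>{0<..<h}.
      (f (?y + h *\<^sub>R axis i 1) - f (x + h *\<^sub>R axis i 1)) - (f (?y + 0 *\<^sub>R axis i 1) - f (x + 0 *\<^sub>R axis i 1))
      = (h - 0) * partial S i f (?y + s *\<^sub>R axis i 1) - (h - 0) * partial S i f (x + s *\<^sub>R axis i 1)"
  proof (rule mvt_simple[OF assms(3)])
    fix s assume s: "0 \<le> s" "s \<le> h"
    have "((\<lambda>s. f (?y + s *\<^sub>R axis i 1)) has_derivative (\<lambda>t. t * partial S i f (?y + s *\<^sub>R axis i 1))) (at s within {0..h})"
      by (rule has_derivative_axis_line) (use f S1 s in \<open>simp_all add: differentiable_on_def\<close>)
    moreover have "((\<lambda>s. f (x + s *\<^sub>R axis i 1)) has_derivative (\<lambda>t. t * partial S i f (x + s *\<^sub>R axis i 1))) (at s within {0..h})"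
      by (rule has_derivative_axis_line) (use f S0 s in \<open>simp_all add: differentiable_on_def\<close>)
    ultimately show "((\<lambda>s. f (?y + s *\<^sub>R axis i 1) - f (x + s *\<^sub>R axis i 1)) has_derivative
        (\<lambda>t. t * partial S i f (?y + s *\<^sub>R axis i 1) - t * partial S i f (x + s *\<^sub>R axis i 1))) (at s within {0..h})"
      by (rule has_derivative_diff)
  qed
  then obtain s where s: "0 < s" "s < h" and eq:
    "f ((x + h *\<^sub>R axis j 1) + h *\<^sub>R axis i 1) - f (x + h *\<^sub>R axis i 1) - (f (x + h *\<^sub>R axis j 1) - f x)
      = h * partial S i f ((x + h *\<^sub>R axis j 1) + s *\<^sub>R axis i 1) - h * partial S i f (x + s *\<^sub>R axis i 1)"
    by auto
  let ?z = "x + s *\<^sub>R axis i 1"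
  have "\<exists>t\<in>{0<..<h}. partial S i f (?z + h *\<^sub>R axis j 1) - partial S i f (?z + 0 *\<^sub>R axis j 1)
      = (h - 0) * partial S j (partial S i f) (?z + t *\<^sub>R axis j 1)"
  proof (rule mvt_simple[OF assms(3)])
    fix t assume t: "0 \<le> t" "t \<le> h"
    show "((\<lambda>t. partial S i f (?z + t *\<^sub>R axis j 1)) has_derivative
        (\<lambda>r. r * partial S j (partial S i f) (?z + t *\<^sub>R axis j 1))) (at t within {0..h})"
      by (rule has_derivative_axis_line) (use f1 S s t in \<open>simp_all add: differentiable_on_def\<close>)
  qed
  then obtain t where t: "0 < t" "t < h" and eq2:
    "partial S i f ((x + s *\<^sub>R axis i 1) + h *\<^sub>R axis j 1) - partial S i f (x + s *\<^sub>R axis i 1)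
      = h * partial S j (partial S i f) ((x + s *\<^sub>R axis i 1) + t *\<^sub>R axis j 1)"
    by auto
  have "f (x + h *\<^sub>R axis i 1 + h *\<^sub>R axis j 1) - f (x + h *\<^sub>R axis i 1) - f (x + h *\<^sub>R axis j 1) + f x
      = h * (partial S i f ((x + s *\<^sub>R axis i 1) + h *\<^sub>R axis j 1) - partial S i f (x + s *\<^sub>R axis i 1))"
    using eq by (simp add: algebra_simps)
  with s t show thesis unfolding eq2 by (rule that)
qed

text \<open>The second difference is symmetric in the two directions, so
  \<open>second_difference\<close> represents it by either mixed derivative, each at some point of a
  shrinking square; continuity moves both points to x.\<close>

lemma partial_commute:
  fixes f :: "real ^ 'k \<Rightarrow> real"
  assumes "corner_open S" "Ck_on 2 S f" "x \<in> S"
  shows "partial S i (partial S j f) x = partial S j (partial S i f) x"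
proof (cases "i = j")
  case False
  obtain e where e: "e > 0" "\<And>v. (\<And>i. 0 \<le> v $ i \<and> v $ i < e) \<Longrightarrow> x + v \<in> S"
    using corner_openD[OF assms(1,3)] by blast
  \<comment> \<open>Side lengths that tend to 0 and stay below e, so that every square lies in the
    corner at x.\<close>
  define h where "h n = e / 2 * inverse (real (Suc n))" for n
  have h: "0 < h n" "h n < e" for n
  proof -
    have "inverse (real (Suc n)) \<le> 1" by (simp add: inverse_le_1_iff)
    then have "h n \<le> e / 2 * 1" unfolding h_def using e(1) by (intro mult_left_mono) auto
    then show "h n < e" using e(1) by simp
  qed (use e(1) in \<open>simp add: h_def\<close>)
  have h0: "h \<longlonglongrightarrow> 0"
    unfolding h_def by (intro tendsto_mult_right_zero LIMSEQ_inverse_real_of_nat)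
  have in_S: "x + s *\<^sub>R axis a 1 + t *\<^sub>R axis b 1 \<in> S"
    if "a \<noteq> b" "0 \<le> s" "s \<le> h n" "0 \<le> t" "t \<le> h n" for a b s t n
    using e(2)[of "s *\<^sub>R axis a 1 + t *\<^sub>R axis b 1"] that h[of n] e(1)
    by (auto simp: axis_def add.assoc)
  define R where "R a b n p \<longleftrightarrow>
      f (x + h n *\<^sub>R axis a 1 + h n *\<^sub>R axis b 1) - f (x + h n *\<^sub>R axis a 1) - f (x + h n *\<^sub>R axis b 1) + f x
      = h n * (h n * partial S b (partial S a f) p)" for a b n p
  have *: "\<exists>p. p \<longlonglongrightarrow> x \<and> (\<forall>n. p n \<in> S \<and> R a b n (p n))" if "a \<noteq> b" for a b
  proof -
    have "\<exists>s t. 0 < s \<and> s < h n \<and> 0 < t \<and> t < h n \<and> R a b n (x + s *\<^sub>R axis a 1 + t *\<^sub>R axis b 1)" for n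
    proof (rule second_difference[OF assms(2) that h(1)[of n], of x])
      show "x + s *\<^sub>R axis a 1 + t *\<^sub>R axis b 1 \<in> S" if "0 \<le> s" "s \<le> h n" "0 \<le> t" "t \<le> h n" for s t
        using in_S[OF \<open>a \<noteq> b\<close> that] .
    qed (unfold R_def, blast)
    then obtain s t where st: "\<And>n. 0 < s n \<and> s n < h n \<and> 0 < t n \<and> t n < h n \<and>
        R a b n (x + s n *\<^sub>R axis a 1 + t n *\<^sub>R axis b 1)"
      by metis
    have "s \<longlonglongrightarrow> 0" "t \<longlonglongrightarrow> 0"
      by (rule tendsto_sandwich[OF _ _ tendsto_const h0], use st in \<open>auto intro: always_eventually less_imp_le\<close>)+
    then have "(\<lambda>n. x + s n *\<^sub>R axis a 1 + t n *\<^sub>R axis b 1) \<longlonglongrightarrow> x + 0 *\<^sub>R axis a 1 + 0 *\<^sub>R axis b 1"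
      by (intro tendsto_intros)
    moreover have "x + s n *\<^sub>R axis a 1 + t n *\<^sub>R axis b 1 \<in> S" for n
      by (rule in_S[OF that, where n=n]) (use st[of n] in auto)
    ultimately show ?thesis
      using st by (intro exI[of _ "\<lambda>n. x + s n *\<^sub>R axis a 1 + t n *\<^sub>R axis b 1"]) simp
  qed
  obtain p q where p: "p \<longlonglongrightarrow> x" "\<And>n. p n \<in> S" "\<And>n. R i j n (p n)"
    and q: "q \<longlonglongrightarrow> x" "\<And>n. q n \<in> S" "\<And>n. R j i n (q n)"
    using *[of i j] *[of j i] False by metis
  have eq: "partial S j (partial S i f) (p n) = partial S i (partial S j f) (q n)" for n
  proof -
    have "h n * (h n * partial S j (partial S i f) (p n)) = h n * (h n * partial S i (partial S j f) (q n))"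
      using p(3)[of n] q(3)[of n] unfolding R_def by (simp add: algebra_simps)
    then show ?thesis using h(1)[of n] by simp
  qed
  have "continuous_on S (partial S b (partial S a f))" for a b
    using assms(2) by (simp add: numeral_2_eq_2)
  then have "(\<lambda>n. partial S j (partial S i f) (p n)) \<longlonglongrightarrow> partial S j (partial S i f) x"
    and "(\<lambda>n. partial S i (partial S j f) (q n)) \<longlonglongrightarrow> partial S i (partial S j f) x"
    using continuous_on_tendsto_compose[OF _ p(1) assms(3)] continuous_on_tendsto_compose[OF _ q(1) assms(3)] p q
    by (auto intro: always_eventually)
  then show ?thesis
    unfolding eq using LIMSEQ_unique by blast
qed simp

subsection \<open>Iterated partial derivatives\<close>

lemma partials_append: "partials S (us @ vs) f = partials S vs (partials S us f)"
  by (induction us arbitrary: f) auto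

lemma partials_cong:
  assumes "\<And>x. x \<in> S \<Longrightarrow> f x = g x" "x \<in> S"
  shows "partials S is f x = partials S is g x"
  using assms
proof (induction "is" arbitrary: f g)
  case (Cons i "is")
  have "partials S is (partial S i f) x = partials S is (partial S i g) x"
    using Cons.prems by (intro Cons.IH partial_cong) auto
  then show ?case by simp
qed simp

lemma Ck_on_partials:
  "Ck_on (length is + k) S f \<Longrightarrow> Ck_on k S (partials S is f)"
  by (induction "is" arbitrary: f) auto

lemma partials_snoc:
  fixes f :: "real ^ 'k \<Rightarrow> real"
  assumes S: "corner_open S" and "Ck_on (Suc (length us)) S f" "x \<in> S"
  shows "partials S (us @ [i]) f x = partials S (i # us) f x"
  using assms(2,3)
proof (induction us arbitrary: f x)
  case (Cons a us)
  have f: "Ck_on 2 S f" by (rule Ck_on_mono[OF S Cons.prems(1)]) simp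
  have "partials S ((a # us) @ [i]) f x = partials S us (partial S i (partial S a f)) x"
    using Cons.IH[of "partial S a f" x] Cons.prems by simp
  also have "\<dots> = partials S us (partial S a (partial S i f)) x"
    by (rule partials_cong[OF partial_commute[OF S f] Cons.prems(2)])
  finally show ?case by simp
qed simp

text \<open>The head of \<open>is\<close> is located in \<open>js\<close> and moved to the front by
  \<open>partials_snoc\<close>; both lists then begin with the same derivative and the induction
  proceeds.\<close>

lemma partials_perm:
  fixes f :: "real ^ 'k \<Rightarrow> real"
  assumes S: "corner_open S" and "Ck_on (length is) S f" "mset is = mset js" "x \<in> S"
  shows "partials S is f x = partials S js f x"
  using assms(2-4)
proof (induction "is" arbitrary: f js x)
  case (Cons i "is")
  have "i \<in> set js" using Cons.prems(2) by (metis list.set_intros(1) set_mset_mset)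
  then obtain us vs where js: "js = us @ i # vs" by (meson split_list)
  have "length us + length vs = length is"
    using arg_cong[OF Cons.prems(2), of size] by (simp add: js)
  then have us: "Ck_on (Suc (length us)) S f"
    by (intro Ck_on_mono[OF S Cons.prems(1)]) simp
  have "partials S js f x = partials S vs (partials S (us @ [i]) f) x"
    by (simp add: js partials_append)
  also have "\<dots> = partials S vs (partials S (i # us) f) x"
    by (rule partials_cong[OF partials_snoc[OF S us] Cons.prems(3)])
  also have "\<dots> = partials S (us @ vs) (partial S i f) x"
    by (simp add: partials_append)
  also have "\<dots> = partials S is (partial S i f) x"
    using Cons.prems js by (intro Cons.IH[symmetric]) auto
  finally show ?case by simp
qed simp

text \<open>Whatever list the choice operator picks has the same multiset as \<open>is\<close>. From
  here on derivatives are handled as lists, which fit the recursion of \<open>Ck_on\<close> and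
  \<open>Cfam\<close>.\<close>

lemma multi_partial_eq:
  fixes f :: "real ^ 'k \<Rightarrow> real"
  assumes "corner_open S" "Ck_on (length is) S f" "x \<in> S"
  shows "multi_partial S (count_list is) f x = partials S is f x"
proof -
  let ?js = "SOME js. \<forall>i. count_list js i = count_list is i"
  have "\<forall>i. count_list ?js i = count_list is i"
    by (rule someI_ex) auto
  then have "mset is = mset ?js"
    by (intro multiset_eqI) (simp add: count_mset)
  from partials_perm[OF assms(1,2) this assms(3)] show ?thesis
    by (simp add: multi_partial_def)
qed

lemma ex_count_list:
  fixes \<beta> :: "'k::finite \<Rightarrow> nat"
  obtains "is" where "count_list is = \<beta>" "length is = (\<Sum>i\<in>UNIV. \<beta> i)"
proof -
  obtain xs where xs: "mset xs = Abs_multiset \<beta>" using ex_mset by blast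
  have "count (Abs_multiset \<beta>) = \<beta>" by (rule count_Abs_multiset) simp
  then have "count_list xs = \<beta>" using xs by (metis count_mset ext)
  moreover have "length xs = (\<Sum>i\<in>UNIV. count_list xs i)"
    by (simp add: sum_count_set)
  ultimately show thesis using that by simp
qed

lemma partial_linear:
  fixes f g :: "real ^ 'k \<Rightarrow> real"
  assumes "corner_open S" "f differentiable_on S" "g differentiable_on S" "x \<in> S"
  shows "partial S i (\<lambda>x. a * f x + b * g x) x = a * partial S i f x + b * partial S i g x"
proof -
  have "((\<lambda>x. a * f x + b * g x) has_derivative
     (\<lambda>v. a * (\<Sum>i\<in>UNIV. v $ i *\<^sub>R partial S i f x) + b * (\<Sum>i\<in>UNIV. v $ i *\<^sub>R partial S i g x))) (at x within S)"
    using assms by (intro has_derivative_add has_derivative_mult_right has_derivative_partials)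
      (auto simp: differentiable_on_def)
  from partial_eqI[OF assms(1,4) this] show ?thesis
    by (simp only: real_scaleR_def sum_axis)
qed

lemma partials_linear:
  fixes f g :: "real ^ 'k \<Rightarrow> real"
  assumes "corner_open S" "Ck_on (length is) S f" "Ck_on (length is) S g" "x \<in> S"
  shows "partials S is (\<lambda>x. a * f x + b * g x) x = a * partials S is f x + b * partials S is g x"
  using assms(2-4)
proof (induction "is" arbitrary: f g x)
  case (Cons i "is")
  have "partials S (i # is) (\<lambda>x. a * f x + b * g x) x
      = partials S is (\<lambda>x. a * partial S i f x + b * partial S i g x) x"
    using Cons.prems by (simp, intro partials_cong partial_linear assms(1)) auto
  also have "\<dots> = a * partials S (i # is) f x + b * partials S (i # is) g x"
    using Cons.prems by (simp add: Cons.IH)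
  finally show ?case .
qed simp

subsection \<open>Convergence of jets along a sequence of points\<close>

text \<open>The index \<open>None\<close> stands for the limit function, evaluated at the limit
  point x, and \<open>Some k\<close> for the k-th member, evaluated at \<open>y k\<close>. A
  sequence and its limit thus form one family, to which the calculus applies at once.\<close>

definition values_converge ::
  "(nat \<Rightarrow> real ^ 'k) \<Rightarrow> real ^ 'k \<Rightarrow> (nat option \<Rightarrow> real ^ 'k \<Rightarrow> real) \<Rightarrow> bool" where
  "values_converge y x f \<longleftrightarrow> (\<lambda>k. f (Some k) (y k)) \<longlonglongrightarrow> f None x"

lemma smooth_families_values_converge:
  assumes "corner_open S" "\<And>k. y k \<in> S" "x \<in> S"
  shows "smooth_families S (values_converge y x)"
proof
  fix f :: "nat option \<Rightarrow> real ^ 'a \<Rightarrow> real" and a :: real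
  assume "values_converge y x f" and pos: "\<And>w x. x \<in> S \<Longrightarrow> 0 < f w x"
  then show "values_converge y x (\<lambda>w x. f w x powr a)"
    using pos[OF assms(3), of None] unfolding values_converge_def
    by (intro tendsto_powr tendsto_const) auto
qed (use assms in \<open>auto simp: values_converge_def intro: tendsto_intros\<close>)

lemma Cfam_partialsI:
  assumes "\<And>w. Ck_on k S (f w)" "\<And>is. length is \<le> k \<Longrightarrow> P (\<lambda>w. partials S is (f w))"
  shows "Cfam P k S f"
  using assms
proof (induction k arbitrary: f)
  case 0 then show ?case using 0(2)[of "[]"] by simp
next
  case (Suc k)
  have "Cfam P k S (\<lambda>w. partial S i (f w))" for i
    using Suc.prems(1) Suc.prems(2)[of "i # _"] by (intro Suc.IH) auto
  then show ?case using Suc.prems(1) Suc.prems(2)[of "[]"] by simp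
qed

subsection \<open>Restriction to the boundary of the half space\<close>

lemma sum_UNIV_option: "(\<Sum>i\<in>UNIV. f i) = f None + (\<Sum>i\<in>UNIV. f (Some (i :: 'n::finite)))"
  by (simp add: UNIV_option_conv sum.reindex)

lemma bd_embed_nth [simp]: "bd_embed y $ None = 0" "bd_embed y $ Some i = y $ i"
  by (auto simp: bd_embed_def)

lemma linear_bd_embed: "linear bd_embed"
  by (rule linearI) (auto simp: vec_eq_iff bd_embed_def split: option.split)

lemma bd_embed_tangential: "x $ None = 0 \<Longrightarrow> bd_embed (\<chi> i. x $ Some i) = x"
  by (auto simp: vec_eq_iff bd_embed_def split: option.split)

lemma bd_embed_halfspace: "bd_embed y \<in> halfspace"
  by (simp add: halfspace_def)

lemma continuous_on_bd_embed: "continuous_on S bd_embed"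
  using linear_bd_embed by (rule linear_continuous_on[OF linear_conv_bounded_linear[THEN iffD1]])

lemma open_bd_embed_vimage:
  assumes "openin (top_of_set halfspace) S"
  shows "open {y. bd_embed y \<in> S}"
proof -
  obtain U where U: "open U" "S = halfspace \<inter> U" using assms by (auto simp: openin_open)
  have "{y. bd_embed y \<in> S} = bd_embed -` U" using U(2) bd_embed_halfspace by auto
  then show ?thesis by (simp add: open_vimage[OF U(1) continuous_on_bd_embed])
qed

text \<open>The points y with \<open>bd_embed y\<close> in S form an open set of R^n, so the
  derivative within S, possibly one-sided in the transversal direction, restricts to a full
  derivative along the boundary.\<close>

lemma has_derivative_bd_embed:
  fixes f :: "real ^ 'n::finite option \<Rightarrow> real"
  assumes "openin (top_of_set halfspace) S" "bd_embed y \<in> S" "f differentiable (at (bd_embed y) within S)"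
  shows "((\<lambda>y. f (bd_embed y)) has_derivative
     (\<lambda>v. \<Sum>i\<in>UNIV. v $ i * partial S (Some i) f (bd_embed y))) (at y)"
proof -
  let ?O = "{y. bd_embed y \<in> S}"
  have "(bd_embed has_derivative bd_embed) (at y within ?O)"
    using linear_bd_embed by (intro bounded_linear_imp_has_derivative) (simp add: linear_conv_bounded_linear)
  moreover have "(f has_derivative (\<lambda>v. \<Sum>i\<in>UNIV. v $ i *\<^sub>R partial S i f (bd_embed y))) (at (bd_embed y) within bd_embed ` ?O)"
    by (rule has_derivative_subset[OF has_derivative_partials[OF assms(3)]]) auto
  ultimately have "((\<lambda>y. f (bd_embed y)) has_derivative
      (\<lambda>v. \<Sum>i\<in>UNIV. bd_embed v $ i *\<^sub>R partial S i f (bd_embed y))) (at y within ?O)"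
    by (rule has_derivative_in_compose)
  moreover have "at y within ?O = at y"
    using assms(2) by (intro at_within_open open_bd_embed_vimage[OF assms(1)]) simp
  ultimately show ?thesis
    by (simp only: sum_UNIV_option bd_embed_nth mult_zero_left add_0_left real_scaleR_def)
qed

lemma partial_bd_embed:
  fixes f :: "real ^ 'n::finite option \<Rightarrow> real"
  assumes "openin (top_of_set halfspace) S" "bd_embed y \<in> S" "f differentiable (at (bd_embed y) within S)"
  shows "partial UNIV i (\<lambda>y. f (bd_embed y)) y = partial S (Some i) f (bd_embed y)"
  using partial_eqI[OF open_imp_corner_open[OF open_UNIV] _ has_derivative_bd_embed[OF assms], of i]
  by (simp only: sum_axis UNIV_I)

lemma partial_UNIV_cong:
  assumes "open W" "y \<in> W" "\<And>z. z \<in> W \<Longrightarrow> f z = g z"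
  shows "partial UNIV i f y = partial UNIV i g y"
proof -
  have W: "openin (top_of_set UNIV) W" using assms(1) by simp
  show ?thesis
    unfolding partial_openin[OF W assms(2), symmetric] by (rule partial_cong[OF assms(3,2)])
qed

lemma hessian_bd_embed:
  fixes f :: "real ^ 'n::finite option \<Rightarrow> real"
  assumes S: "openin (top_of_set halfspace) S" and y: "bd_embed y \<in> S" and f: "Ck_on 2 S f"
    and W: "open W" "y \<in> W" "\<And>z. z \<in> W \<Longrightarrow> F z = f (bd_embed z)"
  shows "hessian F y $ i $ j = partial S (Some i) (partial S (Some j) f) (bd_embed y)"
proof -
  let ?W = "W \<inter> {y. bd_embed y \<in> S}"
  have op: "open ?W" using W(1) open_bd_embed_vimage[OF S] by blast
  have f1: "f differentiable_on S" "partial S (Some j) f differentiable_on S"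
    using f by (auto simp: numeral_2_eq_2)
  have "partial UNIV j F z = partial S (Some j) f (bd_embed z)" if "z \<in> ?W" for z
  proof -
    have "partial UNIV j F z = partial UNIV j (\<lambda>z. f (bd_embed z)) z"
      using that by (intro partial_UNIV_cong[OF W(1) _ W(3)]) auto
    then show ?thesis using partial_bd_embed[OF S, of z f j] that f1 by (simp add: differentiable_on_def)
  qed
  then have "partial UNIV i (partial UNIV j F) y = partial UNIV i (\<lambda>z. partial S (Some j) f (bd_embed z)) y"
    using op W(2) y by (intro partial_UNIV_cong[of ?W]) auto
  also have "\<dots> = partial S (Some i) (partial S (Some j) f) (bd_embed y)"
    using f1(2) y by (intro partial_bd_embed[OF S]) (auto simp: differentiable_on_def)
  finally show ?thesis by (simp add: hessian_def)
qed

section \<open>Mean curvature in a chart\<close>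

definition pos_def :: "real ^ 'k ^ 'k \<Rightarrow> bool" where
  "pos_def B \<longleftrightarrow> transpose B = B \<and> (\<forall>v. v \<noteq> 0 \<longrightarrow> 0 < v \<bullet> (B *v v))"

lemma symmetric_matrix_nth: "transpose B = B \<Longrightarrow> B $ i $ j = B $ j $ i"
proof -
  assume "transpose B = B"
  moreover have "transpose B $ j $ i = B $ i $ j" by (simp add: transpose_def)
  ultimately show ?thesis by simp
qed

lemma pos_def_nth_commute: "pos_def B \<Longrightarrow> B $ i $ j = B $ j $ i"
  unfolding pos_def_def by (blast intro: symmetric_matrix_nth)

lemma pos_def_det: "pos_def (B :: real ^ 'k ^ 'k) \<Longrightarrow> det B \<noteq> 0"
proof -
  assume B: "pos_def B"
  have "x = 0" if "B *v x = 0" for x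
    using B that unfolding pos_def_def by (metis inner_zero_right less_irrefl)
  then have "invertible B"
    by (metis matrix_left_invertible_ker invertible_left_inverse)
  then show ?thesis by (simp add: invertible_det_nz)
qed

lemmas pos_def_inv = matrix_inv_mult[OF pos_def_det]

lemma matrix_inv_unique:
  fixes A :: "real ^ 'k ^ 'k"
  assumes "A ** B = mat 1"
  shows "matrix_inv A = B"
proof -
  have "det A \<noteq> 0" using assms det_mul[of A B] by auto
  then have "matrix_inv A ** A = mat 1" by (rule matrix_inv_mult)
  then have "matrix_inv A ** (A ** B) = B" by (simp add: matrix_mul_assoc)
  then show ?thesis by (simp add: assms)
qed

lemma pos_def_inverse_symmetric:
  assumes "pos_def B"
  shows "transpose (matrix_inv B) = matrix_inv B"
proof -
  have "B ** transpose (matrix_inv B) = transpose (matrix_inv B ** B)"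
    using assms by (simp add: matrix_transpose_mul pos_def_def)
  then show ?thesis using matrix_inv_unique pos_def_inv[OF assms] by (metis transpose_mat)
qed

text \<open>The diagonal entry is the value of the quadratic form of B at the i-th column of its
  inverse.\<close>

lemma pos_def_inverse_diagonal:
  fixes B :: "real ^ 'k ^ 'k"
  assumes "pos_def B"
  shows "0 < matrix_inv B $ i $ i"
proof -
  let ?w = "matrix_inv B *v axis i 1"
  have Bw: "B *v ?w = axis i 1"
    by (simp add: matrix_vector_mul_assoc pos_def_inv[OF assms])
  then have "?w \<noteq> 0" by (metis axis_eq_0_iff matrix_vector_mult_0_right zero_neq_one)
  then have "0 < ?w \<bullet> (B *v ?w)" using assms by (simp add: pos_def_def)
  also have "\<dots> = matrix_inv B $ i $ i"
    unfolding Bw by (simp add: inner_axis matrix_vector_mul_component)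
  finally show ?thesis .
qed

lemma pos_def_induced:
  assumes "pos_def B"
  shows "pos_def (induced_metric B)"
  unfolding pos_def_def
proof (intro conjI allI impI)
  note B = pos_def_nth_commute[OF assms]
  show "transpose (induced_metric B) = induced_metric B"
    using B by (simp add: induced_metric_def transpose_def vec_eq_iff)
  fix w :: "real ^ 'a" assume "w \<noteq> 0"
  then obtain i where "w $ i \<noteq> 0" by (auto simp: vec_eq_iff)
  then have "bd_embed w \<noteq> 0" using bd_embed_nth(2)[of w i] by force
  then have "0 < bd_embed w \<bullet> (B *v bd_embed w)" using assms by (simp add: pos_def_def)
  also have "\<dots> = w \<bullet> (induced_metric B *v w)"
    by (simp add: inner_vec_def matrix_vector_mult_def sum_UNIV_option induced_metric_def)
  finally show "0 < w \<bullet> (induced_metric B *v w)" .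
qed

definition is_inward_normal :: "real ^ 'n option ^ 'n option \<Rightarrow> real ^ 'n::finite option \<Rightarrow> bool" where
  "is_inward_normal B v \<longleftrightarrow> v \<bullet> (B *v v) = 1 \<and> (\<forall>i. axis (Some i) 1 \<bullet> (B *v v) = 0) \<and> 0 < v $ None"

text \<open>Orthogonality to the tangential axes makes \<open>B *v v\<close> a multiple c of the
  covector dx_0, so v is c times the gradient of x_0. Unit length gives c^2 g^00 = 1 and the inward
  direction selects the positive root. This also shows that the definite description in
  \<open>inward_normal\<close> is well defined.\<close>

lemma is_inward_normal_iff:
  assumes "pos_def B"
  shows "is_inward_normal B v \<longleftrightarrow>
    v = (1 / sqrt (matrix_inv B $ None $ None)) *\<^sub>R (matrix_inv B *v axis None 1)" (is "_ \<longleftrightarrow> v = ?r *\<^sub>R ?w")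
proof
  let ?g = "matrix_inv B $ None $ None"
  have g: "0 < ?g" by (rule pos_def_inverse_diagonal[OF assms])
  have w: "?w $ None = ?g" by (simp add: inner_axis matrix_vector_mul_component)
  have Bw: "B *v ?w = axis None 1"
    by (simp add: matrix_vector_mul_assoc pos_def_inv[OF assms])
  {
    assume v: "is_inward_normal B v"
    define c where "c = (B *v v) $ None"
    have "(B *v v) $ Some i = 0" for i
      using v by (simp add: is_inward_normal_def inner_axis')
    then have "(B *v v) $ k = (c *\<^sub>R axis None 1) $ k" for k
      by (cases k) (auto simp: c_def axis_def)
    then have Bv: "B *v v = c *\<^sub>R axis None 1" by (simp add: vec_eq_iff)
    have "v = matrix_inv B *v (B *v v)"
      by (simp add: matrix_vector_mul_assoc pos_def_inv[OF assms])
    then have v_eq: "v = c *\<^sub>R ?w" unfolding Bv by (simp add: matrix_vector_mult_scaleR)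
    have "0 < c * ?g" using v w unfolding is_inward_normal_def by (simp add: v_eq)
    then have c: "0 < c" using g by (simp add: zero_less_mult_iff)
    have "1 = v \<bullet> (c *\<^sub>R axis None 1)" using v Bv by (simp add: is_inward_normal_def)
    also have "\<dots> = c * (c * ?g)" using w by (simp add: v_eq inner_axis)
    finally have "c * c * ?g = 1" by simp
    then have "c\<^sup>2 = 1 / ?g" using g by (simp add: eq_divide_eq power2_eq_square)
    then have "c = sqrt (1 / ?g)" using c by (metis less_imp_le real_sqrt_unique)
    then show "v = ?r *\<^sub>R ?w" unfolding v_eq by (simp add: real_sqrt_divide)
  next
    assume v: "v = ?r *\<^sub>R ?w"
    have Bv: "B *v v = ?r *\<^sub>R axis None 1" unfolding v by (simp add: matrix_vector_mult_scaleR Bw)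
    have v0: "v $ None = ?r * ?g" using w by (simp add: v)
    have "v \<bullet> (B *v v) = ?r * ?r * ?g" unfolding Bv by (simp add: inner_axis v0)
    then have "v \<bullet> (B *v v) = 1" using g by simp
    moreover have "axis (Some i) 1 \<bullet> (B *v v) = 0" for i unfolding Bv by (simp add: inner_axis_axis)
    moreover have "0 < v $ None" using g v0 by simp
    ultimately show "is_inward_normal B v" by (simp add: is_inward_normal_def)
  }
qed

lemma inward_normal_eq:
  assumes "pos_def B"
  shows "is_inward_normal B v \<longleftrightarrow> v = inward_normal B"
proof -
  have "inward_normal B = (THE v. is_inward_normal B v)"
    by (simp add: inward_normal_def is_inward_normal_def)
  then show ?thesis using is_inward_normal_iff[OF assms] by simp
qed

lemma mult_inward_normal:
  assumes "pos_def B"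
  shows "B *v inward_normal B = (1 / sqrt (matrix_inv B $ None $ None)) *\<^sub>R axis None 1"
proof -
  have "inward_normal B = (1 / sqrt (matrix_inv B $ None $ None)) *\<^sub>R (matrix_inv B *v axis None 1)"
    using inward_normal_eq[OF assms] is_inward_normal_iff[OF assms] by blast
  then show ?thesis
    by (simp add: matrix_vector_mult_scaleR matrix_vector_mul_assoc pos_def_inv[OF assms])
qed

lemma levi_civita_axis:
  fixes G :: "real ^ 'k \<Rightarrow> real ^ 'k ^ 'k"
  assumes "corner_open S" "x \<in> S"
  shows "levi_civita S G (\<lambda>_. axis i 1) (\<lambda>_. axis j 1) x = (\<chi> k. christoffel S G k i j x)"
proof -
  have "((\<lambda>_. axis j 1 :: real ^ 'k) has_derivative (\<lambda>_. 0)) (at x within S)" by (rule has_derivative_const)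
  from has_derivative_unique_corner[OF assms _ this] frechet_derivative_works[THEN iffD1, OF differentiableI[OF this]]
  have "frechet_derivative (\<lambda>_. axis j 1 :: real ^ 'k) (at x within S) = (\<lambda>_. 0)"
    by blast
  moreover have "(\<Sum>a\<in>UNIV. \<Sum>b\<in>UNIV. christoffel S G k a b x * axis i 1 $ a * axis j 1 $ b) = christoffel S G k i j x" for k
    by (simp add: axis_def if_distrib[of "\<lambda>c. _ * c"] cong: if_cong)
  ultimately show ?thesis by (simp add: levi_civita_def)
qed

text \<open>Lowering the index of the normal gives (g^00)^(-1/2) dx_0, so the pairing picks the
  \<open>None\<close> component of the covariant derivative, which for axis fields is a Christoffel
  symbol.\<close>

lemma second_fundamental_form_eq:
  assumes "corner_open S" "x \<in> S" "pos_def (G x)"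
  shows "second_fundamental_form S G x $ i $ j =
    christoffel S G None (Some i) (Some j) x * matrix_inv (G x) $ None $ None powr (- 1 / 2)"
proof -
  have "0 < matrix_inv (G x) $ None $ None" by (rule pos_def_inverse_diagonal[OF assms(3)])
  then have "1 / sqrt (matrix_inv (G x) $ None $ None) = matrix_inv (G x) $ None $ None powr (- 1 / 2)"
    by (simp add: powr_minus_divide powr_half_sqrt)
  then show ?thesis
    by (simp add: second_fundamental_form_def mult_inward_normal[OF assms(3)] levi_civita_axis[OF assms(1,2)] inner_axis)
qed

lemma local_mean_curvature_eq:
  assumes "corner_open S" "x \<in> S" "pos_def (G x)"
  shows "local_mean_curvature S G x = (\<Sum>i\<in>UNIV. \<Sum>j\<in>UNIV. matrix_inv (induced_metric (G x)) $ i $ j *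
     (christoffel S G None (Some i) (Some j) x * matrix_inv (G x) $ None $ None powr (- 1 / 2)))"
  by (simp add: local_mean_curvature_def second_fundamental_form_eq[where G=G, OF assms])

text \<open>The formula contains the metric and its first derivatives, hence exactly one order is
  lost. With continuity for P this is the regularity of H; with \<open>values_converge\<close> it is
  the convergence of its jets.\<close>

lemma Cfam_mean_curvature:
  fixes G :: "'w \<Rightarrow> real ^ 'n::finite option \<Rightarrow> real ^ 'n option ^ 'n option"
  assumes "smooth_families S P" and C: "\<And>i j. Cfam P (Suc k) S (\<lambda>w x. G w x $ i $ j)"
    and pd: "\<And>w x. x \<in> S \<Longrightarrow> pos_def (G w x)"
  shows "Cfam P k S (\<lambda>w. local_mean_curvature S (G w))"
proof -
  interpret smooth_families S P by fact
  have G: "C k (\<lambda>w x. G w x $ i $ j)" for i j by (rule C_Suc_imp_C[OF C])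
  have inv: "C k (\<lambda>w x. matrix_inv (G w x) $ i $ j)" for i j
    by (rule C_matrix_inv) (use G pos_def_det[OF pd] in auto)
  have ind: "C k (\<lambda>w x. matrix_inv (induced_metric (G w x)) $ i $ j)" for i j
    by (rule C_matrix_inv) (use G pos_def_det[OF pos_def_induced[OF pd]] in \<open>auto simp: induced_metric_def\<close>)
  have chr: "C k (\<lambda>w x. christoffel S (G w) a i j x)" for a i j
    unfolding christoffel_def
    by (intro C_cmult C_sum C_mult C_add C_diff inv C_partial[OF C])
  have "C k (\<lambda>w x. \<Sum>i\<in>UNIV. \<Sum>j\<in>UNIV. matrix_inv (induced_metric (G w x)) $ i $ j *
     (christoffel S (G w) None (Some i) (Some j) x * matrix_inv (G w x) $ None $ None powr (- 1 / 2)))"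
    by (intro C_sum C_mult ind chr C_powr inv pos_def_inverse_diagonal pd)
  then show ?thesis
    by (rule C_cong) (simp add: local_mean_curvature_eq[OF corner _ pd])
qed

lemma local_mean_curvature_openin:
  assumes "corner_open S" "openin (top_of_set S) T" "x \<in> T" "pos_def (G x)"
  shows "local_mean_curvature T G x = local_mean_curvature S G x"
proof -
  have "x \<in> S" using assms openin_imp_subset by blast
  then show ?thesis
    using assms openin_corner_open[OF assms(2,1)]
    by (simp add: local_mean_curvature_eq christoffel_def partial_openin[OF assms(2,3)])
qed

lemma sum_inverse_symmetric:
  fixes B :: "real ^ 'k ^ 'k"
  assumes "pos_def B"
  shows "(\<Sum>i\<in>UNIV. \<Sum>j\<in>UNIV. matrix_inv B $ i $ j * B $ i $ j) = real CARD('k)"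
proof -
  note B = pos_def_nth_commute[OF assms]
  have "(\<Sum>j\<in>UNIV. matrix_inv B $ i $ j * B $ i $ j) = (matrix_inv B ** B) $ i $ i" for i
    unfolding matrix_matrix_mult_def by (simp, intro sum.cong refl arg_cong2[where f="(*)"] B)
  then show ?thesis by (simp add: pos_def_inv[OF assms] mat_def)
qed

text \<open>At x the factor is 1 and its tangential derivatives vanish, so among the derivatives of
  the metric only the transversal one changes. In the Christoffel symbol with upper index
  \<open>None\<close> and tangential lower indices this contributes -1/2 g^00 (d_0 s) g_ij; the
  trace of g_ij supplies the factor n.\<close>

lemma mean_curvature_conformal:
  fixes G :: "real ^ 'n::finite option \<Rightarrow> real ^ 'n option ^ 'n option"
  assumes S: "corner_open S" "x \<in> S" and pd: "pos_def (G x)"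
    and G: "\<And>i j. (\<lambda>y. G y $ i $ j) differentiable (at x within S)"
    and s: "s differentiable (at x within S)" "s x = 0" "\<And>i. partial S (Some i) s x = 0"
  shows "local_mean_curvature S (\<lambda>y. (1 + s y) *\<^sub>R G y) x =
    local_mean_curvature S G x - CARD('n) / 2 * (matrix_inv (G x) $ None $ None powr (1 / 2) * partial S None s x)"
proof -
  let ?G = "\<lambda>y. (1 + s y) *\<^sub>R G y" and ?h = "matrix_inv (G x) $ None $ None"
  have Gx: "?G x = G x" using s(2) by simp
  have h: "0 < ?h" by (rule pos_def_inverse_diagonal[OF pd])
  have part: "partial S l (\<lambda>y. ?G y $ i $ j) x = partial S l (\<lambda>y. G y $ i $ j) x + partial S l s x * G x $ i $ j" for l i j
  proof -
    have "((\<lambda>y. (1 + s y) * G y $ i $ j) has_derivative (\<lambda>v. (1 + s x) * (\<Sum>l\<in>UNIV. v $ l *\<^sub>R partial S l (\<lambda>y. G y $ i $ j) x)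
        + (0 + (\<Sum>l\<in>UNIV. v $ l *\<^sub>R partial S l s x)) * G x $ i $ j)) (at x within S)"
      by (rule has_derivative_mult[OF has_derivative_add[OF has_derivative_const has_derivative_partials[OF s(1)]]
          has_derivative_partials[OF G]])
    from partial_eqI[OF S this, of l] show ?thesis by (simp only: real_scaleR_def sum_axis) (simp add: s(2))
  qed
  have chr: "christoffel S ?G None (Some i) (Some j) x =
     christoffel S G None (Some i) (Some j) x - ?h / 2 * partial S None s x * G x $ Some i $ Some j" for i j
  proof -
    have "christoffel S ?G None (Some i) (Some j) x =
      1/2 * (\<Sum>l\<in>UNIV. matrix_inv (G x) $ None $ l *
       (partial S (Some i) (\<lambda>y. G y $ Some j $ l) x + partial S (Some j) (\<lambda>y. G y $ Some i $ l) x
          - partial S l (\<lambda>y. G y $ Some i $ Some j) x)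
        - matrix_inv (G x) $ None $ l * (partial S l s x * G x $ Some i $ Some j))"
      unfolding christoffel_def Gx part s(3) by (simp add: algebra_simps)
    also have "\<dots> = christoffel S G None (Some i) (Some j) x
        - 1/2 * (\<Sum>l\<in>UNIV. matrix_inv (G x) $ None $ l * (partial S l s x * G x $ Some i $ Some j))"
      unfolding christoffel_def sum_subtractf by (simp add: right_diff_distrib)
    finally show ?thesis by (simp add: sum_UNIV_option s(3))
  qed
  have powr: "?h * ?h powr (- 1 / 2) = ?h powr (1 / 2)"
    using powr_add[of ?h 1 "- 1 / 2"] h by simp
  let ?I = "matrix_inv (induced_metric (G x))" and ?B = "induced_metric (G x)"
  have "local_mean_curvature S ?G x = (\<Sum>i\<in>UNIV. \<Sum>j\<in>UNIV. ?I $ i $ j *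
     (christoffel S G None (Some i) (Some j) x * ?h powr (- 1 / 2))
      - (?h * ?h powr (- 1 / 2) * partial S None s x / 2) * (?I $ i $ j * ?B $ i $ j))"
    unfolding local_mean_curvature_eq[OF S, of ?G, unfolded Gx, OF pd] chr
    by (intro sum.cong refl) (simp add: algebra_simps induced_metric_def)
  also have "\<dots> = local_mean_curvature S G x
      - (?h * ?h powr (- 1 / 2) * partial S None s x / 2) * (\<Sum>i\<in>UNIV. \<Sum>j\<in>UNIV. ?I $ i $ j * ?B $ i $ j)"
    unfolding local_mean_curvature_eq[where G=G, OF S pd] by (simp only: sum_subtractf sum_distrib_left)
  also have "(\<Sum>i\<in>UNIV. \<Sum>j\<in>UNIV. ?I $ i $ j * ?B $ i $ j) = CARD('n)"
    by (rule sum_inverse_symmetric[OF pos_def_induced[OF pd]])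
  finally show ?thesis unfolding powr by (simp add: algebra_simps)
qed

subsection \<open>Change of coordinates\<close>

text \<open>Written with the components of the normal in place of the row g^0l of the inverse
  matrix: the normal transforms as a vector, which is what the change of coordinates
  exploits.\<close>

lemma second_fundamental_form_normal:
  assumes "corner_open S" "x \<in> S" "pos_def (G x)"
  shows "second_fundamental_form S G x $ i $ j = 1 / 2 * (\<Sum>l\<in>UNIV. inward_normal (G x) $ l *
    (partial S (Some i) (\<lambda>y. G y $ Some j $ l) x + partial S (Some j) (\<lambda>y. G y $ Some i $ l) x
      - partial S l (\<lambda>y. G y $ Some i $ Some j) x))"
proof -
  let ?h = "matrix_inv (G x) $ None $ None"
  have h: "0 < ?h" by (rule pos_def_inverse_diagonal[OF assms(3)])
  then have r: "?h powr (- 1 / 2) = 1 / sqrt ?h"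
    by (simp add: powr_minus_divide powr_half_sqrt)
  have nu: "inward_normal (G x) $ l = matrix_inv (G x) $ None $ l * (1 / sqrt ?h)" for l
  proof -
    have "inward_normal (G x) = (1 / sqrt ?h) *\<^sub>R (matrix_inv (G x) *v axis None 1)"
      using inward_normal_eq[OF assms(3)] is_inward_normal_iff[OF assms(3)] by blast
    moreover have "(matrix_inv (G x) *v axis None 1) $ l = matrix_inv (G x) $ None $ l"
      using symmetric_matrix_nth[OF pos_def_inverse_symmetric[OF assms(3)]]
      by (simp add: matrix_vector_mul_component inner_axis)
    ultimately show ?thesis by simp
  qed
  show ?thesis
    unfolding second_fundamental_form_eq[where G=G, OF assms] r nu christoffel_def
    unfolding mult.assoc[of "1 / 2"] sum_distrib_right
    by (rule arg_cong[where f="\<lambda>x. 1 / 2 * x"], rule sum.cong) (simp_all only: mult_ac)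
qed

lemma sum_linear_combination:
  fixes n :: "'l \<Rightarrow> real"
  shows "(\<Sum>c\<in>B. (\<Sum>l\<in>A. n l * Z l c) * K c) = (\<Sum>l\<in>A. n l * (\<Sum>c\<in>B. Z l c * K c))"
  by (simp only: sum_distrib_left sum_distrib_right mult.assoc) (rule sum.swap)

lemma sum_tangential:
  fixes X Y :: "'n::finite option \<Rightarrow> real"
  assumes "X None = 0" "Y None = 0"
  shows "(\<Sum>a\<in>UNIV. \<Sum>b\<in>UNIV. X a * Y b * H a b) = (\<Sum>a\<in>UNIV. \<Sum>b\<in>UNIV. X (Some a) * Y (Some b) * H (Some a) (Some b))"
  by (simp add: sum_UNIV_option assms)

lemma inner_matrix_sum:
  fixes B :: "real ^ 'k ^ 'k"
  shows "u \<bullet> (B *v v) = (\<Sum>a\<in>UNIV. \<Sum>b\<in>UNIV. u $ a * v $ b * B $ a $ b)"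
  by (simp add: inner_vec_def matrix_vector_mult_def sum_distrib_left mult_ac)

lemma congruence_nth:
  fixes B J :: "real ^ 'k ^ 'k"
  shows "(transpose J ** B ** J) $ i $ j = (\<Sum>a\<in>UNIV. \<Sum>b\<in>UNIV. J $ a $ i * J $ b $ j * B $ a $ b)"
proof -
  have "(transpose J ** B ** J) $ i $ j = (\<Sum>b\<in>UNIV. \<Sum>a\<in>UNIV. J $ a $ i * B $ a $ b * J $ b $ j)"
    by (simp add: matrix_matrix_mult_def transpose_def sum_distrib_right)
  also have "\<dots> = (\<Sum>a\<in>UNIV. \<Sum>b\<in>UNIV. J $ a $ i * B $ a $ b * J $ b $ j)" by (rule sum.swap)
  finally show ?thesis by (simp only: mult_ac)
qed

lemma transpose_mult_inner:
  fixes J :: "real ^ 'k ^ 'k"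
  shows "u \<bullet> (transpose J *v w) = (J *v u) \<bullet> w"
  by (metis dot_lmul_matrix inner_commute transpose_matrix_vector vector_transpose_matrix)

text \<open>The inverse of the transformed metric is K A^(-1) K^T with K inverse to J; the factors J
  and K then cancel by the cyclic invariance of the trace.\<close>

lemma trace_congruence:
  fixes A h J K :: "real ^ 'k ^ 'k"
  assumes "J ** K = mat 1" "K ** J = mat 1" "det A \<noteq> 0"
  shows "(\<Sum>i\<in>UNIV. \<Sum>j\<in>UNIV. matrix_inv (transpose J ** A ** J) $ i $ j * (transpose J ** h ** J) $ i $ j)
    = (\<Sum>i\<in>UNIV. \<Sum>j\<in>UNIV. matrix_inv A $ i $ j * h $ i $ j)"
proof -
  have tr: "(\<Sum>i\<in>UNIV. \<Sum>j\<in>UNIV. X $ i $ j * Y $ i $ j) = trace (X ** transpose Y)" for X Y :: "real ^ 'k ^ 'k"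
    by (simp add: trace_def matrix_matrix_mult_def transpose_def)
  let ?I = "matrix_inv A"
  have KJ: "transpose J ** transpose K = mat 1" "transpose K ** transpose J = mat 1"
    unfolding matrix_transpose_mul[symmetric] using assms(1,2) by (simp_all add: transpose_mat)
  have "(transpose J ** A ** J) ** (K ** ?I ** transpose K)
      = transpose J ** A ** (J ** K) ** ?I ** transpose K"
    by (simp only: matrix_mul_assoc)
  also have "\<dots> = transpose J ** (A ** ?I) ** transpose K"
    unfolding assms(1) matrix_mul_rid by (simp only: matrix_mul_assoc)
  also have "\<dots> = mat 1" unfolding matrix_inv_mult[OF assms(3)] matrix_mul_rid KJ ..
  finally have inv: "matrix_inv (transpose J ** A ** J) = K ** ?I ** transpose K"
    by (rule matrix_inv_unique)
  have "(K ** ?I ** transpose K) ** transpose (transpose J ** h ** J)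
      = (K ** ?I ** (transpose K ** transpose J)) ** (transpose h ** J)"
    by (simp only: matrix_transpose_mul transpose_transpose matrix_mul_assoc)
  also have "\<dots> = K ** (?I ** transpose h ** J)"
    unfolding KJ matrix_mul_rid by (simp only: matrix_mul_assoc)
  finally have "trace ((K ** ?I ** transpose K) ** transpose (transpose J ** h ** J))
      = trace ((?I ** transpose h ** J) ** K)"
    by (simp only: trace_mul_sym[of K])
  also have "(?I ** transpose h ** J) ** K = ?I ** transpose h ** (J ** K)"
    by (simp only: matrix_mul_assoc)
  finally show ?thesis unfolding tr inv assms(1) matrix_mul_rid .
qed

definition partial_jacobian :: "(real ^ 'k) set \<Rightarrow> (real ^ 'k \<Rightarrow> real ^ 'l) \<Rightarrow> real ^ 'k \<Rightarrow> real ^ 'k ^ 'l" where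
  "partial_jacobian W \<tau> x = (\<chi> a i. partial W i (\<lambda>x. \<tau> x $ a) x)"

lemma jacobian_nth: "partial_jacobian W \<tau> x $ a $ i = partial W i (\<lambda>x. \<tau> x $ a) x"
  by (simp add: partial_jacobian_def)

definition tangential_part :: "real ^ 'n option ^ 'n option \<Rightarrow> real ^ 'n ^ 'n::finite" where
  "tangential_part J = (\<chi> i j. J $ Some i $ Some j)"

lemma tangential_part_mult:
  assumes "\<And>i. J $ None $ Some i = 0"
  shows "tangential_part (K ** J) = tangential_part K ** tangential_part J"
  by (simp add: tangential_part_def matrix_matrix_mult_def vec_eq_iff sum_UNIV_option assms)

lemma tangential_part_mat: "tangential_part (mat 1) = mat 1"
  by (simp add: tangential_part_def mat_def vec_eq_iff)

lemma induced_metric_congruence: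
  assumes "\<And>i. J $ None $ Some i = 0"
  shows "induced_metric (transpose J ** B ** J) = transpose (tangential_part J) ** induced_metric B ** tangential_part J"
  unfolding vec_eq_iff induced_metric_def vec_lambda_beta congruence_nth
  by (simp add: sum_UNIV_option assms tangential_part_def)

text \<open>K maps tangential vectors to tangential ones, so orthogonality to the boundary is
  carried over by J. The vanishing tangential part of the row \<open>None\<close> of J together with
  its positive diagonal entry keeps the vector inward.\<close>

lemma inward_normal_congruence:
  fixes B J K :: "real ^ 'n::finite option ^ 'n option"
  assumes pd: "pos_def B" and JK: "J ** K = mat 1"
    and K0: "\<And>i. K $ None $ Some i = 0"
    and J0: "\<And>i. J $ None $ Some i = 0" and J00: "0 < J $ None $ None"
    and nu: "is_inward_normal (transpose J ** B ** J) v"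
  shows "is_inward_normal B (J *v v)"
proof -
  let ?B = "transpose J ** B ** J"
  have B: "(J *v u) \<bullet> (B *v (J *v v)) = u \<bullet> (?B *v v)" for u
    unfolding matrix_vector_mul_assoc[symmetric] by (rule transpose_mult_inner[symmetric])
  have Bv: "(?B *v v) $ Some i = 0" for i
    using nu by (simp add: is_inward_normal_def inner_axis')
  have "axis (Some i) 1 \<bullet> (B *v (J *v v)) = 0" for i
  proof -
    let ?w = "K *v axis (Some i) 1"
    have w: "?w $ None = 0" by (simp add: matrix_vector_mul_component inner_axis K0)
    have "axis (Some i) 1 \<bullet> (B *v (J *v v)) = ?w \<bullet> (?B *v v)"
      unfolding B[of ?w, symmetric] by (simp add: matrix_vector_mul_assoc JK)
    also have "\<dots> = (\<Sum>k\<in>UNIV. ?w $ k * (?B *v v) $ k)" by (simp add: inner_vec_def)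
    also have "\<dots> = 0" by (simp only: sum_UNIV_option w Bv) simp
    finally show ?thesis .
  qed
  moreover have "(J *v v) $ None = J $ None $ None * v $ None"
    by (simp add: matrix_vector_mult_def sum_UNIV_option J0)
  ultimately show ?thesis
    using nu J00 unfolding is_inward_normal_def B by simp
qed

lemma partial_compose:
  fixes \<tau> :: "real ^ 'k \<Rightarrow> real ^ 'l" and f :: "real ^ 'l \<Rightarrow> real"
  assumes "corner_open W" "\<tau> ` W \<subseteq> S" "x \<in> W"
    and \<tau>: "\<And>a. (\<lambda>x. \<tau> x $ a) differentiable (at x within W)"
    and f: "f differentiable (at (\<tau> x) within S)"
  shows "(\<lambda>x. f (\<tau> x)) differentiable (at x within W)" (is ?A)
    and "partial W i (\<lambda>x. f (\<tau> x)) x = (\<Sum>a\<in>UNIV. partial_jacobian W \<tau> x $ a $ i * partial S a f (\<tau> x))" (is ?B)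
proof -
  have "(f has_derivative (\<lambda>v. \<Sum>a\<in>UNIV. v $ a *\<^sub>R partial S a f (\<tau> x))) (at (\<tau> x) within S)"
    by (rule has_derivative_partials[OF f])
  then have 1: "(f has_derivative (\<lambda>v. \<Sum>a\<in>UNIV. v $ a *\<^sub>R partial S a f (\<tau> x))) (at (\<tau> x) within \<tau> ` W)"
    using assms(2) by (rule has_derivative_subset)
  have 2: "(\<tau> has_derivative (\<lambda>v. \<chi> a. \<Sum>i\<in>UNIV. v $ i *\<^sub>R partial W i (\<lambda>x. \<tau> x $ a) x)) (at x within W)"
    unfolding has_derivative_vec_iff using has_derivative_partials[OF \<tau>] by simp
  note 3 = has_derivative_in_compose[OF 2 1]
  from 3 show ?A by (rule differentiableI)
  from partial_eqI[OF assms(1,3) 3, of i] show ?B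
    by (simp only: real_scaleR_def vec_lambda_beta sum_axis jacobian_nth)
qed

text \<open>The product rule for J^T G J. The first two sums carry second derivatives of \<tau>, the
  non-tensorial part that has to disappear from the second fundamental form; the third is the
  tensorial part.\<close>

lemma partial_congruence:
  fixes \<tau> :: "real ^ 'k \<Rightarrow> real ^ 'k"
  assumes W: "corner_open W" "\<tau> ` W \<subseteq> S" "x \<in> W"
    and \<tau>: "\<And>a. Ck_on 2 W (\<lambda>x. \<tau> x $ a)" and G: "\<And>a b. Ck_on 1 S (\<lambda>y. G y $ a $ b)"
    and G': "\<And>x. x \<in> W \<Longrightarrow> G' x = transpose (partial_jacobian W \<tau> x) ** G (\<tau> x) ** partial_jacobian W \<tau> x"
  shows "partial W l (\<lambda>z. G' z $ i $ j) x =
      (\<Sum>a\<in>UNIV. \<Sum>b\<in>UNIV. partial W l (partial W i (\<lambda>x. \<tau> x $ a)) x * partial_jacobian W \<tau> x $ b $ j * G (\<tau> x) $ a $ b)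
    + (\<Sum>a\<in>UNIV. \<Sum>b\<in>UNIV. partial_jacobian W \<tau> x $ a $ i * partial W l (partial W j (\<lambda>x. \<tau> x $ b)) x * G (\<tau> x) $ a $ b)
    + (\<Sum>a\<in>UNIV. \<Sum>b\<in>UNIV. partial_jacobian W \<tau> x $ a $ i * partial_jacobian W \<tau> x $ b $ j *
         (\<Sum>c\<in>UNIV. partial_jacobian W \<tau> x $ c $ l * partial S c (\<lambda>y. G y $ a $ b) (\<tau> x)))"
proof -
  let ?d = "\<lambda>i a. partial W i (\<lambda>x. \<tau> x $ a)"
  have \<tau>x: "\<tau> x \<in> S" using W by auto
  have d1: "(\<lambda>x. \<tau> x $ a) differentiable (at x within W)" for a
    using \<tau>[of a] W(3) by (simp add: numeral_2_eq_2 differentiable_on_def)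
  have d2: "(?d i a has_derivative (\<lambda>v. \<Sum>l\<in>UNIV. v $ l *\<^sub>R partial W l (?d i a) x)) (at x within W)" for i a
    using \<tau>[of a] W(3) by (intro has_derivative_partials) (simp add: numeral_2_eq_2 differentiable_on_def)
  have dG: "(\<lambda>y. G y $ a $ b) differentiable (at (\<tau> x) within S)" for a b
    using G[of a b] \<tau>x by (simp add: differentiable_on_def)
  have d3: "((\<lambda>x. G (\<tau> x) $ a $ b) has_derivative (\<lambda>v. \<Sum>l\<in>UNIV. v $ l *\<^sub>R partial W l (\<lambda>x. G (\<tau> x) $ a $ b) x)) (at x within W)" for a b
    by (rule has_derivative_partials[OF partial_compose(1)[OF W d1 dG]])
  have "partial W l (\<lambda>z. G' z $ i $ j) x = partial W l (\<lambda>z. \<Sum>a\<in>UNIV. \<Sum>b\<in>UNIV. ?d i a z * ?d j b z * G (\<tau> z) $ a $ b) x"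
    by (rule partial_cong[OF _ W(3)]) (simp only: G' congruence_nth jacobian_nth)
  also have "\<dots> = (\<Sum>a\<in>UNIV. \<Sum>b\<in>UNIV. ?d i a x * ?d j b x * partial W l (\<lambda>x. G (\<tau> x) $ a $ b) x
      + (?d i a x * partial W l (?d j b) x + partial W l (?d i a) x * ?d j b x) * G (\<tau> x) $ a $ b)"
    by (rule partial_eqI[OF W(1,3) has_derivative_sum[OF has_derivative_sum[OF
        has_derivative_mult[OF has_derivative_mult[OF d2 d2] d3]]], THEN trans])
      (simp only: real_scaleR_def sum_axis)
  also have "\<dots> = (\<Sum>a\<in>UNIV. \<Sum>b\<in>UNIV. partial W l (?d i a) x * ?d j b x * G (\<tau> x) $ a $ b)
     + (\<Sum>a\<in>UNIV. \<Sum>b\<in>UNIV. ?d i a x * partial W l (?d j b) x * G (\<tau> x) $ a $ b)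
     + (\<Sum>a\<in>UNIV. \<Sum>b\<in>UNIV. ?d i a x * ?d j b x * partial W l (\<lambda>x. G (\<tau> x) $ a $ b) x)"
    unfolding sum.distrib[symmetric] by (intro sum.cong refl) (simp add: algebra_simps)
  finally show ?thesis unfolding partial_compose(2)[OF W d1 dG] jacobian_nth .
qed

text \<open>In the combination of derivatives that defines h, the terms with second derivatives of
  \<tau> cancel except for twice the product of the vector d_i d_j \<tau> with the normal. For
  tangential i and j this vector is tangential, because \<tau> maps boundary to boundary, so the
  product vanishes. Hence h transforms as a tensor on the boundary and its trace is
  invariant.\<close>

theorem mean_curvature_transform:
  fixes \<tau> :: "real ^ 'n::finite option \<Rightarrow> real ^ 'n option"
  assumes W: "openin (top_of_set halfspace) W" and S: "corner_open S" and \<tau>W: "\<tau> ` W \<subseteq> S"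
    and \<tau>: "\<And>a. Ck_on 2 W (\<lambda>x. \<tau> x $ a)" and G: "\<And>a b. Ck_on 1 S (\<lambda>y. G y $ a $ b)"
    and G': "\<And>x. x \<in> W \<Longrightarrow> G' x = transpose (partial_jacobian W \<tau> x) ** G (\<tau> x) ** partial_jacobian W \<tau> x"
    and pd: "\<And>y. y \<in> S \<Longrightarrow> pos_def (G y)" and pd': "pos_def (G' x)"
    and bd: "\<And>z. z \<in> W \<Longrightarrow> z $ None = 0 \<Longrightarrow> \<tau> z $ None = 0"
    and x: "x \<in> W" "x $ None = 0"
    and JK: "partial_jacobian W \<tau> x ** K = mat 1" "K ** partial_jacobian W \<tau> x = mat 1"
    and K0: "\<And>i. K $ None $ Some i = 0" and J0: "\<And>i. partial_jacobian W \<tau> x $ None $ Some i = 0"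
    and J00: "0 < partial_jacobian W \<tau> x $ None $ None"
  shows "local_mean_curvature W G' x = local_mean_curvature S G (\<tau> x)"
proof -
  have Wc: "corner_open W" by (rule openin_halfspace_corner_open[OF W])
  have \<tau>x: "\<tau> x \<in> S" using x(1) \<tau>W by auto
  let ?J = "partial_jacobian W \<tau> x"
  define B where "B = G (\<tau> x)"
  define Q where "Q a i l = partial W l (partial W i (\<lambda>x. \<tau> x $ a)) x" for a i l
  define P where "P c a b = partial S c (\<lambda>y. G y $ a $ b) (\<tau> x)" for c a b
  define v where "v = inward_normal (G' x)"
  define N where "N = inward_normal B"
  have pdB: "pos_def B" using pd \<tau>x by (simp add: B_def)
  have G'x: "G' x = transpose ?J ** B ** ?J" using G'[OF x(1)] by (simp add: B_def)
  have N: "N = ?J *v v"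
  proof -
    have "is_inward_normal (transpose ?J ** B ** ?J) v"
      using inward_normal_eq[OF pd'] by (simp add: v_def G'x)
    then have "is_inward_normal B (?J *v v)"
      by (rule inward_normal_congruence[OF pdB JK(1) K0 J0 J00])
    then show ?thesis using inward_normal_eq[OF pdB] by (simp add: N_def)
  qed
  have Bs: "B $ a $ b = B $ b $ a" for a b by (rule pos_def_nth_commute[OF pdB])
  have Ps: "P c a b = P c b a" for a b c
    unfolding P_def by (rule partial_cong[OF _ \<tau>x]) (rule pos_def_nth_commute[OF pd])
  have Qs: "Q a i l = Q a l i" for a i l
    unfolding Q_def by (rule partial_commute[OF Wc \<tau> x(1)])
  \<comment> \<open>The component \<open>None\<close> of \<tau> vanishes identically on the boundary
    part of W, so its purely tangential second derivatives are those of the zero function.\<close>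
  have Q0: "Q None (Some i) (Some j) = 0" for i j
  proof -
    let ?y = "\<chi> i. x $ Some i"
    have y: "bd_embed ?y = x" using x(2) by (rule bd_embed_tangential)
    have zero: "partial UNIV i (\<lambda>_. 0 :: real) = (\<lambda>_ :: real ^ 'n. 0)" for i
      by (rule ext, rule partial_eqI[OF open_imp_corner_open[OF open_UNIV] UNIV_I has_derivative_const])
    have "hessian (\<lambda>_. 0 :: real) ?y $ j $ i = partial W (Some j) (partial W (Some i) (\<lambda>x. \<tau> x $ None)) (bd_embed ?y)"
      by (rule hessian_bd_embed[OF W _ \<tau> open_bd_embed_vimage[OF W]]) (use x(1) y bd in auto)
    then show ?thesis by (simp add: hessian_def zero Q_def y)
  qed
  \<comment> \<open>\<open>bil\<close> is the metric at \<tau> x as a bilinear form;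
    \<open>tri X Y Z\<close> is the derivative of the metric in direction Z, evaluated on X and
    Y.\<close>
  define bil where "bil X Y = (\<Sum>a\<in>UNIV. \<Sum>b\<in>UNIV. X a * Y b * B $ a $ b)" for X Y
  define tri where "tri X Y Z = (\<Sum>a\<in>UNIV. \<Sum>b\<in>UNIV. X a * Y b * (\<Sum>c\<in>UNIV. Z c * P c a b))" for X Y Z
  define J where "J i a = ?J $ a $ i" for i a
  have bil_sym: "bil X Y = bil Y X" for X Y
    unfolding bil_def by (subst sum.swap) (intro sum.cong refl, simp add: Bs mult_ac)
  have tri_sym: "tri X Y Z = tri Y X Z" for X Y Z
    unfolding tri_def by (subst sum.swap) (intro sum.cong refl, simp add: Ps mult_ac)
  have D: "partial W l (\<lambda>z. G' z $ i $ j) x = bil (\<lambda>a. Q a i l) (J j) + bil (J i) (\<lambda>a. Q a j l) + tri (J i) (J j) (J l)" for i j l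
    unfolding bil_def tri_def J_def P_def Q_def B_def by (rule partial_congruence[OF Wc \<tau>W x(1) \<tau> G G'])
  have tri: "tri X Y Z = (\<Sum>a\<in>UNIV. \<Sum>b\<in>UNIV. \<Sum>c\<in>UNIV. X a * Y b * Z c * P c a b)" for X Y Z
    unfolding tri_def by (simp only: sum_distrib_left mult.assoc)
  have swap3: "(\<Sum>a\<in>UNIV. \<Sum>b\<in>UNIV. \<Sum>c\<in>UNIV. f a b c) = (\<Sum>c\<in>UNIV. \<Sum>a\<in>UNIV. \<Sum>b\<in>UNIV. f a b c)"
    for f :: "'n option \<Rightarrow> 'n option \<Rightarrow> 'n option \<Rightarrow> real"
    by (subst sum.swap[of _ UNIV UNIV], subst (2) sum.swap, rule refl)
  have tri': "tri X Y Z = (\<Sum>c\<in>UNIV. \<Sum>a\<in>UNIV. \<Sum>b\<in>UNIV. X a * Y b * Z c * P c a b)" for X Y Z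
    unfolding tri by (rule swap3)
  have N_eq: "N $ a = (\<Sum>l\<in>UNIV. v $ l * J l a)" for a
    by (simp add: N matrix_vector_mult_def J_def mult.commute)
  have bil_lin: "(\<Sum>l\<in>UNIV. v $ l * bil X (J l)) = bil X (\<lambda>a. N $ a)" for X
  proof -
    have bil': "bil X Y = (\<Sum>b\<in>UNIV. Y b * (\<Sum>a\<in>UNIV. X a * B $ a $ b))" for Y
      unfolding bil_def by (subst sum.swap) (simp add: sum_distrib_left mult_ac)
    show ?thesis unfolding bil' N_eq by (rule sum_linear_combination[symmetric])
  qed
  have tri_lin: "(\<Sum>l\<in>UNIV. v $ l * tri X Y (J l)) = tri X Y (\<lambda>a. N $ a)" for X Y
  proof -
    have tri_c: "tri X Y Z = (\<Sum>c\<in>UNIV. Z c * (\<Sum>a\<in>UNIV. \<Sum>b\<in>UNIV. X a * Y b * P c a b))" for Z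
      unfolding tri' by (simp add: sum_distrib_left mult_ac)
    show ?thesis unfolding tri_c N_eq by (rule sum_linear_combination[symmetric])
  qed
  have tri_lin2: "(\<Sum>l\<in>UNIV. v $ l * tri X (J l) Z) = tri X (\<lambda>a. N $ a) Z" for X Z
  proof -
    have tri_b: "tri X Y Z = (\<Sum>b\<in>UNIV. Y b * (\<Sum>a\<in>UNIV. X a * (\<Sum>c\<in>UNIV. Z c * P c a b)))" for Y
      unfolding tri_def by (subst sum.swap) (simp add: sum_distrib_left mult_ac)
    show ?thesis unfolding tri_b N_eq by (rule sum_linear_combination[symmetric])
  qed
  have bilN: "bil X (\<lambda>a. N $ a) = 0" if "X None = 0" for X
  proof -
    have "bil X (\<lambda>a. N $ a) = (\<chi> a. X a) \<bullet> (B *v N)"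
      unfolding bil_def inner_matrix_sum by simp
    then show ?thesis
      unfolding N_def mult_inward_normal[OF pdB] using that by (simp add: inner_axis)
  qed
  let ?h' = "second_fundamental_form W G' x" and ?h = "second_fundamental_form S G (\<tau> x)"
  let ?H = "\<lambda>a b. \<Sum>l\<in>UNIV. N $ l * (P a b l + P b a l - P l a b)"
  have h: "?h $ i $ j = 1 / 2 * ?H (Some i) (Some j)" for i j
    unfolding second_fundamental_form_normal[where G=G, OF S \<tau>x pd[OF \<tau>x]] P_def N_def B_def ..
  have h': "?h' $ i $ j = (transpose (tangential_part ?J) ** ?h ** tangential_part ?J) $ i $ j" for i j
  proof -
    let ?i = "J (Some i)" and ?j = "J (Some j)"
    have "?h' $ i $ j = 1 / 2 * (\<Sum>l\<in>UNIV. v $ l * (2 * bil (\<lambda>a. Q a (Some i) (Some j)) (J l)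
        + tri ?j (J l) ?i + tri ?i (J l) ?j - tri ?i ?j (J l)))"
      unfolding second_fundamental_form_normal[where G=G', OF Wc x(1) pd'] D v_def[symmetric]
    proof (rule arg_cong[where f="\<lambda>x. 1 / 2 * x"], rule sum.cong[OF refl])
      fix l
      have "(\<lambda>a. Q a (Some j) (Some i)) = (\<lambda>a. Q a (Some i) (Some j))"
        by (rule ext, rule Qs)
      moreover have "bil ?j (\<lambda>a. Q a l (Some i)) = bil (\<lambda>a. Q a (Some i) l) ?j"
        by (subst bil_sym) (rule arg_cong2[where f=bil, OF ext refl], rule Qs)
      moreover have "bil ?i (\<lambda>a. Q a l (Some j)) = bil ?i (\<lambda>a. Q a (Some j) l)"
        by (rule arg_cong2[where f=bil, OF refl ext], rule Qs)
      ultimately show "v $ l * (bil (\<lambda>a. Q a (Some j) (Some i)) (J l) + bil ?j (\<lambda>a. Q a l (Some i)) + tri ?j (J l) ?i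
          + (bil (\<lambda>a. Q a (Some i) (Some j)) (J l) + bil ?i (\<lambda>a. Q a l (Some j)) + tri ?i (J l) ?j)
          - (bil (\<lambda>a. Q a (Some i) l) ?j + bil ?i (\<lambda>a. Q a (Some j) l) + tri ?i ?j (J l)))
        = v $ l * (2 * bil (\<lambda>a. Q a (Some i) (Some j)) (J l) + tri ?j (J l) ?i + tri ?i (J l) ?j - tri ?i ?j (J l))"
        by simp
    qed
    also have "\<dots> = 1 / 2 * (2 * (\<Sum>l\<in>UNIV. v $ l * bil (\<lambda>a. Q a (Some i) (Some j)) (J l))
        + (\<Sum>l\<in>UNIV. v $ l * tri ?j (J l) ?i) + (\<Sum>l\<in>UNIV. v $ l * tri ?i (J l) ?j) - (\<Sum>l\<in>UNIV. v $ l * tri ?i ?j (J l)))"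
      by (simp add: algebra_simps sum.distrib sum_subtractf sum_distrib_left)
    \<comment> \<open>Contraction with v replaces \<open>J l\<close> by the normal N; by
      \<open>Q0\<close> the vector of second derivatives is tangential, and \<open>bilN\<close>
      removes its product with N.\<close>
    also have "\<dots> = 1 / 2 * (tri ?j (\<lambda>a. N $ a) ?i + tri ?i (\<lambda>a. N $ a) ?j - tri ?i ?j (\<lambda>a. N $ a))"
      unfolding bil_lin tri_lin tri_lin2 by (simp add: bilN Q0)
    also have "tri ?j (\<lambda>a. N $ a) ?i = (\<Sum>a\<in>UNIV. \<Sum>b\<in>UNIV. \<Sum>l\<in>UNIV. ?j b * N $ l * ?i a * P a b l)"
      by (rule tri')
    also have "tri ?i (\<lambda>a. N $ a) ?j = (\<Sum>a\<in>UNIV. \<Sum>b\<in>UNIV. \<Sum>l\<in>UNIV. ?i a * N $ l * ?j b * P b a l)"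
      unfolding tri' by (rule sum.swap)
    also have "tri ?i ?j (\<lambda>a. N $ a) = (\<Sum>a\<in>UNIV. \<Sum>b\<in>UNIV. \<Sum>l\<in>UNIV. ?i a * ?j b * N $ l * P l a b)"
      by (rule tri)
    also have "1 / 2 * ((\<Sum>a\<in>UNIV. \<Sum>b\<in>UNIV. \<Sum>l\<in>UNIV. ?j b * N $ l * ?i a * P a b l)
        + (\<Sum>a\<in>UNIV. \<Sum>b\<in>UNIV. \<Sum>l\<in>UNIV. ?i a * N $ l * ?j b * P b a l)
        - (\<Sum>a\<in>UNIV. \<Sum>b\<in>UNIV. \<Sum>l\<in>UNIV. ?i a * ?j b * N $ l * P l a b))
      = (\<Sum>a\<in>UNIV. \<Sum>b\<in>UNIV. ?i a * ?j b * (1 / 2 * ?H a b))"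
      unfolding sum.distrib[symmetric] sum_subtractf[symmetric] sum_distrib_left
      by (intro sum.cong refl) (simp add: algebra_simps)
    also have "\<dots> = (\<Sum>a\<in>UNIV. \<Sum>b\<in>UNIV. tangential_part ?J $ a $ i * tangential_part ?J $ b $ j * (1 / 2 * ?H (Some a) (Some b)))"
      unfolding tangential_part_def vec_lambda_beta J_def[symmetric]
      by (rule sum_tangential) (simp_all add: J_def J0)
    also have "\<dots> = (transpose (tangential_part ?J) ** ?h ** tangential_part ?J) $ i $ j"
      unfolding congruence_nth h ..
    finally show ?thesis .
  qed
  have tan: "tangential_part ?J ** tangential_part K = mat 1" "tangential_part K ** tangential_part ?J = mat 1"
    unfolding tangential_part_mult[OF K0, symmetric] tangential_part_mult[OF J0, symmetric] JK by (rule tangential_part_mat)+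
  show ?thesis
    unfolding local_mean_curvature_def h' G'x induced_metric_congruence[OF J0] B_def
    by (rule trace_congruence[OF tan pos_def_det[OF pos_def_induced[OF pdB[unfolded B_def]]]])
qed

section \<open>Charts and the boundary\<close>

locale manifold =
  fixes M :: "'a topology" and A :: "('a, 'n::finite) chart set"
  assumes smooth_manifold: "smooth_manifold_with_boundary M A"
begin

lemma chart: "c \<in> A \<Longrightarrow> is_chart M c"
  using smooth_manifold by (simp add: smooth_manifold_with_boundary_def)

lemma covered: assumes "p \<in> topspace M" obtains c where "c \<in> A" "p \<in> fst c"
  using smooth_manifold assms unfolding smooth_manifold_with_boundary_def by blast

lemma openin_chart: "c \<in> A \<Longrightarrow> openin M (fst c)"
  using chart by (simp add: is_chart_def)

lemma openin_chart_image: "c \<in> A \<Longrightarrow> openin (top_of_set halfspace) (chart_image c)"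
  using chart by (simp add: is_chart_def)

lemma corner_open_chart_image: "c \<in> A \<Longrightarrow> corner_open (chart_image c)"
  by (rule openin_halfspace_corner_open[OF openin_chart_image])

lemma chart_homeomorphic:
  "c \<in> A \<Longrightarrow> homeomorphic_map (subtopology M (fst c)) (top_of_set (chart_image c)) (snd c)"
  using chart by (simp add: is_chart_def)

lemma fst_chart_subset: "c \<in> A \<Longrightarrow> fst c \<subseteq> topspace M"
  by (rule openin_subset[OF openin_chart])

lemma inj_on_chart: assumes "c \<in> A" shows "inj_on (snd c) (fst c)"
  using homeomorphic_imp_injective_map[OF chart_homeomorphic[OF assms]] fst_chart_subset[OF assms]
  by (simp add: Int_absorb1)

lemma chart_inv_snd: "c \<in> A \<Longrightarrow> p \<in> fst c \<Longrightarrow> chart_inv c (snd c p) = p"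
  unfolding chart_inv_def by (rule inv_into_f_f[OF inj_on_chart])

lemma snd_chart_inv: "x \<in> chart_image c \<Longrightarrow> snd c (chart_inv c x) = x"
  unfolding chart_inv_def by (rule f_inv_into_f)

lemma chart_inv_in: "x \<in> chart_image c \<Longrightarrow> chart_inv c x \<in> fst c"
  unfolding chart_inv_def by (rule inv_into_into)

lemma openin_chart_image_Int:
  assumes "c \<in> A" "openin M U"
  shows "openin (top_of_set halfspace) (snd c ` (fst c \<inter> U))"
proof -
  have "openin (subtopology M (fst c)) (fst c \<inter> U)"
    by (rule openin_subtopology_Int2[OF assms(2)])
  then have "openin (top_of_set (chart_image c)) (snd c ` (fst c \<inter> U))"
    using homeomorphic_imp_open_map[OF chart_homeomorphic[OF assms(1)]] by (simp add: open_map_def)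
  then show ?thesis using openin_chart_image[OF assms(1)] by (rule openin_trans)
qed

lemma openin_chart_vimage:
  assumes "c \<in> A" "open U"
  shows "openin M {p \<in> fst c. snd c p \<in> U}"
proof -
  have "continuous_map (subtopology M (fst c)) euclidean (snd c)"
    using homeomorphic_imp_continuous_map[OF chart_homeomorphic[OF assms(1)]]
    by (simp add: continuous_map_in_subtopology)
  then have "openin (subtopology M (fst c)) {p \<in> topspace (subtopology M (fst c)). snd c p \<in> U}"
    using assms(2) by (intro openin_continuous_map_preimage[where Y=euclidean]) simp_all
  moreover have "topspace (subtopology M (fst c)) = fst c"
    by (rule topspace_subtopology_subset[OF fst_chart_subset[OF assms(1)]])
  ultimately have "openin (subtopology M (fst c)) {p \<in> fst c. snd c p \<in> U}" by metis
  then show ?thesis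
    using openin_chart[OF assms(1)] openin_trans_full by blast
qed

lemma chart_image_halfspace: "c \<in> A \<Longrightarrow> p \<in> fst c \<Longrightarrow> 0 \<le> snd c p $ None"
  using openin_imp_subset[OF openin_chart_image, of c] unfolding halfspace_def by blast

lemma openin_overlap:
  "c \<in> A \<Longrightarrow> d \<in> A \<Longrightarrow> openin (top_of_set halfspace) (overlap c d)"
  unfolding overlap_def by (rule openin_chart_image_Int[OF _ openin_chart])

lemma overlapI: "p \<in> fst c \<Longrightarrow> p \<in> fst d \<Longrightarrow> snd c p \<in> overlap c d"
  by (simp add: overlap_def)

lemma overlapE:
  assumes "x \<in> overlap c d" obtains p where "p \<in> fst c" "p \<in> fst d" "x = snd c p"
  using assms by (auto simp: overlap_def)

lemma overlap_subset: "overlap c d \<subseteq> chart_image c"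
  by (auto simp: overlap_def)

lemma openin_overlap_chart_image:
  "c \<in> A \<Longrightarrow> d \<in> A \<Longrightarrow> openin (top_of_set (chart_image c)) (overlap c d)"
  by (meson openin_overlap openin_subset_trans overlap_subset openin_imp_subset openin_chart_image)

lemma transition_snd: "c \<in> A \<Longrightarrow> p \<in> fst c \<Longrightarrow> transition c d (snd c p) = snd d p"
  by (simp add: transition_def chart_inv_snd)

lemma transition_image: "c \<in> A \<Longrightarrow> transition c d ` overlap c d \<subseteq> overlap d c"
  by (auto simp: overlap_def transition_snd)

lemma transition_inverse:
  "c \<in> A \<Longrightarrow> d \<in> A \<Longrightarrow> x \<in> overlap c d \<Longrightarrow> transition d c (transition c d x) = x"
  by (auto simp: overlap_def transition_snd)

lemma Ck_transition: "c \<in> A \<Longrightarrow> d \<in> A \<Longrightarrow> Ck_on k (overlap c d) (transition c d)"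
  using smooth_manifold by (simp add: smooth_manifold_with_boundary_def)

lemma corner_open_overlap: "c \<in> A \<Longrightarrow> d \<in> A \<Longrightarrow> corner_open (overlap c d)"
  by (rule openin_halfspace_corner_open[OF openin_overlap])

lemma Ck_transition_nth: "c \<in> A \<Longrightarrow> d \<in> A \<Longrightarrow> Ck_on k (overlap c d) (\<lambda>x. transition c d x $ a)"
  using Ck_transition Ck_on_vec_iff[OF corner_open_overlap] by blast

lemma transition_differentiable:
  "c \<in> A \<Longrightarrow> d \<in> A \<Longrightarrow> x \<in> overlap c d \<Longrightarrow> transition c d differentiable (at x within overlap c d)"
  using Ck_transition[of c d 1] by (simp add: differentiable_on_def)

lemma jacobian_transition_eq:
  assumes "c \<in> A" "d \<in> A" "x \<in> overlap c d"
  shows "jacobian_transition c d x = partial_jacobian (overlap c d) (transition c d) x"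
  using partial_vec_nth[OF corner_open_overlap assms(3) transition_differentiable] assms
  by (simp add: jacobian_transition_def partial_jacobian_def matrix_def vec_eq_iff partial_def)

lemma jacobian_transition_inverse:
  assumes "c \<in> A" "d \<in> A" "x \<in> overlap c d"
  shows "jacobian_transition d c (transition c d x) ** jacobian_transition c d x = mat 1"
proof -
  let ?y = "transition c d x"
  let ?D = "frechet_derivative (transition c d) (at x within overlap c d)"
  let ?E = "frechet_derivative (transition d c) (at ?y within overlap d c)"
  have y: "?y \<in> overlap d c" using transition_image assms by blast
  have D: "(transition c d has_derivative ?D) (at x within overlap c d)"
    using transition_differentiable[OF assms] frechet_derivative_works by blast
  have E: "(transition d c has_derivative ?E) (at ?y within overlap d c)"
    using transition_differentiable[OF assms(2,1) y] frechet_derivative_works by blast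
  have "((\<lambda>x. transition d c (transition c d x)) has_derivative (\<lambda>v. ?E (?D v))) (at x within overlap c d)"
    by (rule has_derivative_in_compose[OF D has_derivative_subset[OF E transition_image[OF assms(1)]]])
  then have "((\<lambda>x. x) has_derivative (\<lambda>v. ?E (?D v))) (at x within overlap c d)"
    by (rule has_derivative_transform[rotated 2]) (use assms in \<open>simp_all add: transition_inverse\<close>)
  then have "(\<lambda>v. ?E (?D v)) = (\<lambda>v. v)"
    using has_derivative_unique_corner[OF corner_open_overlap[OF assms(1,2)] assms(3) _ has_derivative_ident] by blast
  then have "?E \<circ> ?D = id" by (auto simp: fun_eq_iff)
  then have "matrix ?E ** matrix ?D = mat 1"
    using matrix_compose[of ?D ?E] has_derivative_linear[OF D] has_derivative_linear[OF E]
    by (simp add: matrix_id_mat_1)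
  then show ?thesis by (simp add: jacobian_transition_def)
qed

text \<open>Invariance of domain. If p were interior in d, the transition to c would map an open set
  of the full model space around it onto an open set; this contains a point slightly below the
  hyperplane at \<open>snd c p\<close>, although chart images lie in the half space.\<close>

lemma boundary_invariant:
  assumes "c \<in> A" "d \<in> A" "p \<in> fst c" "p \<in> fst d" "snd c p $ None = 0"
  shows "snd d p $ None = 0"
proof (rule ccontr)
  assume "snd d p $ None \<noteq> 0"
  then have pos: "0 < snd d p $ None" using chart_image_halfspace[OF assms(2,4)] by simp
  define W where "W = overlap d c \<inter> {x. 0 < x $ None}"
  obtain U where U: "open U" "overlap d c = halfspace \<inter> U"
    using openin_overlap[OF assms(2,1)] by (auto simp: openin_open)
  have "W = U \<inter> {x. 0 < x $ None}" unfolding W_def U(2) by (auto simp: halfspace_def)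
  then have "open W" using U(1) by (auto intro: open_Int open_halfspace_component_gt_cart)
  moreover have "continuous_on W (transition d c)"
    using Ck_transition[OF assms(2,1), of 0] by (auto intro: continuous_on_subset simp: W_def)
  moreover have "inj_on (transition d c) W"
    by (rule inj_on_inverseI[where g="transition c d"]) (use transition_inverse assms in \<open>auto simp: W_def\<close>)
  ultimately have op: "open (transition d c ` W)" by (intro invariance_of_domain)
  have "transition d c (snd d p) \<in> transition d c ` W"
    using pos overlapI[OF assms(4,3)] by (auto simp: W_def)
  then have "snd c p \<in> transition d c ` W" using transition_snd[OF assms(2,4)] by simp
  then obtain e where e: "0 < e" "ball (snd c p) e \<subseteq> transition d c ` W"
    using op open_contains_ball by blast
  let ?z = "snd c p - (e / 2) *\<^sub>R axis None 1"
  have "?z \<in> ball (snd c p) e" using e(1) by (simp add: dist_norm)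
  then have "?z \<in> transition d c ` W" using e(2) by blast
  then have "?z \<in> overlap c d" using transition_image[OF assms(2), of c] by (auto simp: W_def)
  then have "0 \<le> ?z $ None"
    using openin_imp_subset[OF openin_overlap[OF assms(1,2)]] by (auto simp: halfspace_def)
  then show False using assms(5) e(1) by simp
qed

lemma mboundary_iff: "c \<in> A \<Longrightarrow> p \<in> fst c \<Longrightarrow> p \<in> mboundary A \<longleftrightarrow> snd c p $ None = 0"
  unfolding mboundary_def using boundary_invariant by blast

lemma transition_boundary:
  assumes "c \<in> A" "d \<in> A" "x \<in> overlap c d" "x $ None = 0"
  shows "transition c d x $ None = 0"
proof -
  from assms(3) obtain p where p: "p \<in> fst c" "p \<in> fst d" "x = snd c p" by (rule overlapE)
  then show ?thesis using boundary_invariant[OF assms(1,2) p(1,2)] assms(4) by (simp add: transition_snd assms(1))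
qed

text \<open>The transversal component of a transition map is identically zero along the boundary,
  hence so are its tangential derivatives there.\<close>

lemma jacobian_transition_tangential:
  assumes "c \<in> A" "d \<in> A" "x \<in> overlap c d" "x $ None = 0"
  shows "jacobian_transition c d x $ None $ Some i = 0"
proof -
  let ?W = "overlap c d" and ?y = "\<chi> i. x $ Some i"
  let ?f = "\<lambda>x. transition c d x $ None"
  have y: "bd_embed ?y = x" by (rule bd_embed_tangential[OF assms(4)])
  have diff: "?f differentiable (at x within ?W)"
    using transition_differentiable[OF assms(1-3)] differentiable_vec_iff by blast
  have "partial UNIV i (\<lambda>y. ?f (bd_embed y)) ?y = partial UNIV i (\<lambda>_. 0) ?y"
    by (rule partial_UNIV_cong[OF open_bd_embed_vimage[OF openin_overlap[OF assms(1,2)]]])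
      (use y assms transition_boundary in auto)
  also have "\<dots> = 0"
    by (rule partial_eqI[OF open_imp_corner_open[OF open_UNIV] UNIV_I has_derivative_const])
  finally show ?thesis
    using partial_bd_embed[OF openin_overlap[OF assms(1,2)], of ?y ?f i] assms diff
    by (simp add: y jacobian_transition_eq jacobian_nth)
qed

text \<open>The transversal component starts at 0 and stays nonnegative along the inward axis, so
  its derivative is nonnegative. It cannot be 0: the whole row would vanish with it, contrary to the
  invertibility of the Jacobian.\<close>

lemma jacobian_transition_normal_pos:
  assumes "c \<in> A" "d \<in> A" "x \<in> overlap c d" "x $ None = 0"
  shows "0 < jacobian_transition c d x $ None $ None"
proof -
  let ?W = "overlap c d" and ?J = "jacobian_transition c d x"
  let ?f = "\<lambda>x. transition c d x $ None"
  obtain e where e: "e > 0" "\<And>v. (\<And>i. 0 \<le> v $ i \<and> v $ i < e) \<Longrightarrow> x + v \<in> ?W"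
    using corner_openD[OF corner_open_overlap assms(3)] assms by blast
  have in_W: "x + t *\<^sub>R axis None 1 \<in> ?W" if "t \<in> {0..<e}" for t
    using that e(1) by (intro e(2)) (auto simp: axis_def)
  have diff: "?f differentiable (at (x + 0 *\<^sub>R axis None 1) within ?W)"
    using transition_differentiable[OF assms(1-3)] by (simp add: differentiable_vec_iff)
  have "((\<lambda>t. ?f (x + t *\<^sub>R axis None 1)) has_derivative (\<lambda>t. t * partial ?W None ?f (x + 0 *\<^sub>R axis None 1))) (at 0 within {0..<e})"
    by (rule has_derivative_axis_line[OF diff in_W])
  moreover have "(\<lambda>t. t * partial ?W None ?f (x + 0 *\<^sub>R axis None 1)) = (*) (?J $ None $ None)"
    using assms by (simp add: fun_eq_iff jacobian_transition_eq jacobian_nth)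
  ultimately have der: "((\<lambda>t. ?f (x + t *\<^sub>R axis None 1)) has_real_derivative ?J $ None $ None) (at 0 within {0..<e})"
    unfolding has_field_derivative_def by simp
  have nonneg: "0 \<le> ?f z" if "z \<in> ?W" for z
    using transition_image[OF assms(1), of d] that openin_imp_subset[OF openin_overlap[OF assms(2,1)]]
    by (auto simp: halfspace_def)
  have "\<not> ?J $ None $ None < 0"
  proof
    assume "?J $ None $ None < 0"
    from has_real_derivative_neg_dec_right[OF der this] obtain r where
      r: "r > 0" "\<And>h. 0 < h \<Longrightarrow> 0 + h \<in> {0..<e} \<Longrightarrow> h < r \<Longrightarrow> ?f (x + (0 + h) *\<^sub>R axis None 1) < ?f (x + 0 *\<^sub>R axis None 1)"
      by blast
    have "?f (x + (0 + min e r / 2) *\<^sub>R axis None 1) < ?f (x + 0 *\<^sub>R axis None 1)"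
      using e(1) r(1) by (intro r(2)) auto
    moreover have "0 \<le> ?f (x + (0 + min e r / 2) *\<^sub>R axis None 1)"
      using e(1) r(1) by (intro nonneg in_W) auto
    ultimately show False using transition_boundary[OF assms] by simp
  qed
  moreover have "?J $ None $ None \<noteq> 0"
  proof
    assume 0: "?J $ None $ None = 0"
    have row: "?J $ None $ k = 0" for k
      using 0 jacobian_transition_tangential[OF assms] by (cases k) auto
    have y: "transition c d x \<in> overlap d c" using transition_image assms by blast
    have "jacobian_transition c d x ** jacobian_transition d c (transition c d x) = mat 1"
      using jacobian_transition_inverse[OF assms(2,1) y] transition_inverse assms by simp
    then have "(?J ** jacobian_transition d c (transition c d x)) $ None $ None = 1"
      by (simp add: mat_def)
    then show False by (simp add: matrix_matrix_mult_def row)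
  qed
  ultimately show ?thesis by simp
qed

subsection \<open>Metrics and the mean curvature\<close>

lemma sym_tensor_transform:
  assumes "k \<in> sym_tensors m A" "c \<in> A" "d \<in> A" "x \<in> overlap c d"
  shows "k c x = transpose (jacobian_transition c d x) ** k d (transition c d x) ** jacobian_transition c d x"
proof -
  from assms(4) obtain p where p: "p \<in> fst c" "p \<in> fst d" "x = snd c p" by (rule overlapE)
  have "\<forall>c\<in>A. \<forall>d\<in>A. \<forall>p\<in>fst c \<inter> fst d. k c (snd c p) =
      transpose (jacobian_transition c d (snd c p)) ** k d (snd d p) ** jacobian_transition c d (snd c p)"
    using assms(1) unfolding sym_tensors_def by blast
  from this[THEN bspec, THEN bspec, THEN bspec, OF assms(2,3) IntI, OF p(1,2)]
  show ?thesis unfolding p(3) transition_snd[OF assms(2) p(1)] .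
qed

lemma Ck_sym_tensor:
  assumes "k \<in> sym_tensors m A" "c \<in> A" "j \<le> m"
  shows "Ck_on j (chart_image c) (\<lambda>x. k c x $ a $ b)"
proof -
  note S = corner_open_chart_image[OF assms(2)]
  have "Ck_on m (chart_image c) (k c)" using assms(1,2) unfolding sym_tensors_def by blast
  then have "Ck_on m (chart_image c) (\<lambda>x. k c x $ a $ b)"
    using Ck_on_vec_iff[OF S, of m "k c"] Ck_on_vec_iff[OF S, of m "\<lambda>x. k c x $ a"] by blast
  then show ?thesis using assms(3) by (rule Ck_on_mono[OF S])
qed

lemma metric_pos_def:
  assumes "g \<in> riemannian_metrics m A" "c \<in> A" "x \<in> chart_image c"
  shows "pos_def (g c x)"
proof -
  have "transpose (g c x) = g c x"
    using assms unfolding riemannian_metrics_def sym_tensors_def by blast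
  moreover have "\<forall>v. v \<noteq> 0 \<longrightarrow> 0 < v \<bullet> (g c x *v v)"
    using assms unfolding riemannian_metrics_def by blast
  ultimately show ?thesis unfolding pos_def_def by blast
qed

lemma metric_sym_tensor: "g \<in> riemannian_metrics m A \<Longrightarrow> g \<in> sym_tensors m A"
  by (simp add: riemannian_metrics_def)

lemma local_mean_curvature_chart_independent:
  assumes g: "g \<in> riemannian_metrics m A" and m: "1 \<le> m"
    and c: "c \<in> A" "p \<in> fst c" and d: "d \<in> A" "p \<in> fst d" and p: "snd c p $ None = 0"
  shows "local_mean_curvature (chart_image c) (g c) (snd c p) = local_mean_curvature (chart_image d) (g d) (snd d p)"
proof -
  let ?W = "overlap c d" and ?x = "snd c p"
  have x: "?x \<in> ?W" by (rule overlapI[OF c(2) d(2)])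
  have y: "transition c d ?x \<in> overlap d c" using transition_image[OF c(1), of d] x by blast
  have y0: "transition c d ?x $ None = 0" by (rule transition_boundary[OF c(1) d(1) x p])
  have inv: "transition d c (transition c d ?x) = ?x" by (rule transition_inverse[OF c(1) d(1) x])
  have pd: "pos_def (g c ?x)" using c(2) by (intro metric_pos_def[OF g c(1)]) blast
  note J = jacobian_transition_eq[OF c(1) d(1), symmetric]
  have "local_mean_curvature (chart_image c) (g c) ?x = local_mean_curvature ?W (g c) ?x"
    by (rule local_mean_curvature_openin[where G="g c", OF corner_open_chart_image[OF c(1)]
        openin_overlap_chart_image[OF c(1) d(1)] x pd, symmetric])
  also have "\<dots> = local_mean_curvature (chart_image d) (g d) (transition c d ?x)"
  proof (rule mean_curvature_transform[where G="g d" and G'="g c" and \<tau>="transition c d"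
        and K="jacobian_transition d c (transition c d (snd c p))", OF openin_overlap[OF c(1) d(1)] corner_open_chart_image[OF d(1)]])
    show "transition c d ` ?W \<subseteq> chart_image d" using transition_image[OF c(1), of d] overlap_subset by blast
    show "g c z = transpose (partial_jacobian ?W (transition c d) z) ** g d (transition c d z) ** partial_jacobian ?W (transition c d) z"
      if "z \<in> ?W" for z
      using sym_tensor_transform[OF metric_sym_tensor[OF g] c(1) d(1) that] by (simp add: J that)
    show "Ck_on 1 (chart_image d) (\<lambda>y. g d y $ a $ b)" for a b
      by (rule Ck_sym_tensor[OF metric_sym_tensor[OF g] d(1) m])
    show "partial_jacobian ?W (transition c d) ?x ** jacobian_transition d c (transition c d ?x) = mat 1"
      using jacobian_transition_inverse[OF d(1) c(1) y] by (simp add: J x inv)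
    show "jacobian_transition d c (transition c d ?x) ** partial_jacobian ?W (transition c d) ?x = mat 1"
      using jacobian_transition_inverse[OF c(1) d(1) x] by (simp add: J x)
    show "partial_jacobian ?W (transition c d) ?x $ None $ Some i = 0" for i
      using jacobian_transition_tangential[OF c(1) d(1) x p] by (simp add: J x)
    show "0 < partial_jacobian ?W (transition c d) ?x $ None $ None"
      using jacobian_transition_normal_pos[OF c(1) d(1) x p] by (simp add: J x)
    show "jacobian_transition d c (transition c d ?x) $ None $ Some i = 0" for i
      by (rule jacobian_transition_tangential[OF d(1) c(1) y y0])
    show "Ck_on 2 ?W (\<lambda>x. transition c d x $ a)" for a
      by (rule Ck_transition_nth[OF c(1) d(1)])
    show "pos_def (g d y)" if "y \<in> chart_image d" for y
      by (rule metric_pos_def[OF g d(1) that])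
    show "transition c d z $ None = 0" if "z \<in> ?W" "z $ None = 0" for z
      by (rule transition_boundary[OF c(1) d(1) that])
  qed (rule pd x p)+
  finally show ?thesis by (simp add: transition_snd[OF c])
qed

lemma mean_curvature_chart:
  assumes g: "g \<in> riemannian_metrics m A" and m: "1 \<le> m" and c: "c \<in> A" "p \<in> fst c" and p: "snd c p $ None = 0"
  shows "mean_curvature A g p = local_mean_curvature (chart_image c) (g c) (snd c p)"
proof -
  let ?d = "SOME c. c \<in> A \<and> p \<in> fst c"
  have d: "?d \<in> A \<and> p \<in> fst ?d" by (rule someI[of _ c]) (use c in blast)
  show ?thesis
    unfolding mean_curvature_def Let_def
    by (rule local_mean_curvature_chart_independent[OF g m c _ _ p, symmetric]) (use d in auto)
qed

end

subsection \<open>Critical points of the mean curvature\<close>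

lemma partial_open: "open W \<Longrightarrow> y \<in> W \<Longrightarrow> partial W i f y = partial UNIV i f y"
  by (rule partial_openin) simp_all

text \<open>Differentiating the chain rule once more produces one further term, second derivatives
  of \<sigma> times the gradient of F, and it vanishes at a critical point. The Hessian therefore
  changes by congruence with the Jacobian.\<close>

lemma
  fixes F :: "real ^ 'n \<Rightarrow> real" and \<sigma> :: "real ^ 'n \<Rightarrow> real ^ 'n"
  assumes W: "open W" and V: "open V" and \<sigma>W: "\<sigma> ` W \<subseteq> V"
    and F: "Ck_on 2 V F" and \<sigma>: "\<And>a. Ck_on 2 W (\<lambda>y. \<sigma> y $ a)"
    and E: "\<And>y. y \<in> W \<Longrightarrow> E y = F (\<sigma> y)" and y: "y \<in> W"
    and crit: "\<And>a. partial UNIV a F (\<sigma> y) = 0"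
  shows partial_chain_critical: "partial UNIV i E y = 0"
    and hessian_chain_critical: "hessian E y = transpose (partial_jacobian W \<sigma> y) ** hessian F (\<sigma> y) ** partial_jacobian W \<sigma> y"
proof -
  note Wc = open_imp_corner_open[OF W] and Vc = open_imp_corner_open[OF V]
  have d\<sigma>: "(\<lambda>y. \<sigma> y $ a) differentiable (at z within W)" if "z \<in> W" for z a
    using \<sigma>[of a] that by (simp add: numeral_2_eq_2 differentiable_on_def)
  have dF: "F differentiable (at (\<sigma> z) within V)" if "z \<in> W" for z
    using F that \<sigma>W by (auto simp: numeral_2_eq_2 differentiable_on_def)
  have dF2: "partial V a F differentiable (at (\<sigma> y) within V)" for a
    using F y \<sigma>W by (auto simp: numeral_2_eq_2 differentiable_on_def)
  have \<sigma>V: "\<sigma> z \<in> V" if "z \<in> W" for z using \<sigma>W that by blast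
  have gradient: "partial UNIV j E z = (\<Sum>a\<in>UNIV. partial_jacobian W \<sigma> z $ a $ j * partial V a F (\<sigma> z))" if z: "z \<in> W" for z j
  proof -
    have "partial UNIV j E z = partial W j (\<lambda>y. F (\<sigma> y)) z"
      unfolding partial_open[OF W z, symmetric] by (rule partial_cong[OF E z])
    then show ?thesis using partial_compose(2)[OF Wc \<sigma>W z d\<sigma>[OF z] dF[OF z]] by simp
  qed
  have crit': "partial V a F (\<sigma> y) = 0" for a
    by (rule trans[OF partial_open[OF V \<sigma>V[OF y]] crit])
  show "partial UNIV i E y = 0" by (simp add: gradient[OF y] crit')
  let ?J = "partial_jacobian W \<sigma> y"
  have "hessian E y $ i $ j = (transpose ?J ** hessian F (\<sigma> y) ** ?J) $ i $ j" for i j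
  proof -
    have d2\<sigma>: "((\<lambda>z. partial W j (\<lambda>y. \<sigma> y $ a) z) has_derivative
        (\<lambda>v. \<Sum>l\<in>UNIV. v $ l *\<^sub>R partial W l (partial W j (\<lambda>y. \<sigma> y $ a)) y)) (at y within W)" for a
      using \<sigma>[of a] y by (intro has_derivative_partials) (simp add: numeral_2_eq_2 differentiable_on_def)
    note dcomp = has_derivative_partials[OF partial_compose(1)[OF Wc \<sigma>W y d\<sigma>[OF y] dF2]]
    have "hessian E y $ i $ j = partial UNIV i (\<lambda>z. \<Sum>a\<in>UNIV. partial W j (\<lambda>y. \<sigma> y $ a) z * partial V a F (\<sigma> z)) y"
      unfolding hessian_def vec_lambda_beta by (rule partial_UNIV_cong[OF W y]) (simp add: gradient jacobian_nth)
    also have "\<dots> = partial W i (\<lambda>z. \<Sum>a\<in>UNIV. partial W j (\<lambda>y. \<sigma> y $ a) z * partial V a F (\<sigma> z)) y"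
      by (rule partial_open[OF W y, symmetric])
    also have "\<dots> = (\<Sum>a\<in>UNIV. partial W j (\<lambda>y. \<sigma> y $ a) y * partial W i (\<lambda>z. partial V a F (\<sigma> z)) y
        + partial W i (partial W j (\<lambda>y. \<sigma> y $ a)) y * partial V a F (\<sigma> y))"
      by (rule partial_eqI[OF Wc y has_derivative_sum[OF has_derivative_mult[OF d2\<sigma> dcomp]], THEN trans])
        (simp only: real_scaleR_def sum_axis)
    also have "\<dots> = (\<Sum>a\<in>UNIV. ?J $ a $ j * (\<Sum>b\<in>UNIV. ?J $ b $ i * partial V b (partial V a F) (\<sigma> y)))"
      unfolding crit' partial_compose(2)[OF Wc \<sigma>W y d\<sigma>[OF y] dF2] by (simp add: jacobian_nth)
    also have "\<dots> = (\<Sum>a\<in>UNIV. \<Sum>b\<in>UNIV. ?J $ b $ i * ?J $ a $ j * hessian F (\<sigma> y) $ b $ a)"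
    proof -
      have "hessian F (\<sigma> y) $ b $ a = partial V b (partial V a F) (\<sigma> y)" for a b
      proof -
        have "hessian F (\<sigma> y) $ b $ a = partial UNIV b (partial V a F) (\<sigma> y)"
          unfolding hessian_def vec_lambda_beta
          by (rule partial_UNIV_cong[OF V \<sigma>V[OF y]]) (rule partial_open[OF V, symmetric])
        then show ?thesis by (simp add: partial_open[OF V \<sigma>V[OF y]])
      qed
      then show ?thesis by (simp add: sum_distrib_left mult_ac)
    qed
    also have "\<dots> = (transpose ?J ** hessian F (\<sigma> y) ** ?J) $ i $ j"
      unfolding congruence_nth by (rule sum.swap)
    finally show ?thesis .
  qed
  then show "hessian E y = transpose ?J ** hessian F (\<sigma> y) ** ?J" by (simp add: vec_eq_iff)
qed

text \<open>The Hessian of the restriction to the boundary, but with derivatives taken within the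
  half space, so that \<open>Cfam\<close> applies to it; \<open>hessian_bd_embed\<close> is the
  link.\<close>

definition tangential_hessian :: "(real ^ 'n::finite option) set \<Rightarrow> (real ^ 'n option \<Rightarrow> real) \<Rightarrow> real ^ 'n option \<Rightarrow> real ^ 'n ^ 'n" where
  "tangential_hessian S f x = (\<chi> i j. partial S (Some i) (partial S (Some j) f) x)"

context manifold
begin

abbreviation chart_mean_curvature :: "('a, 'n) tensor2 \<Rightarrow> ('a, 'n) chart \<Rightarrow> real ^ 'n option \<Rightarrow> real" where
  "chart_mean_curvature g c \<equiv> local_mean_curvature (chart_image c) (g c)"

lemma Ck_mean_curvature:
  assumes g: "g \<in> riemannian_metrics m A" and c: "c \<in> A" and k: "Suc k \<le> m"
  shows "Ck_on k (chart_image c) (chart_mean_curvature g c)"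
  unfolding Ck_on_Cfam
  by (rule Cfam_mean_curvature[OF smooth_families_continuous[OF corner_open_chart_image[OF c]]])
    (rule Ck_sym_tensor[OF metric_sym_tensor[OF g] c k, unfolded Ck_on_Cfam], rule metric_pos_def[OF g c])

lemma bd_embed_bd_coord: "snd c p $ None = 0 \<Longrightarrow> bd_embed (bd_coord c p) = snd c p"
  unfolding bd_coord_def by (rule bd_embed_tangential)

lemma bd_local_mean_curvature:
  assumes g: "g \<in> riemannian_metrics m A" and m: "1 \<le> m" and c: "c \<in> A" and y: "bd_embed y \<in> chart_image c"
  shows "bd_local c (mean_curvature A g) y = chart_mean_curvature g c (bd_embed y)"
  using mean_curvature_chart[OF g m c chart_inv_in[OF y]] by (simp add: bd_local_def snd_chart_inv[OF y])

context
  fixes g :: "('a, 'n) tensor2" and m :: nat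
  assumes g: "g \<in> riemannian_metrics m A" and m: "3 \<le> m"
begin

lemma Ck2_mean_curvature: "c \<in> A \<Longrightarrow> Ck_on 2 (chart_image c) (chart_mean_curvature g c)"
  using m by (intro Ck_mean_curvature[OF g]) auto

lemma bd_local_eq:
  "c \<in> A \<Longrightarrow> bd_embed y \<in> chart_image c \<Longrightarrow> bd_local c (mean_curvature A g) y = chart_mean_curvature g c (bd_embed y)"
  using m by (intro bd_local_mean_curvature[OF g]) auto

lemma bd_local_has_derivative:
  assumes c: "c \<in> A" "p \<in> fst c" and p: "snd c p $ None = 0"
  shows "(bd_local c (mean_curvature A g) has_derivative
    (\<lambda>v. \<Sum>i\<in>UNIV. v $ i * partial (chart_image c) (Some i) (chart_mean_curvature g c) (snd c p))) (at (bd_coord c p))"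
proof -
  have x: "bd_embed (bd_coord c p) \<in> chart_image c" using c bd_embed_bd_coord[of c p, OF p] by simp
  have "chart_mean_curvature g c differentiable (at (bd_embed (bd_coord c p)) within chart_image c)"
    using Ck2_mean_curvature[OF c(1)] x by (auto simp: numeral_2_eq_2 differentiable_on_def)
  from has_derivative_bd_embed[OF openin_chart_image[OF c(1)] x this]
  show ?thesis
    unfolding bd_embed_bd_coord[of c p, OF p]
    by (rule has_derivative_transform_within_open[OF _ open_bd_embed_vimage[OF openin_chart_image[OF c(1)]]])
      (use x in \<open>simp_all add: bd_local_eq[OF c(1)]\<close>)
qed

lemma partial_bd_local:
  assumes c: "c \<in> A" "p \<in> fst c" and p: "snd c p $ None = 0"
  shows "partial UNIV i (bd_local c (mean_curvature A g)) (bd_coord c p)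
    = partial (chart_image c) (Some i) (chart_mean_curvature g c) (snd c p)"
  using partial_eqI[OF open_imp_corner_open[OF open_UNIV] UNIV_I bd_local_has_derivative[OF assms], of i]
  by (simp only: sum_axis)

lemma hessian_bd_local:
  assumes c: "c \<in> A" "p \<in> fst c" and p: "snd c p $ None = 0"
  shows "hessian (bd_local c (mean_curvature A g)) (bd_coord c p)
    = tangential_hessian (chart_image c) (chart_mean_curvature g c) (snd c p)"
proof -
  have x: "bd_embed (bd_coord c p) \<in> chart_image c" using c bd_embed_bd_coord[of c p, OF p] by simp
  have "hessian (bd_local c (mean_curvature A g)) (bd_coord c p) $ i $ j =
      tangential_hessian (chart_image c) (chart_mean_curvature g c) (snd c p) $ i $ j" for i j
    unfolding tangential_hessian_def vec_lambda_beta bd_embed_bd_coord[of c p, OF p, symmetric]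
    by (rule hessian_bd_embed[OF openin_chart_image[OF c(1)] x Ck2_mean_curvature[OF c(1)]
          open_bd_embed_vimage[OF openin_chart_image[OF c(1)]]])
      (use x in \<open>simp_all add: bd_local_eq[OF c(1)]\<close>)
  then show ?thesis by (simp add: vec_eq_iff)
qed

definition bd_transition :: "('a, 'n) chart \<Rightarrow> ('a, 'n) chart \<Rightarrow> real ^ 'n \<Rightarrow> real ^ 'n" where
  "bd_transition c d y = (\<chi> i. transition c d (bd_embed y) $ Some i)"

text \<open>The two boundary expressions of H differ by the boundary part of the transition map. Its
  Jacobian is the tangential block of the full Jacobian, invertible because taking this block is
  multiplicative for matrices that preserve tangential vectors.\<close>

lemma
  assumes c: "c \<in> A" "p \<in> fst c" and d: "d \<in> A" "p \<in> fst d" and p: "snd c p $ None = 0"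
    and crit: "\<And>i. partial (chart_image d) (Some i) (chart_mean_curvature g d) (snd d p) = 0"
  shows critical_transfer: "partial (chart_image c) (Some i) (chart_mean_curvature g c) (snd c p) = 0"
    and hessian_transfer: "det (tangential_hessian (chart_image d) (chart_mean_curvature g d) (snd d p)) \<noteq> 0 \<Longrightarrow>
      det (tangential_hessian (chart_image c) (chart_mean_curvature g c) (snd c p)) \<noteq> 0"
proof -
  let ?W = "{y. bd_embed y \<in> overlap c d}" and ?V = "{y. bd_embed y \<in> chart_image d}"
  let ?\<sigma> = "bd_transition c d" and ?y = "bd_coord c p" and ?H = "mean_curvature A g"
  have pd: "snd d p $ None = 0" by (rule boundary_invariant[OF c(1) d(1) c(2) d(2) p])
  have ey: "bd_embed ?y = snd c p" by (rule bd_embed_bd_coord[OF p])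
  have x: "snd c p \<in> overlap c d" by (rule overlapI[OF c(2) d(2)])
  have W: "open ?W" by (rule open_bd_embed_vimage[OF openin_overlap[OF c(1) d(1)]])
  have V: "open ?V" by (rule open_bd_embed_vimage[OF openin_chart_image[OF d(1)]])
  have y: "?y \<in> ?W" using x ey by simp
  have e\<sigma>: "bd_embed (?\<sigma> z) = transition c d (bd_embed z)" if "z \<in> ?W" for z
    unfolding bd_transition_def
    using that transition_boundary[OF c(1) d(1)] by (intro bd_embed_tangential) simp
  have \<sigma>W: "?\<sigma> ` ?W \<subseteq> ?V"
    using e\<sigma> transition_image[OF c(1), of d] overlap_subset[of d c] by fastforce
  have \<sigma>y: "?\<sigma> ?y = bd_coord d p"
    unfolding bd_transition_def ey transition_snd[OF c] by (simp add: bd_coord_def)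
  have emb: "Ck_on k UNIV (\<lambda>y. bd_embed y $ a)" for k and a :: "'n option"
  proof (cases a)
    case None then show ?thesis using Ck_on_const[OF open_imp_corner_open[OF open_UNIV], of k 0] by simp
  next
    case (Some i) then show ?thesis using Ck_on_vec_nth[OF open_imp_corner_open[OF open_UNIV], of k i] by simp
  qed
  have embW: "Ck_on k U (\<lambda>y. bd_embed y $ a)" if "open U" for k U and a :: "'n option"
    by (rule Ck_on_openin[OF _ emb]) (simp add: that)
  have \<sigma>: "Ck_on 2 ?W (\<lambda>y. ?\<sigma> y $ a)" for a
    unfolding bd_transition_def vec_lambda_beta
    by (rule Ck_on_compose[OF open_imp_corner_open[OF W] corner_open_overlap[OF c(1) d(1)] _
          Ck_transition_nth[OF c(1) d(1)] embW[OF W]]) auto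
  have F: "Ck_on 2 ?V (bd_local d ?H)"
  proof -
    have "Ck_on 2 ?V (\<lambda>y. chart_mean_curvature g d (bd_embed y))"
      by (rule Ck_on_compose[OF open_imp_corner_open[OF V] corner_open_chart_image[OF d(1)] _
          Ck2_mean_curvature[OF d(1)] embW[OF V]]) auto
    then show ?thesis
      using Ck_on_cong[of ?V "bd_local d ?H" "\<lambda>y. chart_mean_curvature g d (bd_embed y)" 2]
      by (simp add: bd_local_eq[OF d(1)])
  qed
  have E: "bd_local c ?H z = bd_local d ?H (?\<sigma> z)" if z: "z \<in> ?W" for z
  proof -
    obtain q where q: "q \<in> fst c" "q \<in> fst d" "bd_embed z = snd c q" using z by (auto elim: overlapE)
    show ?thesis
      unfolding bd_local_def e\<sigma>[OF z] q(3) transition_snd[OF c(1) q(1)]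
      by (simp add: chart_inv_snd[OF c(1) q(1)] chart_inv_snd[OF d(1) q(2)])
  qed
  have crit': "partial UNIV a (bd_local d ?H) (?\<sigma> ?y) = 0" for a
    unfolding \<sigma>y partial_bd_local[OF d pd] by (rule crit)
  note chain = W V \<sigma>W F \<sigma> E y crit'
  show "partial (chart_image c) (Some i) (chart_mean_curvature g c) (snd c p) = 0"
    using partial_chain_critical[OF chain] partial_bd_local[OF c p] by simp
  let ?J = "partial_jacobian ?W ?\<sigma> ?y"
  have "?J = tangential_part (jacobian_transition c d (snd c p))"
  proof -
    have "?J $ a $ i = jacobian_transition c d (snd c p) $ Some a $ Some i" for a i
    proof -
      have diff: "(\<lambda>x. transition c d x $ Some a) differentiable (at (bd_embed ?y) within overlap c d)"
        using transition_differentiable[OF c(1) d(1) x] by (simp add: differentiable_vec_iff ey)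
      have "?J $ a $ i = partial UNIV i (\<lambda>y. transition c d (bd_embed y) $ Some a) ?y"
        unfolding jacobian_nth partial_open[OF W y] by (simp add: bd_transition_def)
      also have "\<dots> = partial (overlap c d) (Some i) (\<lambda>x. transition c d x $ Some a) (bd_embed ?y)"
        using y by (intro partial_bd_embed[OF openin_overlap[OF c(1) d(1)] _ diff]) simp
      finally show ?thesis using c d x by (simp add: jacobian_transition_eq jacobian_nth ey)
    qed
    then show ?thesis by (simp add: tangential_part_def vec_eq_iff)
  qed
  moreover have "tangential_part (jacobian_transition d c (transition c d (snd c p))) ** tangential_part (jacobian_transition c d (snd c p)) = mat 1"
    by (simp only: tangential_part_mult[OF jacobian_transition_tangential[OF c(1) d(1) x p], symmetric]
        jacobian_transition_inverse[OF c(1) d(1) x] tangential_part_mat)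
  ultimately have "det ?J \<noteq> 0"
    by (metis det_I det_mul mult_zero_right zero_neq_one)
  moreover have "hessian (bd_local c ?H) ?y = transpose ?J ** hessian (bd_local d ?H) (?\<sigma> ?y) ** ?J"
    by (rule hessian_chain_critical[OF chain])
  ultimately show "det (tangential_hessian (chart_image d) (chart_mean_curvature g d) (snd d p)) \<noteq> 0 \<Longrightarrow>
      det (tangential_hessian (chart_image c) (chart_mean_curvature g c) (snd c p)) \<noteq> 0"
    unfolding \<sigma>y hessian_bd_local[OF c p] hessian_bd_local[OF d pd] by (simp add: det_mul)
qed

text \<open>The definition quantifies over all charts at p; \<open>critical_transfer\<close> reduces
  it to whichever chart is at hand, and \<open>hessian_transfer\<close> does the same for
  nondegeneracy below.\<close>

lemma critical_point_iff:
  assumes c: "c \<in> A" "p \<in> fst c" and p: "snd c p $ None = 0"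
  shows "critical_point A (mean_curvature A g) p \<longleftrightarrow>
    (\<forall>i. partial (chart_image c) (Some i) (chart_mean_curvature g c) (snd c p) = 0)"
proof
  assume "critical_point A (mean_curvature A g) p"
  then have "(bd_local c (mean_curvature A g) has_derivative (\<lambda>_. 0)) (at (bd_coord c p))"
    using c by (simp add: critical_point_def)
  then show "\<forall>i. partial (chart_image c) (Some i) (chart_mean_curvature g c) (snd c p) = 0"
    using partial_eqI[OF open_imp_corner_open[OF open_UNIV] UNIV_I] partial_bd_local[OF c p] by metis
next
  assume crit: "\<forall>i. partial (chart_image c) (Some i) (chart_mean_curvature g c) (snd c p) = 0"
  have "(bd_local d (mean_curvature A g) has_derivative (\<lambda>_. 0)) (at (bd_coord d p))" if d: "d \<in> A" "p \<in> fst d" for d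
  proof -
    have pd: "snd d p $ None = 0" by (rule boundary_invariant[OF c(1) d(1) c(2) d(2) p])
    show ?thesis
      using bd_local_has_derivative[OF d pd] critical_transfer[OF d c pd crit[rule_format]] by simp
  qed
  then show "critical_point A (mean_curvature A g) p"
    using mboundary_iff[OF c] p by (simp add: critical_point_def)
qed

lemma nondegenerate_at_iff:
  assumes c: "c \<in> A" "p \<in> fst c" and p: "snd c p $ None = 0"
    and crit: "critical_point A (mean_curvature A g) p"
  shows "nondegenerate_at A (mean_curvature A g) p \<longleftrightarrow>
    det (tangential_hessian (chart_image c) (chart_mean_curvature g c) (snd c p)) \<noteq> 0"
proof
  assume "nondegenerate_at A (mean_curvature A g) p"
  then have "invertible (hessian (bd_local c (mean_curvature A g)) (bd_coord c p))"
    using c by (simp add: nondegenerate_at_def)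
  then show "det (tangential_hessian (chart_image c) (chart_mean_curvature g c) (snd c p)) \<noteq> 0"
    by (simp add: hessian_bd_local[OF c p] invertible_det_nz)
next
  assume det: "det (tangential_hessian (chart_image c) (chart_mean_curvature g c) (snd c p)) \<noteq> 0"
  have "invertible (hessian (bd_local d (mean_curvature A g)) (bd_coord d p))" if d: "d \<in> A" "p \<in> fst d" for d
  proof -
    have pd: "snd d p $ None = 0" by (rule boundary_invariant[OF c(1) d(1) c(2) d(2) p])
    show ?thesis
      unfolding invertible_det_nz hessian_bd_local[OF d pd]
      by (rule hessian_transfer[OF d c pd _ det]) (use crit critical_point_iff[OF c p] in blast)
  qed
  then show "nondegenerate_at A (mean_curvature A g) p" by (simp add: nondegenerate_at_def)
qed

end

end

section \<open>The space of tensors\<close>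

lemma finite_multi_indices: "finite {\<beta> :: 'k::finite \<Rightarrow> nat. (\<Sum>i\<in>UNIV. \<beta> i) \<le> m}"
proof (rule finite_subset)
  show "{\<beta>. (\<Sum>i\<in>UNIV. \<beta> i) \<le> m} \<subseteq> PiE (UNIV :: 'k set) (\<lambda>_. {..m})"
  proof (intro subsetI PiE_I)
    fix \<beta> :: "'k \<Rightarrow> nat" and i assume "\<beta> \<in> {\<beta>. (\<Sum>i\<in>UNIV. \<beta> i) \<le> m}"
    moreover have "\<beta> i \<le> (\<Sum>i\<in>UNIV. \<beta> i)" by (rule member_le_sum) auto
    ultimately show "\<beta> i \<in> {..m}" by simp
  qed simp
qed (simp add: finite_PiE)

text \<open>The list depends on \<beta> only, so one ordering serves all functions simultaneously;
  the linearity of \<open>multi_partial\<close> on C^m functions relies on this.\<close>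

lemma multi_partial_partials:
  assumes "corner_open S" "(\<Sum>i\<in>UNIV. \<beta> i) \<le> m"
  obtains "is" where "length is \<le> m" "count_list is = \<beta>"
    "\<And>(f :: _ \<Rightarrow> real) x. Ck_on m S f \<Longrightarrow> x \<in> S \<Longrightarrow> multi_partial S \<beta> f x = partials S is f x"
proof -
  obtain "is" where i: "count_list is = \<beta>" "length is = (\<Sum>i\<in>UNIV. \<beta> i)" by (rule ex_count_list)
  show thesis
  proof (rule that[of "is"])
    show "multi_partial S \<beta> f x = partials S is f x" if "Ck_on m S f" "x \<in> S" for f :: "_ \<Rightarrow> real" and x
      unfolding i(1)[symmetric]
      by (rule multi_partial_eq[OF assms(1) Ck_on_mono[OF assms(1) that(1)] that(2)]) (use i assms(2) in simp)
  qed (use i assms(2) in auto)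
qed

lemma Ck_on_partials_continuous:
  assumes "corner_open S" "Ck_on m S (f :: _ \<Rightarrow> real)" "length is \<le> m"
  shows "continuous_on S (partials S is f)"
  using Ck_on_partials[of "is" 0 S f] Ck_on_mono[OF assms] by simp

lemma congruence_linear:
  fixes B C J :: "real ^ 'k ^ 'k"
  shows "transpose J ** (a *\<^sub>R B + b *\<^sub>R C) ** J = a *\<^sub>R (transpose J ** B ** J) + b *\<^sub>R (transpose J ** C ** J)"
  by (simp add: vec_eq_iff congruence_nth distrib_left sum.distrib sum_distrib_left mult_ac)

locale normed_manifold = manifold M A
  for M :: "'a topology" and A :: "('a, 'n::finite) chart set" +
  fixes L :: "'l set" and V :: "'l \<Rightarrow> 'a set" and \<phi> :: "'l \<Rightarrow> ('a, 'n) chart" and m :: nat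
  assumes compact: "compact_space M" and cover: "norm_cover M A L V \<phi>"
begin

abbreviation "tensors \<equiv> sym_tensors m A"
abbreviation "metrics \<equiv> riemannian_metrics m A"
abbreviation "tensor_norm \<equiv> Cm_norm m L V \<phi>"

lemma finite_L: "finite L"
  using cover by (simp add: norm_cover_def)

lemma cover_chart: "\<alpha> \<in> L \<Longrightarrow> \<phi> \<alpha> \<in> A"
  using cover unfolding norm_cover_def by blast

lemma cover_subset: assumes "\<alpha> \<in> L" shows "V \<alpha> \<subseteq> M closure_of V \<alpha>" "M closure_of V \<alpha> \<subseteq> fst (\<phi> \<alpha>)"
proof -
  have "(\<Union>\<alpha>\<in>L. V \<alpha>) = topspace M" using cover by (simp add: norm_cover_def)
  then show "V \<alpha> \<subseteq> M closure_of V \<alpha>" using assms by (intro closure_of_subset) blast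
  show "M closure_of V \<alpha> \<subseteq> fst (\<phi> \<alpha>)" using cover assms unfolding norm_cover_def by blast
qed

lemma cover_member: "\<alpha> \<in> L \<Longrightarrow> p \<in> V \<alpha> \<Longrightarrow> p \<in> fst (\<phi> \<alpha>)"
  using cover_subset by blast

lemma coverE: assumes "p \<in> topspace M" obtains \<alpha> where "\<alpha> \<in> L" "p \<in> V \<alpha>"
  using cover assms unfolding norm_cover_def by blast

lemma compact_chart_image:
  assumes "c \<in> A" "closedin M K" "K \<subseteq> fst c"
  shows "compact (snd c ` K)"
proof -
  have "compactin (subtopology M (fst c)) K"
    using closedin_compact_space[OF compact assms(2)] assms(3) by (simp add: compactin_subtopology)
  moreover have "continuous_map (subtopology M (fst c)) euclidean (snd c)"
    using homeomorphic_imp_continuous_map[OF chart_homeomorphic[OF assms(1)]]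
    by (simp add: continuous_map_in_subtopology)
  ultimately have "compactin euclidean (snd c ` K)" by (rule image_compactin)
  then show ?thesis by simp
qed

lemma tensor_linear:
  assumes "k \<in> tensors" "k' \<in> tensors"
  shows "(\<lambda>c x. a *\<^sub>R k c x + b *\<^sub>R k' c x) \<in> tensors"
  unfolding sym_tensors_def
proof (intro CollectI conjI ballI allI impI)
  fix c assume c: "c \<in> A"
  note S = corner_open_chart_image[OF c]
  have "Ck_on m (chart_image c) (\<lambda>x. (a *\<^sub>R k c x + b *\<^sub>R k' c x) $ i $ j)" for i j
    using Ck_on_add[OF S Ck_on_mult[OF S Ck_on_const[OF S, of m a] Ck_sym_tensor[OF assms(1) c order_refl, of i j]]
        Ck_on_mult[OF S Ck_on_const[OF S, of m b] Ck_sym_tensor[OF assms(2) c order_refl, of i j]]]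
    by simp
  then show "Ck_on m (chart_image c) (\<lambda>x. a *\<^sub>R k c x + b *\<^sub>R k' c x)"
    using Ck_on_vec_iff[OF S, of m "\<lambda>x. a *\<^sub>R k c x + b *\<^sub>R k' c x"]
      Ck_on_vec_iff[OF S, of m "\<lambda>x. (a *\<^sub>R k c x + b *\<^sub>R k' c x) $ i" for i] by blast
next
  fix c x assume cx: "c \<in> A" "x \<in> chart_image c"
  have "transpose (k c x) = k c x" "transpose (k' c x) = k' c x"
    using assms cx unfolding sym_tensors_def by blast+
  then show "transpose (a *\<^sub>R k c x + b *\<^sub>R k' c x) = a *\<^sub>R k c x + b *\<^sub>R k' c x"
    using symmetric_matrix_nth[of "k c x"] symmetric_matrix_nth[of "k' c x"]
    by (subst vec_eq_iff, subst vec_eq_iff) (simp add: transpose_def)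
next
  fix c d p assume c: "c \<in> A" and d: "d \<in> A" and p: "p \<in> fst c \<inter> fst d"
  let ?J = "jacobian_transition c d (snd c p)"
  have "k c (snd c p) = transpose ?J ** k d (snd d p) ** ?J" "k' c (snd c p) = transpose ?J ** k' d (snd d p) ** ?J"
    using sym_tensor_transform[OF assms(1) c d overlapI] sym_tensor_transform[OF assms(2) c d overlapI] p
    by (simp_all add: transition_snd c)
  then show "a *\<^sub>R k c (snd c p) + b *\<^sub>R k' c (snd c p) =
      transpose ?J ** (a *\<^sub>R k d (snd d p) + b *\<^sub>R k' d (snd d p)) ** ?J"
    unfolding congruence_linear by simp
next
  fix c x assume "c \<notin> A \<or> x \<notin> chart_image c"
  then have "k c x = 0" "k' c x = 0" using assms unfolding sym_tensors_def by blast+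
  then show "a *\<^sub>R k c x + b *\<^sub>R k' c x = 0" by simp
qed

lemma tensor_diff: "k \<in> tensors \<Longrightarrow> k' \<in> tensors \<Longrightarrow> (\<lambda>c x. k c x - k' c x) \<in> tensors"
  using tensor_linear[of k k' 1 "-1"] by simp

section \<open>The C^m norm and the metric space of tensors\<close>

definition coefficient_norm :: "'l \<Rightarrow> ('n option \<Rightarrow> nat) \<Rightarrow> 'n option \<Rightarrow> 'n option \<Rightarrow> ('a, 'n) tensor2 \<Rightarrow> real" where
  "coefficient_norm \<alpha> \<beta> i j k = Sup (insert 0 ((\<lambda>x. \<bar>multi_partial (chart_image (\<phi> \<alpha>)) \<beta> (\<lambda>y. k (\<phi> \<alpha>) y $ i $ j) x\<bar>)
                         ` snd (\<phi> \<alpha>) ` V \<alpha>))"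

lemma tensor_norm_eq: "tensor_norm k =
    (\<Sum>\<alpha>\<in>L. \<Sum>\<beta> | (\<Sum>i\<in>UNIV. \<beta> i) \<le> m. \<Sum>i\<in>UNIV. \<Sum>j\<in>UNIV. coefficient_norm \<alpha> \<beta> i j k)"
  by (simp add: Cm_norm_def coefficient_norm_def)

context
  fixes \<alpha> :: 'l and \<beta> :: "'n option \<Rightarrow> nat"
  assumes \<alpha>: "\<alpha> \<in> L" and \<beta>: "(\<Sum>i\<in>UNIV. \<beta> i) \<le> m"
begin

text \<open>The closure of V \<alpha> is compact and lies in the chart, where the derivative is
  continuous. Without boundedness the real supremum in the norm would carry no information.\<close>

lemma bdd_coefficient:
  assumes "k \<in> tensors"
  shows "bdd_above (insert 0 ((\<lambda>x. \<bar>multi_partial (chart_image (\<phi> \<alpha>)) \<beta> (\<lambda>y. k (\<phi> \<alpha>) y $ i $ j) x\<bar>) ` snd (\<phi> \<alpha>) ` V \<alpha>))"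
proof -
  let ?S = "chart_image (\<phi> \<alpha>)" and ?f = "\<lambda>y. k (\<phi> \<alpha>) y $ i $ j" and ?K = "snd (\<phi> \<alpha>) ` (M closure_of V \<alpha>)"
  note S = corner_open_chart_image[OF cover_chart[OF \<alpha>]]
  note f = Ck_sym_tensor[OF assms cover_chart[OF \<alpha>] order_refl, of i j]
  obtain "is" where i: "length is \<le> m" "\<And>(f :: _ \<Rightarrow> real) x. Ck_on m ?S f \<Longrightarrow> x \<in> ?S \<Longrightarrow> multi_partial ?S \<beta> f x = partials ?S is f x"
    using multi_partial_partials[OF S \<beta>] by metis
  have K: "compact ?K" by (rule compact_chart_image[OF cover_chart[OF \<alpha>] closedin_closure_of cover_subset(2)[OF \<alpha>]])
  have sub: "snd (\<phi> \<alpha>) ` V \<alpha> \<subseteq> ?K" "?K \<subseteq> ?S" using cover_subset[OF \<alpha>] by blast+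
  have "continuous_on ?K (\<lambda>x. \<bar>partials ?S is ?f x\<bar>)"
    by (intro continuous_on_rabs continuous_on_subset[OF Ck_on_partials_continuous[OF S f i(1)] sub(2)])
  then have "bdd_above ((\<lambda>x. \<bar>partials ?S is ?f x\<bar>) ` ?K)"
    using compact_continuous_image[OF _ K] by (intro bounded_imp_bdd_above compact_imp_bounded) blast
  then have "bdd_above ((\<lambda>x. \<bar>partials ?S is ?f x\<bar>) ` snd (\<phi> \<alpha>) ` V \<alpha>)"
    by (rule bdd_above_mono) (use sub in blast)
  moreover have "(\<lambda>x. \<bar>partials ?S is ?f x\<bar>) ` snd (\<phi> \<alpha>) ` V \<alpha> = (\<lambda>x. \<bar>multi_partial ?S \<beta> ?f x\<bar>) ` snd (\<phi> \<alpha>) ` V \<alpha>"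
  proof (intro image_cong refl)
    fix x assume "x \<in> snd (\<phi> \<alpha>) ` V \<alpha>"
    then have x: "x \<in> ?S" using sub by blast
    show "\<bar>partials ?S is ?f x\<bar> = \<bar>multi_partial ?S \<beta> ?f x\<bar>" by (simp only: i(2)[OF f x])
  qed
  ultimately show ?thesis by (simp only: bdd_above_insert)
qed

lemma coefficient_le:
  assumes "k \<in> tensors" "p \<in> V \<alpha>"
  shows "\<bar>multi_partial (chart_image (\<phi> \<alpha>)) \<beta> (\<lambda>y. k (\<phi> \<alpha>) y $ i $ j) (snd (\<phi> \<alpha>) p)\<bar> \<le> coefficient_norm \<alpha> \<beta> i j k"
  unfolding coefficient_norm_def by (rule cSup_upper[OF _ bdd_coefficient[OF assms(1)]]) (intro insertI2 imageI assms(2))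

lemma coefficient_norm_nonneg: "k \<in> tensors \<Longrightarrow> 0 \<le> coefficient_norm \<alpha> \<beta> i j k"
  unfolding coefficient_norm_def by (rule cSup_upper[OF insertI1 bdd_coefficient])

lemma coefficient_norm_linear:
  assumes k: "k \<in> tensors" "k' \<in> tensors"
  shows "coefficient_norm \<alpha> \<beta> i j (\<lambda>c x. a *\<^sub>R k c x + b *\<^sub>R k' c x)
    \<le> \<bar>a\<bar> * coefficient_norm \<alpha> \<beta> i j k + \<bar>b\<bar> * coefficient_norm \<alpha> \<beta> i j k'"
proof -
  let ?S = "chart_image (\<phi> \<alpha>)" and ?f = "\<lambda>y. k (\<phi> \<alpha>) y $ i $ j" and ?g = "\<lambda>y. k' (\<phi> \<alpha>) y $ i $ j"
  let ?h = "\<lambda>y. (a *\<^sub>R k (\<phi> \<alpha>) y + b *\<^sub>R k' (\<phi> \<alpha>) y) $ i $ j"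
  note S = corner_open_chart_image[OF cover_chart[OF \<alpha>]]
  note f = Ck_sym_tensor[OF k(1) cover_chart[OF \<alpha>] order_refl, of i j]
  note g = Ck_sym_tensor[OF k(2) cover_chart[OF \<alpha>] order_refl, of i j]
  note h = Ck_sym_tensor[OF tensor_linear[OF k] cover_chart[OF \<alpha>] order_refl, of a b i j]
  obtain "is" where i: "length is \<le> m" "\<And>(f :: _ \<Rightarrow> real) x. Ck_on m ?S f \<Longrightarrow> x \<in> ?S \<Longrightarrow> multi_partial ?S \<beta> f x = partials ?S is f x"
    using multi_partial_partials[OF S \<beta>] by metis
  have mp: "multi_partial ?S \<beta> ?h x = a * multi_partial ?S \<beta> ?f x + b * multi_partial ?S \<beta> ?g x" if x: "x \<in> ?S" for x
  proof -
    have "?h = (\<lambda>y. a * ?f y + b * ?g y)" by simp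
    then have "partials ?S is ?h x = a * partials ?S is ?f x + b * partials ?S is ?g x"
      using partials_linear[OF S Ck_on_mono[OF S f i(1)] Ck_on_mono[OF S g i(1)] x] by simp
    then show ?thesis unfolding i(2)[OF f x] i(2)[OF g x] i(2)[OF h x] .
  qed
  show ?thesis
    unfolding coefficient_norm_def[of _ _ _ _ "\<lambda>c x. a *\<^sub>R k c x + b *\<^sub>R k' c x"]
  proof (rule cSup_least, rule insert_not_empty)
    fix y assume "y \<in> insert 0 ((\<lambda>x. \<bar>multi_partial ?S \<beta> ?h x\<bar>) ` snd (\<phi> \<alpha>) ` V \<alpha>)"
    then consider "y = 0" | p where "p \<in> V \<alpha>" "y = \<bar>multi_partial ?S \<beta> ?h (snd (\<phi> \<alpha>) p)\<bar>" by blast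
    then show "y \<le> \<bar>a\<bar> * coefficient_norm \<alpha> \<beta> i j k + \<bar>b\<bar> * coefficient_norm \<alpha> \<beta> i j k'"
    proof cases
      case 1
      then show ?thesis using coefficient_norm_nonneg[OF k(1)] coefficient_norm_nonneg[OF k(2)] by simp
    next
      case 2
      let ?x = "snd (\<phi> \<alpha>) p"
      have x: "?x \<in> ?S" using cover_member[OF \<alpha> 2(1)] by blast
      have "y \<le> \<bar>a\<bar> * \<bar>multi_partial ?S \<beta> ?f ?x\<bar> + \<bar>b\<bar> * \<bar>multi_partial ?S \<beta> ?g ?x\<bar>"
        unfolding 2(2) mp[OF x] abs_mult[symmetric] by (rule abs_triangle_ineq)
      also have "\<dots> \<le> \<bar>a\<bar> * coefficient_norm \<alpha> \<beta> i j k + \<bar>b\<bar> * coefficient_norm \<alpha> \<beta> i j k'"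
        by (intro add_mono mult_left_mono coefficient_le k 2(1)) auto
      finally show ?thesis .
    qed
  qed
qed

end

lemma tensor_norm_nonneg: "k \<in> tensors \<Longrightarrow> 0 \<le> tensor_norm k"
  unfolding tensor_norm_eq by (intro sum_nonneg coefficient_norm_nonneg) auto

text \<open>One inequality for all metric axioms that concern linear structure: coefficients 1, 1
  give the triangle inequality, -1, 0 the symmetry, and 0, 0 the norm of the zero tensor.\<close>

lemma tensor_norm_linear:
  assumes "k \<in> tensors" "k' \<in> tensors"
  shows "tensor_norm (\<lambda>c x. a *\<^sub>R k c x + b *\<^sub>R k' c x) \<le> \<bar>a\<bar> * tensor_norm k + \<bar>b\<bar> * tensor_norm k'"
  unfolding tensor_norm_eq sum_distrib_left sum.distrib[symmetric]
  by (intro sum_mono coefficient_norm_linear assms) auto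

lemma coefficient_norm_le:
  assumes k: "k \<in> tensors" and \<alpha>: "\<alpha> \<in> L" and \<beta>: "(\<Sum>i\<in>UNIV. \<beta> i) \<le> m"
  shows "coefficient_norm \<alpha> \<beta> i j k \<le> tensor_norm k"
proof -
  let ?N = "\<lambda>\<alpha> \<beta>. \<Sum>i\<in>UNIV. \<Sum>j\<in>UNIV. coefficient_norm \<alpha> \<beta> i j k"
  let ?B = "{\<beta> :: 'n option \<Rightarrow> nat. (\<Sum>i\<in>UNIV. \<beta> i) \<le> m}"
  have "coefficient_norm \<alpha> \<beta> i j k \<le> (\<Sum>j\<in>UNIV. coefficient_norm \<alpha> \<beta> i j k)"
    using coefficient_norm_nonneg[OF \<alpha> \<beta> k] by (intro member_le_sum) auto
  also have "\<dots> \<le> ?N \<alpha> \<beta>"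
    using coefficient_norm_nonneg[OF \<alpha> \<beta> k] by (intro member_le_sum[where f="\<lambda>i. \<Sum>j\<in>UNIV. coefficient_norm \<alpha> \<beta> i j k"]) (auto intro: sum_nonneg)
  also have "\<dots> \<le> sum (?N \<alpha>) ?B"
    using coefficient_norm_nonneg[OF \<alpha> _ k] \<beta> by (intro member_le_sum) (auto intro!: sum_nonneg finite_multi_indices)
  also have "\<dots> \<le> (\<Sum>\<alpha>\<in>L. sum (?N \<alpha>) ?B)"
    using coefficient_norm_nonneg[OF _ _ k] \<alpha> by (intro member_le_sum[where f="\<lambda>\<alpha>. sum (?N \<alpha>) ?B"]) (auto intro!: sum_nonneg finite_L)
  finally show ?thesis unfolding tensor_norm_eq .
qed

text \<open>The passage from the norm, a sum over multi-indices, to a uniform bound for each list of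
  derivatives; every use of C^m convergence goes through it.\<close>

lemma partials_le_tensor_norm:
  assumes k: "k \<in> tensors" and \<alpha>: "\<alpha> \<in> L" "p \<in> V \<alpha>" and i: "length is \<le> m"
  shows "\<bar>partials (chart_image (\<phi> \<alpha>)) is (\<lambda>y. k (\<phi> \<alpha>) y $ i $ j) (snd (\<phi> \<alpha>) p)\<bar> \<le> tensor_norm k"
proof -
  note S = corner_open_chart_image[OF cover_chart[OF \<alpha>(1)]]
  have \<beta>: "(\<Sum>i\<in>UNIV. count_list is i) \<le> m" using i by (simp add: sum_count_set)
  have "multi_partial (chart_image (\<phi> \<alpha>)) (count_list is) (\<lambda>y. k (\<phi> \<alpha>) y $ i $ j) (snd (\<phi> \<alpha>) p)
      = partials (chart_image (\<phi> \<alpha>)) is (\<lambda>y. k (\<phi> \<alpha>) y $ i $ j) (snd (\<phi> \<alpha>) p)"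
    using cover_member[OF \<alpha>] by (intro multi_partial_eq S Ck_sym_tensor[OF k cover_chart[OF \<alpha>(1)] i]) blast
  then show ?thesis
    using coefficient_le[OF \<alpha>(1) \<beta> k \<alpha>(2), of i j] coefficient_norm_le[OF k \<alpha>(1) \<beta>, of i j] by simp
qed

text \<open>The norm only sees the charts \<phi> \<alpha> on the sets V \<alpha>. The transformation
  law carries equality from there to every chart of the atlas, and elsewhere both tensors are 0 by
  convention.\<close>

lemma tensor_eqI:
  assumes k: "k \<in> tensors" "k' \<in> tensors"
    and eq: "\<And>\<alpha> p. \<alpha> \<in> L \<Longrightarrow> p \<in> V \<alpha> \<Longrightarrow> k (\<phi> \<alpha>) (snd (\<phi> \<alpha>) p) = k' (\<phi> \<alpha>) (snd (\<phi> \<alpha>) p)"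
  shows "k = k'"
proof (intro ext)
  fix c x
  show "k c x = k' c x"
  proof (cases "c \<in> A \<and> x \<in> chart_image c")
    case False
    then have "k c x = 0" "k' c x = 0" using k unfolding sym_tensors_def by blast+
    then show ?thesis by simp
  next
    case True
    then obtain p where p: "p \<in> fst c" "x = snd c p" by blast
    obtain \<alpha> where \<alpha>: "\<alpha> \<in> L" "p \<in> V \<alpha>" using fst_chart_subset True p coverE by blast
    have x: "x \<in> overlap c (\<phi> \<alpha>)" unfolding p(2) by (rule overlapI[OF p(1) cover_member[OF \<alpha>]])
    have "transition c (\<phi> \<alpha>) x = snd (\<phi> \<alpha>) p" unfolding p(2) using True p by (intro transition_snd) auto
    then show ?thesis
      using sym_tensor_transform[OF k(1) _ cover_chart[OF \<alpha>(1)] x] sym_tensor_transform[OF k(2) _ cover_chart[OF \<alpha>(1)] x]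
        eq[OF \<alpha>] True by simp
  qed
qed

abbreviation "tensor_dist \<equiv> Cm_dist m A L V \<phi>"

lemma tensor_dist_eq: "k \<in> tensors \<Longrightarrow> k' \<in> tensors \<Longrightarrow> tensor_dist k k' = tensor_norm (\<lambda>c x. k c x - k' c x)"
  by (simp add: Cm_dist_def)

lemma tensor_dist_triangle:
  assumes "k \<in> tensors" "k' \<in> tensors" "k'' \<in> tensors"
  shows "tensor_dist k k'' \<le> tensor_dist k k' + tensor_dist k' k''"
proof -
  have "(\<lambda>c x. k c x - k'' c x) = (\<lambda>c x. 1 *\<^sub>R (k c x - k' c x) + 1 *\<^sub>R (k' c x - k'' c x))" by simp
  then show ?thesis
    using tensor_norm_linear[OF tensor_diff[OF assms(1,2)] tensor_diff[OF assms(2,3)], of 1 1] assms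
    by (simp add: tensor_dist_eq)
qed

lemma tensor_dist_commute_le:
  assumes "k \<in> tensors" "k' \<in> tensors"
  shows "tensor_dist k k' \<le> tensor_dist k' k"
proof -
  have "(\<lambda>c x. k c x - k' c x) = (\<lambda>c x. (-1) *\<^sub>R (k' c x - k c x) + 0 *\<^sub>R (k' c x - k c x))" by simp
  then show ?thesis
    using tensor_norm_linear[OF tensor_diff[OF assms(2,1)] tensor_diff[OF assms(2,1)], of "-1" 0] assms
    by (simp add: tensor_dist_eq)
qed

lemma Metric_space_tensors: "Metric_space tensors tensor_dist"
proof
  show "0 \<le> tensor_dist k k'" for k k'
    using tensor_norm_nonneg[OF tensor_diff] by (simp add: Cm_dist_def)
  show "tensor_dist k k' = tensor_dist k' k" for k k'
  proof (cases "k \<in> tensors \<and> k' \<in> tensors")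
    case True
    then show ?thesis using tensor_dist_commute_le[of k k'] tensor_dist_commute_le[of k' k] by simp
  qed (auto simp: Cm_dist_def)
  show "tensor_dist k k' = 0 \<longleftrightarrow> k = k'" if k: "k \<in> tensors" "k' \<in> tensors" for k k'
  proof
    assume "k = k'"
    then have "(\<lambda>c x. k c x - k' c x) = (\<lambda>c x. 0 *\<^sub>R k c x + 0 *\<^sub>R k c x)" by simp
    then show "tensor_dist k k' = 0"
      using tensor_norm_linear[OF k(1) k(1), of 0 0] tensor_norm_nonneg[OF tensor_diff[OF k]] k
      by (simp add: tensor_dist_eq)
  next
    assume "tensor_dist k k' = 0"
    then have 0: "tensor_norm (\<lambda>c x. k c x - k' c x) = 0" using k by (simp add: tensor_dist_eq)
    show "k = k'"
    proof (rule tensor_eqI[OF k])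
      fix \<alpha> p assume "\<alpha> \<in> L" "p \<in> V \<alpha>"
      from partials_le_tensor_norm[OF tensor_diff[OF k] this, of "[]"] 0
      show "k (\<phi> \<alpha>) (snd (\<phi> \<alpha>) p) = k' (\<phi> \<alpha>) (snd (\<phi> \<alpha>) p)" by (simp add: vec_eq_iff)
    qed
  qed
qed (rule tensor_dist_triangle)

end

section \<open>Openness\<close>

lemma Cfam_imp: "Cfam P k S f \<Longrightarrow> P f"
  by (cases k) simp_all

lemma norm_unit_limit:
  fixes u :: "nat \<Rightarrow> real ^ 'k"
  assumes "\<And>n. norm (u n) = 1"
  obtains r w where "strict_mono (r :: nat \<Rightarrow> nat)" "norm w = 1" "(u \<circ> r) \<longlonglongrightarrow> w"
proof -
  have "\<forall>n. u n \<in> sphere 0 1" using assms by simp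
  then show thesis
    using compact_sphere[of "0 :: real ^ 'k" 1, unfolded compact_def] that by fastforce
qed

context normed_manifold
begin

lemma metrics_subset: "metrics \<subseteq> tensors"
  by (auto simp: riemannian_metrics_def)

text \<open>The \<open>case_option\<close> puts g at index \<open>None\<close> and the subsequence
  of G at the indices \<open>Some n\<close>, matching \<open>values_converge\<close>.\<close>

definition jets_converge ::
  "(nat \<Rightarrow> ('a, 'n) tensor2) \<Rightarrow> ('a, 'n) tensor2 \<Rightarrow> (nat \<Rightarrow> 'a) \<Rightarrow> 'l \<Rightarrow> (nat \<Rightarrow> nat) \<Rightarrow> 'a \<Rightarrow> bool" where
  "jets_converge G g p \<alpha> r q \<longleftrightarrow> \<alpha> \<in> L \<and> q \<in> fst (\<phi> \<alpha>) \<and> (\<forall>n. p (r n) \<in> fst (\<phi> \<alpha>)) \<and>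
     (\<lambda>n. snd (\<phi> \<alpha>) (p (r n))) \<longlonglongrightarrow> snd (\<phi> \<alpha>) q \<and>
     (\<forall>i j. Cfam (values_converge (\<lambda>n. snd (\<phi> \<alpha>) (p (r n))) (snd (\<phi> \<alpha>) q)) m (chart_image (\<phi> \<alpha>))
        (\<lambda>w y. case_option g (\<lambda>n. G (r n)) w (\<phi> \<alpha>) y $ i $ j))"

lemma jets_convergeD:
  assumes "jets_converge G g p \<alpha> r q"
  shows "\<alpha> \<in> L" "q \<in> fst (\<phi> \<alpha>)" "p (r n) \<in> fst (\<phi> \<alpha>)"
    "(\<lambda>n. snd (\<phi> \<alpha>) (p (r n))) \<longlonglongrightarrow> snd (\<phi> \<alpha>) q"
    "Cfam (values_converge (\<lambda>n. snd (\<phi> \<alpha>) (p (r n))) (snd (\<phi> \<alpha>) q)) m (chart_image (\<phi> \<alpha>))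
      (\<lambda>w y. case_option g (\<lambda>n. G (r n)) w (\<phi> \<alpha>) y $ i $ j)"
proof -
  note 1 = assms[unfolded jets_converge_def]
  note 2 = 1[THEN conjunct2] note 3 = 2[THEN conjunct2] note 4 = 3[THEN conjunct2] note 5 = 4[THEN conjunct2]
  show "\<alpha> \<in> L" by (rule 1[THEN conjunct1])
  show "q \<in> fst (\<phi> \<alpha>)" by (rule 2[THEN conjunct1])
  show "p (r n) \<in> fst (\<phi> \<alpha>)" by (rule 3[THEN conjunct1, THEN spec])
  show "(\<lambda>n. snd (\<phi> \<alpha>) (p (r n))) \<longlonglongrightarrow> snd (\<phi> \<alpha>) q" by (rule 4[THEN conjunct1])
  show "Cfam (values_converge (\<lambda>n. snd (\<phi> \<alpha>) (p (r n))) (snd (\<phi> \<alpha>) q)) m (chart_image (\<phi> \<alpha>))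
      (\<lambda>w y. case_option g (\<lambda>n. G (r n)) w (\<phi> \<alpha>) y $ i $ j)"
    by (rule 5[THEN spec, THEN spec])
qed

text \<open>
  Finitely many charts cover M and the closures of the covering sets are compact, so along a subsequence
  the points stay in one chart and converge there; C^m convergence then becomes convergence of all
  jets of order at most m.
\<close>

lemma jet_convergence:
  assumes G: "\<And>n. G n \<in> tensors" and g: "g \<in> tensors"
    and lim: "(\<lambda>n. tensor_dist (G n) g) \<longlonglongrightarrow> 0"
    and K: "closedin M K" and p: "\<And>n. p n \<in> K"
  obtains \<alpha> r q where "q \<in> K" "jets_converge G g p \<alpha> r q"
proof -
  have "p n \<in> topspace M" for n using p closedin_subset[OF K] by blast
  then have "\<forall>n. \<exists>\<alpha>. \<alpha> \<in> L \<and> p n \<in> V \<alpha>" using coverE by metis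
  then obtain a where a: "\<And>n. a n \<in> L" "\<And>n. p n \<in> V (a n)" by metis
  have "finite (range a)" using finite_L a(1) by (meson finite_subset image_subsetI)
  then obtain n0 where "infinite {n \<in> UNIV. a n = a n0}"
    using pigeonhole_infinite[of UNIV a] by auto
  then obtain r1 :: "nat \<Rightarrow> nat" where r1: "strict_mono r1" "\<And>n. a (r1 n) = a n0"
    using infinite_enumerate[of "{n \<in> UNIV. a n = a n0}"] by auto
  define \<alpha> where "\<alpha> = a n0"
  have \<alpha>: "\<alpha> \<in> L" "\<And>n. p (r1 n) \<in> V \<alpha>" using a(1)[of n0] a(2)[of "r1 _"] r1(2) by (simp_all add: \<alpha>_def)
  let ?\<phi> = "snd (\<phi> \<alpha>)" and ?S = "chart_image (\<phi> \<alpha>)"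
  note S = corner_open_chart_image[OF cover_chart[OF \<alpha>(1)]]
  have "compact (?\<phi> ` (M closure_of V \<alpha> \<inter> K))"
    using cover_subset(2)[OF \<alpha>(1)]
    by (intro compact_chart_image cover_chart[OF \<alpha>(1)] closedin_Int closedin_closure_of K) blast
  moreover have "\<forall>n. ?\<phi> (p (r1 n)) \<in> ?\<phi> ` (M closure_of V \<alpha> \<inter> K)"
    using cover_subset(1)[OF \<alpha>(1)] \<alpha>(2) p by blast
  ultimately obtain l r2 where l: "l \<in> ?\<phi> ` (M closure_of V \<alpha> \<inter> K)" and r2: "strict_mono r2"
    and conv: "((\<lambda>n. ?\<phi> (p (r1 n))) \<circ> r2) \<longlonglongrightarrow> l"
    unfolding compact_def by (meson)
  obtain q where q: "q \<in> M closure_of V \<alpha>" "q \<in> K" "l = ?\<phi> q" using l by blast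
  have qS: "q \<in> fst (\<phi> \<alpha>)" using q(1) cover_subset(2)[OF \<alpha>(1)] by blast
  define r where "r = r1 \<circ> r2"
  have r: "strict_mono r" unfolding r_def by (rule strict_mono_o[OF r1(1) r2])
  have pV: "p (r n) \<in> V \<alpha>" for n using \<alpha>(2) by (simp add: r_def)
  have pS: "p (r n) \<in> fst (\<phi> \<alpha>)" for n by (rule cover_member[OF \<alpha>(1) pV])
  have conv': "(\<lambda>n. ?\<phi> (p (r n))) \<longlonglongrightarrow> ?\<phi> q" using conv by (simp add: r_def o_def q(3))
  have dist0: "(\<lambda>n. tensor_dist (G (r n)) g) \<longlonglongrightarrow> 0"
    using LIMSEQ_subseq_LIMSEQ[OF lim r] by (simp add: o_def)
  show thesis
  proof (rule that[OF q(2)], unfold jets_converge_def, intro conjI allI)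
    fix i j
    let ?f = "\<lambda>w y. case_option g (\<lambda>n. G (r n)) w (\<phi> \<alpha>) y $ i $ j"
    show "Cfam (values_converge (\<lambda>n. ?\<phi> (p (r n))) (?\<phi> q)) m ?S ?f"
    proof (rule Cfam_partialsI)
      show "Ck_on m ?S (?f w)" for w
        by (rule Ck_sym_tensor[OF _ cover_chart[OF \<alpha>(1)] order_refl]) (use G g in \<open>cases w; simp\<close>)
      fix "is" :: "'n option list" assume i: "length is \<le> m"
      let ?D = "\<lambda>k. partials ?S is (\<lambda>y. k (\<phi> \<alpha>) y $ i $ j)"
      \<comment> \<open>At the moving points the derivative of \<open>G (r n)\<close> is split into
        that of the difference to g, bounded by the distance uniformly in the point, and that of g
        itself, which converges by continuity.\<close>
      have D: "?D (\<lambda>c x. G (r n) c x - g c x) (?\<phi> (p (r n))) = ?D (G (r n)) (?\<phi> (p (r n))) - ?D g (?\<phi> (p (r n)))" for n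
        using partials_linear[OF S Ck_sym_tensor[OF G cover_chart[OF \<alpha>(1)] i] Ck_sym_tensor[OF g cover_chart[OF \<alpha>(1)] i],
            of "?\<phi> (p (r n))" 1 "r n" i j "-1" i j] pS[of n] by simp
      have "(\<lambda>n. ?D (\<lambda>c x. G (r n) c x - g c x) (?\<phi> (p (r n)))) \<longlonglongrightarrow> 0"
      proof (rule tendsto_0_le[OF dist0, where K=1], rule always_eventually, rule allI)
        fix n
        show "norm (?D (\<lambda>c x. G (r n) c x - g c x) (?\<phi> (p (r n)))) \<le> norm (tensor_dist (G (r n)) g) * 1"
          using partials_le_tensor_norm[OF tensor_diff[OF G g] \<alpha>(1) pV i, of "r n" i j n] tensor_dist_eq[OF G g, of "r n"]
          by simp
      qed
      moreover have "(\<lambda>n. ?D g (?\<phi> (p (r n)))) \<longlonglongrightarrow> ?D g (?\<phi> q)"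
        by (rule continuous_on_tendsto_compose[OF Ck_on_partials_continuous[OF S
              Ck_sym_tensor[OF g cover_chart[OF \<alpha>(1)] order_refl] i] conv'])
          (use qS pS in \<open>auto intro: always_eventually\<close>)
      ultimately have "(\<lambda>n. ?D (\<lambda>c x. G (r n) c x - g c x) (?\<phi> (p (r n))) + ?D g (?\<phi> (p (r n)))) \<longlonglongrightarrow> 0 + ?D g (?\<phi> q)"
        by (rule tendsto_add)
      then show "values_converge (\<lambda>n. ?\<phi> (p (r n))) (?\<phi> q) (\<lambda>w. partials ?S is (?f w))"
        unfolding D by (simp add: values_converge_def)
    qed
  qed (rule \<alpha>(1) qS pS conv')+
qed

text \<open>Failure on the balls of radius 1/(n+1) yields a converging sequence outside T. R is the
  ambient set: all tensors for positivity, the metrics for nondegeneracy.\<close>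

lemma open_by_sequences:
  assumes "\<And>g G. g \<in> T \<Longrightarrow> (\<And>n. G n \<in> R) \<Longrightarrow> (\<lambda>n. tensor_dist (G n) g) \<longlonglongrightarrow> 0 \<Longrightarrow> (\<And>n. G n \<notin> T) \<Longrightarrow> False"
    and "g \<in> T" "R \<subseteq> tensors"
  obtains r where "r > 0" "\<And>g'. g' \<in> R \<Longrightarrow> tensor_dist g' g < r \<Longrightarrow> g' \<in> T"
proof (rule ccontr)
  assume no: "\<not> thesis"
  have "\<exists>g'. g' \<in> R \<and> tensor_dist g' g < inverse (real (Suc n)) \<and> g' \<notin> T" for n
    using no that[of "inverse (real (Suc n))"] by auto
  then obtain G where G: "\<And>n. G n \<in> R" "\<And>n. tensor_dist (G n) g < inverse (real (Suc n))" "\<And>n. G n \<notin> T"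
    by metis
  have nonneg: "0 \<le> tensor_dist (G n) g" for n
    by (rule Metric_space.nonneg[OF Metric_space_tensors])
  have "(\<lambda>n. tensor_dist (G n) g) \<longlonglongrightarrow> 0"
    by (rule tendsto_sandwich[OF _ _ tendsto_const LIMSEQ_inverse_real_of_nat])
      (use G(2) nonneg in \<open>auto intro!: always_eventually less_imp_le simp del: of_nat_Suc\<close>)
  from assms(1)[OF assms(2) G(1) this G(3)] show False .
qed

text \<open>The compactness argument dictates its own chart, so a vector that violates positivity is
  transported to every chart at p by the Jacobian, which is injective, and normalised so that unit
  vectors have a limit.\<close>

lemma not_metricE:
  assumes k: "k \<in> tensors" and not: "k \<notin> metrics"
  obtains p where "p \<in> topspace M"
    "\<And>d. d \<in> A \<Longrightarrow> p \<in> fst d \<Longrightarrow> \<exists>u. norm u = 1 \<and> u \<bullet> (k d (snd d p) *v u) \<le> 0"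
proof -
  obtain c x v where c: "c \<in> A" "x \<in> chart_image c" and v: "v \<noteq> 0" "v \<bullet> (k c x *v v) \<le> 0"
  proof -
    have "\<not> (\<forall>c\<in>A. \<forall>x\<in>chart_image c. \<forall>v. v \<noteq> 0 \<longrightarrow> 0 < v \<bullet> (k c x *v v))"
      using k not unfolding riemannian_metrics_def by blast
    then show thesis using that by (meson not_less)
  qed
  obtain p where p: "p \<in> fst c" "x = snd c p" using c(2) by blast
  show thesis
  proof (rule that[of p])
    show "p \<in> topspace M" using p(1) fst_chart_subset[OF c(1)] by blast
    fix d assume d: "d \<in> A" "p \<in> fst d"
    let ?J = "jacobian_transition c d x" and ?B = "k d (snd d p)"
    have x: "x \<in> overlap c d" unfolding p(2) by (rule overlapI[OF p(1) d(2)])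
    have inv: "jacobian_transition d c (transition c d x) ** ?J = mat 1"
      by (rule jacobian_transition_inverse[OF c(1) d(1) x])
    have w: "?J *v v \<noteq> 0"
    proof
      assume "?J *v v = 0"
      then have "(jacobian_transition d c (transition c d x) ** ?J) *v v = 0"
        by (simp add: matrix_vector_mul_assoc[symmetric])
      then show False using v(1) by (simp add: inv)
    qed
    have "k c x = transpose ?J ** ?B ** ?J"
      using sym_tensor_transform[OF k c(1) d(1) x] transition_snd[OF c(1) p(1)] by (simp add: p(2))
    then have "v \<bullet> (k c x *v v) = (?J *v v) \<bullet> (?B *v (?J *v v))"
      by (simp only: transpose_mult_inner matrix_vector_mul_assoc[symmetric])
    then have le: "(?J *v v) \<bullet> (?B *v (?J *v v)) \<le> 0" using v(2) by simp
    let ?u = "(1 / norm (?J *v v)) *\<^sub>R (?J *v v)"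
    have "?u \<bullet> (?B *v ?u) = (1 / norm (?J *v v)) * ((1 / norm (?J *v v)) * ((?J *v v) \<bullet> (?B *v (?J *v v))))"
      by (simp add: matrix_vector_mult_scaleR)
    also have "\<dots> \<le> 0" by (intro mult_nonneg_nonpos le) auto
    finally show "\<exists>u. norm u = 1 \<and> u \<bullet> (?B *v u) \<le> 0" using w by (intro exI[of _ ?u]) simp
  qed
qed

text \<open>Points and unit vectors at which positivity fails along a converging sequence of tensors
  have limits; the limiting quadratic form takes a nonpositive value at a unit vector, against the
  positivity of g.\<close>

lemma metrics_open:
  assumes "g \<in> metrics"
  obtains r where "r > 0" "\<And>g'. g' \<in> tensors \<Longrightarrow> tensor_dist g' g < r \<Longrightarrow> g' \<in> metrics"
proof (rule open_by_sequences[of metrics tensors, OF _ assms order_refl])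
  fix g G
  assume g: "g \<in> metrics" and G: "\<And>n. G n \<in> tensors" and lim: "(\<lambda>n. tensor_dist (G n) g) \<longlonglongrightarrow> 0"
    and bad: "\<And>n. G n \<notin> metrics"
  have g': "g \<in> tensors" using g metrics_subset by blast
  have "\<forall>n. \<exists>p. p \<in> topspace M \<and> (\<forall>d. d \<in> A \<longrightarrow> p \<in> fst d \<longrightarrow> (\<exists>u. norm u = 1 \<and> u \<bullet> (G n d (snd d p) *v u) \<le> 0))"
    using not_metricE[OF G bad] by metis
  then obtain p where p: "\<And>n. p n \<in> topspace M"
    "\<And>n d. d \<in> A \<Longrightarrow> p n \<in> fst d \<Longrightarrow> \<exists>u. norm u = 1 \<and> u \<bullet> (G n d (snd d (p n)) *v u) \<le> 0" by metis
  obtain \<alpha> r q where "q \<in> topspace M" and jets: "jets_converge G g p \<alpha> r q"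
    by (rule jet_convergence[where G=G and g=g and p=p, OF G g' lim closedin_topspace p(1)])
  note \<alpha> = jets_convergeD(1)[OF jets] and q = jets_convergeD(2)[OF jets] and pr = jets_convergeD(3)[OF jets]
    and C = jets_convergeD(5)[OF jets]
  let ?B = "\<lambda>n. G (r n) (\<phi> \<alpha>) (snd (\<phi> \<alpha>) (p (r n)))" and ?b = "g (\<phi> \<alpha>) (snd (\<phi> \<alpha>) q)"
  have "\<forall>n. \<exists>u. norm u = 1 \<and> u \<bullet> (?B n *v u) \<le> 0" using p(2)[OF cover_chart[OF \<alpha>] pr] by blast
  then obtain u where u: "\<And>n. norm (u n) = 1" "\<And>n. u n \<bullet> (?B n *v u n) \<le> 0" by metis
  obtain s w where s: "strict_mono (s :: nat \<Rightarrow> nat)" and w: "norm w = 1" and uw: "(u \<circ> s) \<longlonglongrightarrow> w"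
    by (rule norm_unit_limit[where u=u, OF u(1)])
  have B: "(\<lambda>n. ?B n $ i $ j) \<longlonglongrightarrow> ?b $ i $ j" for i j
  proof -
    have "values_converge (\<lambda>n. snd (\<phi> \<alpha>) (p (r n))) (snd (\<phi> \<alpha>) q) (\<lambda>w y. case_option g (\<lambda>n. G (r n)) w (\<phi> \<alpha>) y $ i $ j)"
      by (rule Cfam_imp[OF C])
    then show ?thesis by (simp add: values_converge_def)
  qed
  have "(\<lambda>n. u (s n) \<bullet> (?B (s n) *v u (s n))) \<longlonglongrightarrow> w \<bullet> (?b *v w)"
    unfolding inner_matrix_sum
    by (intro tendsto_sum tendsto_mult tendsto_vec_nth uw[unfolded o_def] LIMSEQ_subseq_LIMSEQ[OF B s, unfolded o_def])
  then have le: "w \<bullet> (?b *v w) \<le> 0"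
    by (rule LIMSEQ_le_const2) (use u(2) in blast)
  have "pos_def ?b" using q by (intro metric_pos_def[OF g cover_chart[OF \<alpha>]]) blast
  moreover have "w \<noteq> 0" using w by auto
  ultimately have "0 < w \<bullet> (?b *v w)" unfolding pos_def_def by blast
  then show False using le by simp
qed (use that in blast)

text \<open>A local condition that can be achieved on one set at a time; for closed K it is open, so
  it survives later small perturbations.\<close>

definition nondegenerate_metrics_on :: "'a set \<Rightarrow> ('a, 'n) tensor2 set" where
  "nondegenerate_metrics_on K = {g \<in> metrics. \<forall>\<xi>\<in>K.
     critical_point A (mean_curvature A g) \<xi> \<longrightarrow> nondegenerate_at A (mean_curvature A g) \<xi>}"

lemma nondegenerate_metrics_on_topspace: "nondegenerate_metrics_on (topspace M) = nondegenerate_metrics m A"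
proof -
  have "\<xi> \<in> topspace M" if "critical_point A f \<xi>" for f \<xi>
    using that fst_chart_subset unfolding critical_point_def mboundary_def by blast
  then show ?thesis unfolding nondegenerate_metrics_on_def nondegenerate_metrics_def by blast
qed

lemma nondegenerate_metrics_on_open:
  assumes m: "3 \<le> m" and K: "closedin M K" and g: "g \<in> nondegenerate_metrics_on K"
  obtains r where "r > 0" "\<And>g'. g' \<in> metrics \<Longrightarrow> tensor_dist g' g < r \<Longrightarrow> g' \<in> nondegenerate_metrics_on K"
proof (rule open_by_sequences[of "nondegenerate_metrics_on K" metrics, OF _ g metrics_subset])
  fix g G
  assume g: "g \<in> nondegenerate_metrics_on K" and G: "\<And>n. G n \<in> metrics" and lim: "(\<lambda>n. tensor_dist (G n) g) \<longlonglongrightarrow> 0"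
    and bad: "\<And>n. G n \<notin> nondegenerate_metrics_on K"
  have gm: "g \<in> metrics" using g by (simp add: nondegenerate_metrics_on_def)
  have gt: "g \<in> tensors" and Gt: "\<And>n. G n \<in> tensors" using gm G metrics_subset by blast+
  have "\<forall>n. \<exists>\<xi>. \<xi> \<in> K \<and> critical_point A (mean_curvature A (G n)) \<xi> \<and> \<not> nondegenerate_at A (mean_curvature A (G n)) \<xi>"
    using bad G by (auto simp: nondegenerate_metrics_on_def)
  then obtain p where p: "\<And>n. p n \<in> K" and crit: "\<And>n. critical_point A (mean_curvature A (G n)) (p n)"
    and deg: "\<And>n. \<not> nondegenerate_at A (mean_curvature A (G n)) (p n)" by metis
  obtain \<alpha> r q where qK: "q \<in> K" and jets: "jets_converge G g p \<alpha> r q"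
    by (rule jet_convergence[where G=G and g=g and p=p, OF Gt gt lim K p(1)])
  note \<alpha> = jets_convergeD(1)[OF jets] and q = qK jets_convergeD(2)[OF jets] and pr = jets_convergeD(3)[OF jets]
    and conv = jets_convergeD(4)[OF jets] and C = jets_convergeD(5)[OF jets]
  let ?c = "\<phi> \<alpha>" and ?S = "chart_image (\<phi> \<alpha>)" and ?y = "\<lambda>n. snd (\<phi> \<alpha>) (p (r n))" and ?x = "snd (\<phi> \<alpha>) q"
  let ?P = "values_converge ?y ?x"
  note c = cover_chart[OF \<alpha>]
  define \<Gamma> where "\<Gamma> w = case_option g (\<lambda>n. G (r n)) w" for w
  have \<Gamma>: "\<Gamma> w \<in> metrics" for w using gm G by (cases w) (auto simp: \<Gamma>_def)
  have y0: "?y n $ None = 0" for n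
    using crit[of "r n"] mboundary_iff[OF c pr] by (simp add: critical_point_def)
  \<comment> \<open>Critical points lie on the boundary, and the equation x_0 = 0 passes to the
    limit.\<close>
  have "(\<lambda>n. ?y n $ None) \<longlonglongrightarrow> ?x $ None" by (rule tendsto_vec_nth[OF conv])
  then have x0: "?x $ None = 0" unfolding y0 by (simp add: LIMSEQ_const_iff)
  have fam: "smooth_families ?S ?P"
    by (rule smooth_families_values_converge[OF corner_open_chart_image[OF c]]) (use pr q in auto)
  then interpret smooth_families ?S ?P .
  \<comment> \<open>Three derivatives of the metrics control two of the mean curvature; the bound on
    m enters here and through \<open>critical_point_iff\<close> and
    \<open>nondegenerate_at_iff\<close>.\<close>
  have "Cfam ?P (Suc 2) ?S (\<lambda>w y. \<Gamma> w ?c y $ i $ j)" for i j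
    using C_mono[OF C[of i j], of "Suc 2"] m unfolding \<Gamma>_def by simp
  then have H: "Cfam ?P 2 ?S (\<lambda>w. chart_mean_curvature (\<Gamma> w) ?c)"
    by (rule Cfam_mean_curvature[OF fam, where G="\<lambda>w. \<Gamma> w ?c"]) (rule metric_pos_def[OF \<Gamma> c])
  have d1: "(\<lambda>n. partial ?S i (chart_mean_curvature (G (r n)) ?c) (?y n)) \<longlonglongrightarrow> partial ?S i (chart_mean_curvature g ?c) ?x" for i
    using H by (simp add: numeral_2_eq_2 values_converge_def \<Gamma>_def)
  have crit_n: "partial ?S (Some i) (chart_mean_curvature (G (r n)) ?c) (?y n) = 0" for i n
    using crit[of "r n"] critical_point_iff[OF G m c pr y0] by blast
  have "partial ?S (Some i) (chart_mean_curvature g ?c) ?x = 0" for i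
    using d1[of "Some i"] unfolding crit_n by (simp add: LIMSEQ_const_iff)
  then have crit_q: "critical_point A (mean_curvature A g) q"
    using critical_point_iff[OF gm m c q(2) x0] by blast
  \<comment> \<open>Second derivatives converge, hence so does the determinant, a polynomial in
    them; it is 0 along the sequence.\<close>
  have "C 0 (\<lambda>w x. det (tangential_hessian ?S (chart_mean_curvature (\<Gamma> w) ?c) x))"
    by (rule C_det) (use H in \<open>simp add: numeral_2_eq_2 tangential_hessian_def\<close>)
  then have "(\<lambda>n. det (tangential_hessian ?S (chart_mean_curvature (G (r n)) ?c) (?y n)))
      \<longlonglongrightarrow> det (tangential_hessian ?S (chart_mean_curvature g ?c) ?x)"
    by (simp add: values_converge_def \<Gamma>_def)
  moreover have "det (tangential_hessian ?S (chart_mean_curvature (G (r n)) ?c) (?y n)) = 0" for n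
    using deg[of "r n"] nondegenerate_at_iff[OF G m c pr y0 crit] by blast
  ultimately have "det (tangential_hessian ?S (chart_mean_curvature g ?c) ?x) = 0"
    by (simp add: LIMSEQ_const_iff)
  then have "\<not> nondegenerate_at A (mean_curvature A g) q"
    using nondegenerate_at_iff[OF gm m c q(2) x0 crit_q] by blast
  then show False using g q(1) crit_q by (auto simp: nondegenerate_metrics_on_def)
qed (use that in blast)

end

section \<open>Sard's theorem for square maps\<close>

text \<open>
  The library states Sard's theorem for index types in the class \<open>wellorder\<close>. A copy of the index
  type, well-ordered by some enumeration, removes this restriction.
\<close>

typedef 'n ordered_copy = "UNIV :: 'n set" by auto

lemma bij_Rep_ordered_copy: "bij Rep_ordered_copy"
  by (metis Abs_ordered_copy_inverse Rep_ordered_copy_inverse UNIV_I bij_iff)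

instance ordered_copy :: (finite) finite
proof
  have "finite (Rep_ordered_copy ` (UNIV :: 'a ordered_copy set))" by simp
  then show "finite (UNIV :: 'a ordered_copy set)"
    by (rule finite_imageD) (use bij_Rep_ordered_copy in \<open>auto simp: bij_def\<close>)
qed

definition enumeration :: "'n::finite \<Rightarrow> nat" where
  "enumeration = (SOME f. inj f)"

lemma inj_enumeration: "inj enumeration"
proof -
  have "\<exists>f :: 'a \<Rightarrow> nat. inj f" using finite_imp_inj_to_nat_seg[of "UNIV :: 'a set"] by auto
  then show ?thesis unfolding enumeration_def by (rule someI_ex)
qed

instantiation ordered_copy :: (finite) wellorder
begin

definition less_eq_ordered_copy :: "'a ordered_copy \<Rightarrow> 'a ordered_copy \<Rightarrow> bool" where
  "x \<le> y \<longleftrightarrow> enumeration (Rep_ordered_copy x) \<le> enumeration (Rep_ordered_copy y)"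

definition less_ordered_copy :: "'a ordered_copy \<Rightarrow> 'a ordered_copy \<Rightarrow> bool" where
  "x < y \<longleftrightarrow> enumeration (Rep_ordered_copy x) < enumeration (Rep_ordered_copy y)"

instance
proof
  fix x y :: "'a ordered_copy"
  assume "x \<le> y" "y \<le> x"
  then have "enumeration (Rep_ordered_copy x) = enumeration (Rep_ordered_copy y)"
    by (simp add: less_eq_ordered_copy_def)
  then show "x = y" by (metis inj_enumeration injD Rep_ordered_copy_inject)
next
  fix P and a :: "'a ordered_copy"
  assume step: "\<And>x :: 'a ordered_copy. (\<And>y. y < x \<Longrightarrow> P y) \<Longrightarrow> P x"
  show "P a"
  proof (induction "enumeration (Rep_ordered_copy a)" arbitrary: a rule: less_induct)
    case less
    show ?case by (rule step) (simp add: less less_ordered_copy_def)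
  qed
qed (auto simp: less_eq_ordered_copy_def less_ordered_copy_def)

end

text \<open>The values taken at points with singular derivative form a negligible set, which cannot
  contain a ball around 0; a missed point of the ball is a small regular value. T and T' rename the
  coordinates to the ordered copy and back.\<close>

lemma regular_small_value:
  fixes f :: "real ^ 'n \<Rightarrow> real ^ 'n"
  assumes f: "\<And>y. y \<in> W \<Longrightarrow> (f has_derivative f' y) (at y)" and e: "0 < e"
  obtains a where "\<And>i. \<bar>a $ i\<bar> < e" "\<And>y. y \<in> W \<Longrightarrow> f y = a \<Longrightarrow> det (matrix (f' y)) \<noteq> 0"
proof -
  define T :: "real ^ 'n \<Rightarrow> real ^ 'n ordered_copy" where "T y = (\<chi> k. y $ Rep_ordered_copy k)" for y
  define T' :: "real ^ 'n ordered_copy \<Rightarrow> real ^ 'n" where "T' z = (\<chi> i. z $ Abs_ordered_copy i)" for z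
  have TT': "T (T' z) = z" for z by (simp add: T_def T'_def vec_eq_iff Rep_ordered_copy_inverse)
  have T'T: "T' (T y) = y" for y by (simp add: T_def T'_def vec_eq_iff Abs_ordered_copy_inverse)
  have "linear T" "linear T'" by (auto intro!: linearI simp: T_def T'_def vec_eq_iff)
  then have bl: "bounded_linear T" "bounded_linear T'" by (simp_all add: linear_conv_bounded_linear)
  let ?S = "{z. T' z \<in> W \<and> det (matrix (f' (T' z))) = 0}"
  have "negligible ((\<lambda>z. T (f (T' z))) ` ?S)"
  proof (rule baby_Sard[where f'="\<lambda>z v. T (f' (T' z) (T' v))"])
    fix z assume z: "z \<in> ?S"
    have d: "(f has_derivative f' (T' z)) (at (T' z))" using f z by simp
    have "(T' has_derivative T') (at z within ?S)"
      by (rule bounded_linear_imp_has_derivative[OF bl(2)])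
    from has_derivative_compose[OF this d]
    have "((\<lambda>z. f (T' z)) has_derivative (\<lambda>v. f' (T' z) (T' v))) (at z within ?S)" .
    from bounded_linear.has_derivative[OF bl(1) this]
    show D: "((\<lambda>z. T (f (T' z))) has_derivative (\<lambda>v. T (f' (T' z) (T' v)))) (at z within ?S)" .
    have "\<not> inj (f' (T' z))"
      using z det_nz_iff_inj[OF has_derivative_linear[OF d]] by simp
    then obtain u v where uv: "u \<noteq> v" "f' (T' z) u = f' (T' z) v" unfolding inj_def by blast
    have "T (f' (T' z) (T' (T u))) = T (f' (T' z) (T' (T v)))" "T u \<noteq> T v"
      using uv T'T by (simp, metis)
    then have "\<not> inj (\<lambda>v. T (f' (T' z) (T' v)))" unfolding inj_def by blast
    then show "rank (matrix (\<lambda>v. T (f' (T' z) (T' v)))) < CARD('n ordered_copy)"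
      unfolding less_rank_noninjective using has_derivative_linear[OF D] by (metis matrix_vector_mul)
  qed simp
  then have "\<not> ball 0 e \<subseteq> (\<lambda>z. T (f (T' z))) ` ?S"
    using e negligible_subset open_not_negligible[of "ball (0 :: real ^ 'n ordered_copy) e"] by auto
  then obtain z where z: "z \<in> ball 0 e" "z \<notin> (\<lambda>z. T (f (T' z))) ` ?S" by blast
  show thesis
  proof (rule that[of "T' z"])
    fix i
    have "\<bar>T' z $ i\<bar> \<le> norm z" unfolding T'_def by (simp add: component_le_norm_cart)
    then show "\<bar>T' z $ i\<bar> < e" using z(1) by simp
  next
    fix y assume y: "y \<in> W" "f y = T' z"
    show "det (matrix (f' y)) \<noteq> 0"
    proof
      assume "det (matrix (f' y)) = 0"
      then have "T y \<in> ?S" using y(1) by (simp add: T'T)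
      moreover have "z = T (f (T' (T y)))" by (simp add: T'T y(2) TT')
      ultimately show False using z(2) by blast
    qed
  qed
qed

section \<open>Plateau functions\<close>

text \<open>From exponent 2 on, the difference quotient at 0 is itself a positive power of
  \<open>max 0 h\<close> and tends to 0, so the two branches fit together.\<close>

lemma has_derivative_max_power:
  "((\<lambda>s :: real. max 0 s ^ Suc (Suc j)) has_real_derivative real (Suc (Suc j)) * max 0 s ^ Suc j) (at s)"
proof -
  consider "s > 0" | "s < 0" | "s = 0" by linarith
  then show ?thesis
  proof cases
    case 1
    have "((\<lambda>s :: real. s ^ Suc (Suc j)) has_real_derivative real (Suc (Suc j)) * s ^ Suc j) (at s)"
      using DERIV_pow[of "Suc (Suc j)" s UNIV] by simp
    then have "((\<lambda>s :: real. max 0 s ^ Suc (Suc j)) has_real_derivative real (Suc (Suc j)) * s ^ Suc j) (at s)"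
      by (rule has_field_derivative_transform_within_open[where S="{0<..}"]) (use 1 in auto)
    then show ?thesis using 1 by simp
  next
    case 2
    have "((\<lambda>s :: real. max 0 s ^ Suc (Suc j)) has_real_derivative 0) (at s)"
      by (rule has_field_derivative_transform_within_open[where S="{..<0}", OF DERIV_const[of 0]]) (use 2 in auto)
    then show ?thesis using 2 by simp
  next
    case 3
    have "(\<lambda>h :: real. (max 0 (0 + h) ^ Suc (Suc j) - max 0 0 ^ Suc (Suc j)) / h) = (\<lambda>h. max 0 h ^ Suc j)"
      by (auto simp: fun_eq_iff max_def)
    moreover have "((\<lambda>h :: real. max 0 h ^ Suc j) \<longlongrightarrow> max 0 0 ^ Suc j) (at 0)"
      by (intro tendsto_intros)
    ultimately show ?thesis using 3 by (simp add: DERIV_def)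
  qed
qed

text \<open>Each derivative lowers the exponent by one. Exponent \<open>Suc j\<close> with k \<le> j
  still leaves exponent at least 1, hence continuity, after k derivatives; this is why the plateau
  uses \<open>Suc m\<close>.\<close>

lemma Ck_on_max_power:
  assumes "corner_open S" "Ck_on k S (f :: _ \<Rightarrow> real)" "k \<le> j"
  shows "Ck_on k S (\<lambda>x. max 0 (f x) ^ Suc j)"
  using assms(2,3)
proof (induction k arbitrary: j)
  case 0
  then show ?case by (auto intro!: continuous_intros)
next
  case (Suc k)
  obtain i where j: "j = Suc i" "k \<le> i" using Suc.prems(2) by (cases j) auto
  have f: "Ck_on k S f" by (rule Ck_on_mono[OF assms(1) Suc.prems(1)]) simp
  show ?case
  proof (rule Ck_on_SucI[OF assms(1)])
    fix x assume "x \<in> S"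
    then have "(f has_derivative (\<lambda>v. \<Sum>l\<in>UNIV. v $ l *\<^sub>R partial S l f x)) (at x within S)"
      using Suc.prems(1) by (intro has_derivative_partials) (simp add: differentiable_on_def)
    from has_derivative_compose[OF this has_derivative_max_power[unfolded has_field_derivative_def]]
    show "((\<lambda>x. max 0 (f x) ^ Suc j) has_derivative
      (\<lambda>v. (real (Suc j) * max 0 (f x) ^ j) * (\<Sum>l\<in>UNIV. v $ l * partial S l f x))) (at x within S)"
      unfolding j real_scaleR_def .
  next
    fix i'
    show "Ck_on k S (\<lambda>x. (real (Suc j) * max 0 (f x) ^ j) * (\<Sum>l\<in>UNIV. axis i' 1 $ l * partial S l f x))"
      unfolding sum_axis j(1)
      by (intro Ck_on_mult[OF assms(1)] Ck_on_const[OF assms(1)] Suc.IH[OF f j(2)])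
        (use Suc.prems(1) in simp)
  qed
qed

text \<open>
  With \<open>q s = max 0 s ^ (m + 1)\<close> and \<open>t\<close> a decreasing function of the distance to \<open>x0\<close> that is
  at least 1 on the small ball and nonpositive outside the large one, \<open>1 - q (1 - q t)\<close> is a plateau.
\<close>

definition plateau :: "nat \<Rightarrow> real ^ 'k \<Rightarrow> real \<Rightarrow> real ^ 'k \<Rightarrow> real" where
  "plateau m x0 r x = 1 - max 0 (1 - max 0 (2 - (\<Sum>i\<in>UNIV. (x $ i - x0 $ i) * (x $ i - x0 $ i)) / (r * r)) ^ Suc m) ^ Suc m"

lemma Ck_on_plateau:
  assumes "corner_open S"
  shows "Ck_on m S (plateau m x0 r)"
  unfolding plateau_def divide_inverse
  by (intro Ck_on_diff[OF assms] Ck_on_const[OF assms] Ck_on_max_power[OF assms] Ck_on_mult[OF assms]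
      Ck_on_sum[OF assms] Ck_on_vec_nth[OF assms] order_refl)

lemma sum_squares_dist: "(\<Sum>i\<in>UNIV. (x $ i - x0 $ i) * (x $ i - x0 $ i)) = dist x0 x * dist x0 x"
  for x :: "real ^ 'k"
proof -
  have "(\<Sum>i\<in>UNIV. (x $ i - x0 $ i) * (x $ i - x0 $ i)) = (x - x0) \<bullet> (x - x0)"
    by (simp add: inner_vec_def)
  also have "\<dots> = dist x0 x * dist x0 x"
    by (simp add: dist_norm norm_minus_commute power2_norm_eq_inner[symmetric] power2_eq_square)
  finally show ?thesis .
qed

lemma plateau_eq_1:
  assumes "0 < r" "dist x0 x \<le> r"
  shows "plateau m x0 r x = 1"
proof -
  have "dist x0 x * dist x0 x \<le> r * r" using assms by (intro mult_mono) auto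
  then have "dist x0 x * dist x0 x / (r * r) \<le> 1" using assms(1) by simp
  then have "1 \<le> max 0 (2 - dist x0 x * dist x0 x / (r * r)) ^ Suc m" by (intro one_le_power) auto
  then have "max 0 (1 - max 0 (2 - dist x0 x * dist x0 x / (r * r)) ^ Suc m) = 0" by simp
  then show ?thesis unfolding plateau_def sum_squares_dist by simp
qed

lemma plateau_eq_0:
  assumes "0 < r" "2 * r \<le> dist x0 x"
  shows "plateau m x0 r x = 0"
proof -
  have "(2 * r) * (2 * r) \<le> dist x0 x * dist x0 x" using assms by (intro mult_mono) auto
  moreover have "2 * (r * r) \<le> (2 * r) * (2 * r)" using assms(1) by simp
  ultimately have "2 * (r * r) \<le> dist x0 x * dist x0 x" by linarith
  then have "2 \<le> dist x0 x * dist x0 x / (r * r)" using assms(1) by (simp add: pos_le_divide_eq)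
  then have "max 0 (2 - dist x0 x * dist x0 x / (r * r)) = 0" by simp
  then show ?thesis unfolding plateau_def sum_squares_dist by simp
qed

section \<open>Perturbation of a metric\<close>

lemma local_mean_curvature_cong:
  assumes "corner_open S" "x \<in> S" "pos_def (G x)" "\<And>y. y \<in> S \<Longrightarrow> G y = G' y"
  shows "local_mean_curvature S G x = local_mean_curvature S G' x"
proof -
  have p: "partial S l (\<lambda>y. G y $ i $ j) x = partial S l (\<lambda>y. G' y $ i $ j) x" for l i j
    by (rule partial_cong[OF _ assms(2)]) (simp add: assms(4))
  have "pos_def (G' x)" using assms(2-4) by simp
  with assms(1-3) show ?thesis
    by (simp add: local_mean_curvature_eq christoffel_def p assms(4)[OF assms(2)])
qed

context normed_manifold
begin

definition extend_chart :: "('a, 'n) chart \<Rightarrow> (real ^ 'n option \<Rightarrow> real) \<Rightarrow> 'a \<Rightarrow> real" where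
  "extend_chart c f p = (if p \<in> fst c then f (snd c p) else 0)"

text \<open>Smooth here means class C^m: the functions in question contain coefficients of a C^m
  metric.\<close>

definition smooth_scalar :: "('a \<Rightarrow> real) \<Rightarrow> bool" where
  "smooth_scalar s \<longleftrightarrow> (\<forall>d\<in>A. Ck_on m (chart_image d) (\<lambda>x. s (chart_inv d x)))"

lemma smooth_scalarD: "smooth_scalar s \<Longrightarrow> d \<in> A \<Longrightarrow> Ck_on m (chart_image d) (\<lambda>x. s (chart_inv d x))"
  by (simp add: smooth_scalar_def)

lemma extend_chart_inv: "x \<in> chart_image c \<Longrightarrow> extend_chart c f (chart_inv c x) = f x"
  by (simp add: extend_chart_def chart_inv_in snd_chart_inv)

text \<open>A compact set of coordinates corresponds to a compact subset of M, and this is closed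
  because M is Hausdorff.\<close>

lemma closedin_chart_vimage:
  assumes "c \<in> A" "compact K" "K \<subseteq> chart_image c"
  shows "closedin M {p \<in> fst c. snd c p \<in> K}"
proof -
  let ?C = "{p \<in> fst c. snd c p \<in> K}"
  have "snd c ` ?C = K" using assms(3) by blast
  moreover have "topspace (subtopology M (fst c)) = fst c"
    by (rule topspace_subtopology_subset[OF fst_chart_subset[OF assms(1)]])
  ultimately have "compactin (subtopology M (fst c)) ?C"
    using homeomorphic_map_compactness[OF chart_homeomorphic[OF assms(1)], of ?C] assms(2,3)
    by (simp add: compactin_subtopology)
  then have "compactin M ?C" by (simp add: compactin_subtopology)
  then show ?thesis
    using smooth_manifold compactin_imp_closedin unfolding smooth_manifold_with_boundary_def by blast
qed

text \<open>M is covered by two open sets: the domain of c, where a transition map relates the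
  function to f, and the complement of the closed support set, where it is 0.
  \<open>Ck_on_local\<close> combines the two in any other chart.\<close>

lemma smooth_extend_chart:
  assumes c: "c \<in> A" and f: "Ck_on m (chart_image c) f"
    and K: "compact K" "K \<subseteq> chart_image c" and supp: "\<And>x. x \<in> chart_image c \<Longrightarrow> x \<notin> K \<Longrightarrow> f x = 0"
  shows "smooth_scalar (extend_chart c f)"
  unfolding smooth_scalar_def
proof
  fix d assume d: "d \<in> A"
  let ?C = "{p \<in> fst c. snd c p \<in> K}"
  have C: "closedin M ?C" by (rule closedin_chart_vimage[OF c K])
  show "Ck_on m (chart_image d) (\<lambda>x. extend_chart c f (chart_inv d x))"
  proof (rule Ck_on_local)
    fix x assume x: "x \<in> chart_image d"
    show "\<exists>T. openin (top_of_set (chart_image d)) T \<and> x \<in> T \<and> Ck_on m T (\<lambda>x. extend_chart c f (chart_inv d x))"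
    proof (cases "chart_inv d x \<in> fst c")
      case True
      have "x \<in> overlap d c"
        using overlapI[OF chart_inv_in[OF x] True] by (simp add: snd_chart_inv[OF x])
      moreover have "Ck_on m (overlap d c) (\<lambda>x. f (transition d c x))"
        by (rule Ck_on_compose[OF corner_open_overlap[OF d c] corner_open_chart_image[OF c] _ f Ck_transition_nth[OF d c]])
          (rule order_trans[OF transition_image[OF d] overlap_subset])
      moreover have "Ck_on m (overlap d c) (\<lambda>x. f (transition d c x)) \<longleftrightarrow> Ck_on m (overlap d c) (\<lambda>x. extend_chart c f (chart_inv d x))"
      proof (rule Ck_on_cong)
        fix y assume "y \<in> overlap d c"
        then obtain p where p: "p \<in> fst d" "p \<in> fst c" "y = snd d p" by (rule overlapE)
        show "f (transition d c y) = extend_chart c f (chart_inv d y)"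
          unfolding p(3) transition_snd[OF d p(1)] chart_inv_snd[OF d p(1)] by (simp add: extend_chart_def p(2))
      qed
      ultimately show ?thesis using openin_overlap_chart_image[OF d c] by blast
    next
      case False
      let ?T = "snd d ` (fst d \<inter> (topspace M - ?C))"
      have "openin (top_of_set halfspace) ?T"
        by (rule openin_chart_image_Int[OF d openin_diff[OF openin_topspace C]])
      then have "openin (top_of_set (chart_image d)) ?T"
        by (rule openin_subset_trans) (rule image_mono[OF Int_lower1], rule openin_imp_subset[OF openin_chart_image[OF d]])
      moreover have "x \<in> ?T"
      proof -
        have "chart_inv d x \<in> fst d \<inter> (topspace M - ?C)"
          using chart_inv_in[OF x] False fst_chart_subset[OF d] by blast
        then show ?thesis using snd_chart_inv[OF x] image_eqI[of x "snd d" "chart_inv d x"] by simp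
      qed
      moreover have "Ck_on m ?T (\<lambda>x. 0 :: real) \<longleftrightarrow> Ck_on m ?T (\<lambda>x. extend_chart c f (chart_inv d x))"
      proof (rule Ck_on_cong)
        fix y assume "y \<in> ?T"
        then obtain p where "p \<in> fst d \<inter> (topspace M - ?C)" "y = snd d p" by (rule imageE)
        then have p: "p \<in> fst d" "p \<notin> ?C" "y = snd d p" by simp_all
        show "0 = extend_chart c f (chart_inv d y)"
          unfolding p(3) chart_inv_snd[OF d p(1)] extend_chart_def using p(2) supp by auto
      qed
      moreover have "Ck_on m ?T (\<lambda>x. 0 :: real)"
        by (rule Ck_on_const[OF openin_corner_open[OF \<open>openin (top_of_set (chart_image d)) ?T\<close> corner_open_chart_image[OF d]]])
      ultimately show ?thesis by blast
    qed
  qed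
qed

lemma scalar_tensor:
  assumes s: "smooth_scalar s" and k: "k \<in> tensors"
  shows "(\<lambda>c x. s (chart_inv c x) *\<^sub>R k c x) \<in> tensors"
  unfolding sym_tensors_def
proof (intro CollectI conjI ballI allI impI)
  fix c assume c: "c \<in> A"
  note S = corner_open_chart_image[OF c]
  have "Ck_on m (chart_image c) (\<lambda>x. (s (chart_inv c x) *\<^sub>R k c x) $ i $ j)" for i j
    using Ck_on_mult[OF S smooth_scalarD[OF s c] Ck_sym_tensor[OF k c order_refl, of i j]] by simp
  then show "Ck_on m (chart_image c) (\<lambda>x. s (chart_inv c x) *\<^sub>R k c x)"
    using Ck_on_vec_iff[OF S, of m "\<lambda>x. s (chart_inv c x) *\<^sub>R k c x"]
      Ck_on_vec_iff[OF S, of m "\<lambda>x. (s (chart_inv c x) *\<^sub>R k c x) $ i" for i] by blast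
next
  fix c x assume cx: "c \<in> A" "x \<in> chart_image c"
  have "transpose (k c x) = k c x" using k cx unfolding sym_tensors_def by blast
  then show "transpose (s (chart_inv c x) *\<^sub>R k c x) = s (chart_inv c x) *\<^sub>R k c x"
    using symmetric_matrix_nth[of "k c x"] by (subst vec_eq_iff, subst vec_eq_iff) (simp add: transpose_def)
next
  fix c d p assume c: "c \<in> A" and d: "d \<in> A" and p: "p \<in> fst c \<inter> fst d"
  let ?J = "jacobian_transition c d (snd c p)"
  have *: "k c (snd c p) = transpose ?J ** k d (snd d p) ** ?J"
    using sym_tensor_transform[OF k c d overlapI] p by (simp add: transition_snd c)
  have inv: "chart_inv c (snd c p) = p" "chart_inv d (snd d p) = p"
    using p by (simp_all add: chart_inv_snd c d)
  show "s (chart_inv c (snd c p)) *\<^sub>R k c (snd c p) = transpose ?J ** (s (chart_inv d (snd d p)) *\<^sub>R k d (snd d p)) ** ?J"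
    unfolding inv * using congruence_linear[of ?J "s p" "k d (snd d p)" 0 0] by simp
next
  fix c x assume "c \<notin> A \<or> x \<notin> chart_image c"
  then have "k c x = 0" using k unfolding sym_tensors_def by blast
  then show "s (chart_inv c x) *\<^sub>R k c x = 0" by simp
qed

lemma tensor_sum:
  assumes "finite I" "\<And>i. i \<in> I \<Longrightarrow> k i \<in> tensors" "g \<in> tensors"
  shows "(\<lambda>c x. \<Sum>i\<in>I. a i *\<^sub>R k i c x) \<in> tensors \<and>
    tensor_norm (\<lambda>c x. \<Sum>i\<in>I. a i *\<^sub>R k i c x) \<le> (\<Sum>i\<in>I. \<bar>a i\<bar> * tensor_norm (k i))"
  using assms(1,2)
proof (induction I rule: finite_induct)
  case empty
  then show ?case using tensor_linear[OF assms(3,3), of 0 0] tensor_norm_linear[OF assms(3,3), of 0 0] by simp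
next
  case (insert i I)
  let ?s = "\<lambda>c x. \<Sum>i\<in>I. a i *\<^sub>R k i c x"
  have s: "?s \<in> tensors" "tensor_norm ?s \<le> (\<Sum>i\<in>I. \<bar>a i\<bar> * tensor_norm (k i))" and ki: "k i \<in> tensors"
    using insert.IH insert.prems by simp_all
  have eq: "(\<lambda>c x. \<Sum>i\<in>insert i I. a i *\<^sub>R k i c x) = (\<lambda>c x. a i *\<^sub>R k i c x + 1 *\<^sub>R ?s c x)"
    using insert.hyps by simp
  show ?case
    unfolding eq using tensor_linear[OF ki s(1), of "a i" 1] tensor_norm_linear[OF ki s(1), of "a i" 1] s(2) insert.hyps
    by simp
qed

text \<open>The factor x_0 vanishes on the boundary, so by the product rule only the derivative that
  hits it survives there. This prescribes the transversal derivative freely and leaves all other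
  first-order data at 0.\<close>

lemma partial_normal_factor:
  fixes w :: "real ^ 'n option \<Rightarrow> real"
  assumes "corner_open S" "x \<in> S" "x $ None = 0" "w differentiable (at x within S)"
  shows "(\<lambda>x. x $ None * w x) differentiable (at x within S)"
    and "partial S None (\<lambda>x. x $ None * w x) x = w x"
    and "partial S (Some i) (\<lambda>x. x $ None * w x) x = 0"
proof -
  have "((\<lambda>x. x $ None) has_derivative (\<lambda>v. v $ None)) (at x within S)"
    by (rule bounded_linear_imp_has_derivative[OF bounded_linear_vec_nth])
  note D = has_derivative_mult[OF this has_derivative_partials[OF assms(4)]]
  from D show "(\<lambda>x. x $ None * w x) differentiable (at x within S)" by (rule differentiableI)
  show "partial S None (\<lambda>x. x $ None * w x) x = w x" "partial S (Some i) (\<lambda>x. x $ None * w x) x = 0"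
    using partial_eqI[OF assms(1,2) D] by (simp_all add: assms(3) axis_def)
qed

text \<open>
  The conformal factor \<open>1 + s\<close> with \<open>s = x_0 w\<close> changes the mean curvature by \<open>- (n/2) (g^00)^(1/2) w\<close>,
  so the following coefficients change it by \<open>- x_i\<close> on the plateau.
\<close>

definition perturbation_weight ::
  "('a, 'n) tensor2 \<Rightarrow> ('a, 'n) chart \<Rightarrow> real ^ 'n option \<Rightarrow> real \<Rightarrow> 'n \<Rightarrow> real ^ 'n option \<Rightarrow> real" where
  "perturbation_weight g c x0 r i x =
     2 / CARD('n) * (plateau m x0 r x * (x $ Some i * matrix_inv (g c x) $ None $ None powr (- 1 / 2)))"

definition perturbation_factor ::
  "('a, 'n) tensor2 \<Rightarrow> ('a, 'n) chart \<Rightarrow> real ^ 'n option \<Rightarrow> real \<Rightarrow> 'n \<Rightarrow> real ^ 'n option \<Rightarrow> real" where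
  "perturbation_factor g c x0 r i x = x $ None * perturbation_weight g c x0 r i x"

lemma Ck_perturbation_weight:
  assumes g: "g \<in> metrics" and c: "c \<in> A"
  shows "Ck_on m (chart_image c) (perturbation_weight g c x0 r i)"
proof -
  note S = corner_open_chart_image[OF c]
  have "Ck_on m (chart_image c) (\<lambda>x. matrix_inv (g c x) $ None $ None)"
    by (rule Ck_on_matrix_inv[OF S Ck_sym_tensor[OF metric_sym_tensor[OF g] c order_refl] pos_def_det[OF metric_pos_def[OF g c]]])
  then have "Ck_on m (chart_image c) (\<lambda>x. matrix_inv (g c x) $ None $ None powr (- 1 / 2))"
    by (rule Ck_on_powr[OF S]) (rule pos_def_inverse_diagonal[OF metric_pos_def[OF g c]])
  then show ?thesis
    unfolding perturbation_weight_def
    by (intro Ck_on_mult[OF S] Ck_on_const[OF S] Ck_on_plateau[OF S] Ck_on_vec_nth[OF S])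
qed

lemma smooth_perturbation:
  assumes g: "g \<in> metrics" and c: "c \<in> A" and r: "0 < r" "cball x0 (2 * r) \<inter> halfspace \<subseteq> chart_image c"
  shows "smooth_scalar (extend_chart c (perturbation_factor g c x0 r i))"
proof (rule smooth_extend_chart[OF c _ _ r(2)])
  note S = corner_open_chart_image[OF c]
  show "Ck_on m (chart_image c) (perturbation_factor g c x0 r i)"
    unfolding perturbation_factor_def
    by (intro Ck_on_mult[OF S] Ck_on_vec_nth[OF S] Ck_perturbation_weight[OF g c])
  have "closed (halfspace :: (real ^ 'n option) set)"
    unfolding halfspace_def by (rule closed_halfspace_component_ge_cart)
  then show "compact (cball x0 (2 * r) \<inter> halfspace)" by (intro compact_Int_closed compact_cball)
  fix x assume x: "x \<in> chart_image c" "x \<notin> cball x0 (2 * r) \<inter> halfspace"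
  then have "2 * r \<le> dist x0 x" using openin_imp_subset[OF openin_chart_image[OF c]] by auto
  then show "perturbation_factor g c x0 r i x = 0"
    by (simp add: perturbation_factor_def perturbation_weight_def plateau_eq_0[OF r(1)])
qed

definition perturbed_metric ::
  "('a, 'n) tensor2 \<Rightarrow> ('a, 'n) chart \<Rightarrow> real ^ 'n option \<Rightarrow> real \<Rightarrow> real ^ 'n \<Rightarrow> ('a, 'n) tensor2" where
  "perturbed_metric g c x0 r a =
     (\<lambda>d x. (1 + (\<Sum>i\<in>UNIV. a $ i * extend_chart c (perturbation_factor g c x0 r i) (chart_inv d x))) *\<^sub>R g d x)"

lemma perturbed_metric_close:
  assumes g: "g \<in> metrics" and c: "c \<in> A" and r: "0 < r" "cball x0 (2 * r) \<inter> halfspace \<subseteq> chart_image c"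
    and e: "0 < e"
  obtains d where "0 < d" "\<And>a. (\<And>i. \<bar>a $ i\<bar> < d) \<Longrightarrow>
    perturbed_metric g c x0 r a \<in> tensors \<and> tensor_dist (perturbed_metric g c x0 r a) g < e"
proof -
  note gt = metric_sym_tensor[OF g]
  define u where "u i = (\<lambda>d x. extend_chart c (perturbation_factor g c x0 r i) (chart_inv d x) *\<^sub>R g d x)" for i
  have u: "u i \<in> tensors" for i unfolding u_def by (rule scalar_tensor[OF smooth_perturbation[OF g c r] gt])
  define N where "N = (\<Sum>i\<in>UNIV. tensor_norm (u i))"
  have N: "0 \<le> N" unfolding N_def by (intro sum_nonneg tensor_norm_nonneg u)
  \<comment> \<open>The perturbed metric is affine in a, with directions \<open>u i\<close> of total
    norm N; the summand 1 keeps the quotient meaningful for N = 0.\<close>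
  let ?d = "e / (N + 1)"
  show thesis
  proof (rule that[of ?d])
    show "0 < ?d" using e N by simp
    fix a :: "real ^ 'n" assume a: "\<And>i. \<bar>a $ i\<bar> < ?d"
    let ?v = "\<lambda>d x. \<Sum>i\<in>UNIV. a $ i *\<^sub>R u i d x"
    have v: "?v \<in> tensors" "tensor_norm ?v \<le> (\<Sum>i\<in>UNIV. \<bar>a $ i\<bar> * tensor_norm (u i))"
      using tensor_sum[of UNIV u g "\<lambda>i. a $ i"] u gt by simp_all
    have eq: "perturbed_metric g c x0 r a = (\<lambda>d x. 1 *\<^sub>R g d x + 1 *\<^sub>R ?v d x)"
      by (simp add: perturbed_metric_def u_def scaleR_add_left scaleR_sum_left)
    have in_t: "perturbed_metric g c x0 r a \<in> tensors" unfolding eq by (rule tensor_linear[OF gt v(1)])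
    have "tensor_norm ?v \<le> (\<Sum>i\<in>UNIV. ?d * tensor_norm (u i))"
      using v(2) by (rule order_trans) (intro sum_mono mult_right_mono less_imp_le a tensor_norm_nonneg u)
    also have "\<dots> = ?d * N" by (simp add: N_def sum_distrib_left)
    also have "\<dots> < e" using e N by (simp add: field_simps)
    finally have "tensor_norm ?v < e" .
    moreover have "(\<lambda>d x. perturbed_metric g c x0 r a d x - g d x) = ?v" unfolding eq by simp
    ultimately show "perturbed_metric g c x0 r a \<in> tensors \<and> tensor_dist (perturbed_metric g c x0 r a) g < e"
      using in_t tensor_dist_eq[OF in_t gt] by simp
  qed
qed

lemma perturbed_mean_curvature:
  assumes g: "g \<in> metrics" and m: "1 \<le> m" and c: "c \<in> A" and r: "0 < r"
    and g': "perturbed_metric g c x0 r a \<in> metrics"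
    and x: "x \<in> chart_image c" "x $ None = 0" "dist x0 x \<le> r"
  shows "chart_mean_curvature (perturbed_metric g c x0 r a) c x = chart_mean_curvature g c x - (\<Sum>i\<in>UNIV. a $ i * x $ Some i)"
proof -
  let ?S = "chart_image c" and ?g' = "perturbed_metric g c x0 r a" and ?h = "matrix_inv (g c x) $ None $ None"
  note S = corner_open_chart_image[OF c]
  define w where "w y = (\<Sum>i\<in>UNIV. a $ i * perturbation_weight g c x0 r i y)" for y
  define s where "s y = y $ None * w y" for y :: "real ^ 'n option"
  have "Ck_on m ?S w"
    unfolding w_def by (intro Ck_on_sum[OF S] Ck_on_mult[OF S] Ck_on_const[OF S] Ck_perturbation_weight[OF g c])
  then have "Ck_on (Suc 0) ?S w" by (rule Ck_on_mono[OF S]) (use m in simp)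
  then have "w differentiable_on ?S" by simp
  then have dw: "w differentiable (at x within ?S)" using x(1) unfolding differentiable_on_def by (rule bspec)
  note s = partial_normal_factor[OF S x(1,2) dw, folded s_def]
  have pd: "pos_def (g c x)" by (rule metric_pos_def[OF g c x(1)])
  have h: "0 < ?h" by (rule pos_def_inverse_diagonal[OF pd])
  have dg: "(\<lambda>y. g c y $ i $ j) differentiable (at x within ?S)" for i j
  proof -
    have "(\<lambda>y. g c y $ i $ j) differentiable_on ?S"
      using Ck_sym_tensor[OF metric_sym_tensor[OF g] c, of "Suc 0" i j] m by simp
    then show ?thesis using x(1) unfolding differentiable_on_def by (rule bspec)
  qed
  have g'_eq: "?g' c y = (1 + s y) *\<^sub>R g c y" if "y \<in> ?S" for y
    by (simp add: perturbed_metric_def extend_chart_inv[OF that] s_def w_def perturbation_factor_def sum_distrib_left mult_ac)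
  have "chart_mean_curvature ?g' c x = local_mean_curvature ?S (\<lambda>y. (1 + s y) *\<^sub>R g c y) x"
    by (rule local_mean_curvature_cong[where G="?g' c", OF S x(1) metric_pos_def[OF g' c x(1)] g'_eq])
  also have "\<dots> = chart_mean_curvature g c x - CARD('n) / 2 * (?h powr (1 / 2) * w x)"
    unfolding s(2)[symmetric]
    by (rule mean_curvature_conformal[OF S x(1) pd dg s(1) _ s(3)]) (simp add: s_def x(2))
  also have "CARD('n) / 2 * (?h powr (1 / 2) * w x) = (\<Sum>i\<in>UNIV. a $ i * x $ Some i)"
  proof -
    have "w x = 2 / CARD('n) * (\<Sum>i\<in>UNIV. a $ i * x $ Some i) * ?h powr (- 1 / 2)"
      by (simp add: w_def perturbation_weight_def plateau_eq_1[OF r x(3)] sum_distrib_left sum_distrib_right mult_ac)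
    moreover have "?h powr (1 / 2) * ?h powr (- 1 / 2) = 1"
      using h powr_add[of ?h "1 / 2" "- 1 / 2"] by simp
    ultimately show ?thesis by simp
  qed
  finally show ?thesis .
qed

end

section \<open>Density\<close>

context normed_manifold
begin

text \<open>On the plateau the two mean curvatures differ by a linear function of the tangential
  coordinates, with constant gradient a and zero Hessian. They are compared on the boundary only, so
  the derivatives are taken through \<open>bd_embed\<close> on an open set of R^n.\<close>

lemma perturbed_derivatives:
  assumes g: "g \<in> metrics" and m: "3 \<le> m" and c: "c \<in> A" and r: "0 < r"
    and g': "perturbed_metric g c x0 r a \<in> metrics"
    and y: "bd_embed y \<in> chart_image c" "bd_embed y \<in> ball x0 r"
  shows "partial (chart_image c) (Some i) (chart_mean_curvature (perturbed_metric g c x0 r a) c) (bd_embed y)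
      = partial (chart_image c) (Some i) (chart_mean_curvature g c) (bd_embed y) - a $ i"
    and "tangential_hessian (chart_image c) (chart_mean_curvature (perturbed_metric g c x0 r a) c) (bd_embed y)
      = tangential_hessian (chart_image c) (chart_mean_curvature g c) (bd_embed y)"
proof -
  let ?S = "chart_image c" and ?g' = "perturbed_metric g c x0 r a"
  let ?H = "chart_mean_curvature g c" and ?H' = "chart_mean_curvature ?g' c"
  define E where "E z = ?H (bd_embed z)" for z
  define lin where "lin z = (\<Sum>i\<in>UNIV. a $ i * z $ i)" for z :: "real ^ 'n"
  let ?W = "{z. bd_embed z \<in> ?S} \<inter> bd_embed -` ball x0 r"
  have W: "open ?W"
    by (intro open_Int open_bd_embed_vimage[OF openin_chart_image[OF c]] open_vimage continuous_on_bd_embed open_ball)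
  have yW: "y \<in> ?W" using y by simp
  have U: "corner_open (UNIV :: (real ^ 'n) set)" by (rule open_imp_corner_open[OF open_UNIV])
  have Ck: "Ck_on 2 ?S ?H" "Ck_on 2 ?S ?H'"
    by (rule Ck2_mean_curvature[OF g m c], rule Ck2_mean_curvature[OF g' m c])
  have diff: "?H differentiable (at (bd_embed z) within ?S)" "?H' differentiable (at (bd_embed z) within ?S)"
    if "bd_embed z \<in> ?S" for z
    using Ck that by (simp_all only: numeral_2_eq_2 Ck_on.simps differentiable_on_def)
  have H': "?H' (bd_embed z) = E z - lin z" if "z \<in> ?W" for z
    using perturbed_mean_curvature[OF g _ c r g', of "bd_embed z"] that m by (simp add: E_def lin_def)
  have dE: "(E has_derivative (\<lambda>v. \<Sum>i\<in>UNIV. v $ i * partial ?S (Some i) ?H (bd_embed z))) (at z)" if "z \<in> ?W" for z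
    unfolding E_def using that by (intro has_derivative_bd_embed[OF openin_chart_image[OF c]] diff) auto
  have dlin: "(lin has_derivative lin) (at z)" for z
  proof -
    have "linear lin" by (rule linearI) (simp_all add: lin_def distrib_left sum.distrib sum_distrib_left mult_ac)
    then show ?thesis by (intro bounded_linear_imp_has_derivative) (simp add: linear_conv_bounded_linear)
  qed
  have lin_axis: "lin (axis i 1) = a $ i" for i
    unfolding lin_def using sum_axis[of i "\<lambda>i. a $ i"] by (simp only: mult.commute)
  have gradient: "partial ?S (Some i) ?H' (bd_embed z) = partial ?S (Some i) ?H (bd_embed z) - a $ i" if z: "z \<in> ?W" for z i
  proof -
    have "partial ?S (Some i) ?H' (bd_embed z) = partial UNIV i (\<lambda>z. ?H' (bd_embed z)) z"
      using z by (intro partial_bd_embed[OF openin_chart_image[OF c], symmetric] diff) auto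
    also have "\<dots> = partial UNIV i (\<lambda>z. E z - lin z) z"
      by (rule partial_UNIV_cong[OF W z H'])
    also have "\<dots> = partial ?S (Some i) ?H (bd_embed z) - a $ i"
      unfolding partial_eqI[OF U UNIV_I has_derivative_diff[OF dE[OF z] dlin]] lin_axis by (simp only: sum_axis)
    finally show ?thesis .
  qed
  from gradient[OF yW] show "partial ?S (Some i) ?H' (bd_embed y) = partial ?S (Some i) ?H (bd_embed y) - a $ i" .
  have "tangential_hessian ?S ?H' (bd_embed y) $ i $ j = tangential_hessian ?S ?H (bd_embed y) $ i $ j" for i j
  proof -
    have d2: "partial ?S (Some j) ?H differentiable (at (bd_embed y) within ?S)" "partial ?S (Some j) ?H' differentiable (at (bd_embed y) within ?S)"
      using Ck y(1) by (simp_all only: numeral_2_eq_2 Ck_on.simps differentiable_on_def)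
    have "partial ?S (Some i) (partial ?S (Some j) ?H') (bd_embed y) = partial UNIV i (\<lambda>z. partial ?S (Some j) ?H' (bd_embed z)) y"
      by (rule partial_bd_embed[OF openin_chart_image[OF c] y(1) d2(2), symmetric])
    also have "\<dots> = partial UNIV i (\<lambda>z. partial ?S (Some j) ?H (bd_embed z) - a $ j) y"
      by (rule partial_UNIV_cong[OF W yW gradient])
    also have "\<dots> = partial ?S (Some i) (partial ?S (Some j) ?H) (bd_embed y)"
      unfolding partial_eqI[OF U UNIV_I has_derivative_diff[OF has_derivative_bd_embed[OF openin_chart_image[OF c] y(1) d2(1)] has_derivative_const]]
      by (simp only: sum_axis diff_zero)
    finally show ?thesis by (simp add: tangential_hessian_def)
  qed
  then show "tangential_hessian ?S ?H' (bd_embed y) = tangential_hessian ?S ?H (bd_embed y)" by (simp add: vec_eq_iff)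
qed

lemma nondegenerate_perturbation:
  assumes g: "g \<in> metrics" and m: "3 \<le> m" and c: "c \<in> A"
    and r: "0 < r" "cball x0 (2 * r) \<inter> halfspace \<subseteq> chart_image c" and e: "0 < e"
  obtains g' where "tensor_dist g' g < e" "g' \<in> nondegenerate_metrics_on {p \<in> fst c. snd c p \<in> ball x0 r}"
proof -
  let ?S = "chart_image c" and ?H = "chart_mean_curvature g c"
  obtain e' where e': "0 < e'" "\<And>g'. g' \<in> tensors \<Longrightarrow> tensor_dist g' g < e' \<Longrightarrow> g' \<in> metrics"
    using metrics_open[OF g] by blast
  \<comment> \<open>The radius e' ensures that the perturbed tensor is still positive
    definite.\<close>
  have "0 < min e e'" using e e'(1) by simp
  from perturbed_metric_close[OF g c r this] obtain d where d: "0 < d"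
    "\<And>a. (\<And>i. \<bar>a $ i\<bar> < d) \<Longrightarrow> perturbed_metric g c x0 r a \<in> tensors \<and> tensor_dist (perturbed_metric g c x0 r a) g < min e e'"
    by blast
  let ?f = "\<lambda>y. \<chi> i. partial ?S (Some i) ?H (bd_embed y)"
  let ?f' = "\<lambda>y v. \<chi> i. \<Sum>j\<in>UNIV. v $ j * partial ?S (Some j) (partial ?S (Some i) ?H) (bd_embed y)"
  have f: "(?f has_derivative ?f' y) (at y)" if "y \<in> {y. bd_embed y \<in> ?S}" for y
    unfolding has_derivative_vec_iff vec_lambda_beta
  proof
    fix i
    have "partial ?S (Some i) ?H differentiable_on ?S"
      using Ck2_mean_curvature[OF g m c] by (simp only: numeral_2_eq_2 Ck_on.simps)
    then have "partial ?S (Some i) ?H differentiable (at (bd_embed y) within ?S)"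
      using that unfolding differentiable_on_def by blast
    then show "((\<lambda>y. partial ?S (Some i) ?H (bd_embed y)) has_derivative
        (\<lambda>v. \<Sum>j\<in>UNIV. v $ j * partial ?S (Some j) (partial ?S (Some i) ?H) (bd_embed y))) (at y)"
      using that by (intro has_derivative_bd_embed[OF openin_chart_image[OF c]]) simp_all
  qed
  have hess: "det (matrix (?f' y)) = det (tangential_hessian ?S ?H (bd_embed y))" for y
  proof -
    have "matrix (?f' y) = transpose (tangential_hessian ?S ?H (bd_embed y))"
      unfolding matrix_def vec_lambda_beta sum_axis by (simp add: transpose_def tangential_hessian_def)
    then show ?thesis by simp
  qed
  \<comment> \<open>The critical points of the new mean curvature in the ball are boundary points
    where the old tangential gradient equals a; its derivative there is the transposed Hessian, so a
    regular value a makes the Hessian invertible.\<close>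
  obtain a where a: "\<And>i. \<bar>a $ i\<bar> < d" "\<And>y. y \<in> {y. bd_embed y \<in> ?S} \<Longrightarrow> ?f y = a \<Longrightarrow> det (matrix (?f' y)) \<noteq> 0"
    using regular_small_value[where f="?f" and f'="?f'", OF f d(1)] by blast
  let ?g' = "perturbed_metric g c x0 r a"
  have close: "?g' \<in> tensors" "tensor_dist ?g' g < min e e'" using d(2)[OF a(1)] by auto
  then have g': "?g' \<in> metrics" using e'(2) by simp
  show thesis
  proof (rule that[of ?g'])
    show "tensor_dist ?g' g < e" using close(2) by simp
    have "nondegenerate_at A (mean_curvature A ?g') p"
      if p: "p \<in> fst c" "snd c p \<in> ball x0 r" and crit: "critical_point A (mean_curvature A ?g') p" for p
    proof -
      have p0: "snd c p $ None = 0" using crit mboundary_iff[OF c p(1)] by (simp add: critical_point_def)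
      let ?y = "bd_coord c p"
      have y: "bd_embed ?y = snd c p" by (rule bd_embed_bd_coord[OF p0])
      have yS: "bd_embed ?y \<in> ?S" "bd_embed ?y \<in> ball x0 r" unfolding y using p by auto
      note D = perturbed_derivatives[OF g m c r(1) g' yS, unfolded y]
      have "partial ?S (Some i) (chart_mean_curvature ?g' c) (snd c p) = 0" for i
        using critical_point_iff[OF g' m c p(1) p0] crit by blast
      then have "?f ?y = a" using D(1) by (simp add: y vec_eq_iff)
      then have "det (tangential_hessian ?S ?H (snd c p)) \<noteq> 0" using a(2)[of ?y] yS(1) hess[of ?y] by (simp add: y)
      then show ?thesis unfolding nondegenerate_at_iff[OF g' m c p(1) p0 crit] D(2) .
    qed
    then show "?g' \<in> nondegenerate_metrics_on {p \<in> fst c. snd c p \<in> ball x0 r}"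
      using g' by (simp add: nondegenerate_metrics_on_def)
  qed
qed

text \<open>Three concentric radii: the perturbation is supported within 2 r, which fits into the
  chart, nondegeneracy is reached within r, and K has radius r / 2. K is closed so that
  nondegeneracy on it is an open condition, and it contains the open set N so that compactness of M
  applies.\<close>

lemma local_density:
  assumes m: "3 \<le> m" and p: "p \<in> topspace M"
  obtains N K where "openin M N" "p \<in> N" "N \<subseteq> K" "closedin M K"
    "\<And>g e. g \<in> metrics \<Longrightarrow> 0 < e \<Longrightarrow> \<exists>g'. tensor_dist g' g < e \<and> g' \<in> nondegenerate_metrics_on K"
proof -
  obtain c where c: "c \<in> A" "p \<in> fst c" using covered[OF p] by blast
  let ?x = "snd c p"
  obtain U where U: "open U" "chart_image c = halfspace \<inter> U"
    using openin_chart_image[OF c(1)] by (auto simp: openin_open)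
  have "?x \<in> U" using c(2) U(2) by blast
  then obtain d where d: "0 < d" "cball ?x d \<subseteq> U" using U(1) open_contains_cball by blast
  define r where "r = d / 2"
  have r: "0 < r" "cball ?x (2 * r) \<inter> halfspace \<subseteq> chart_image c" using d U(2) by (auto simp: r_def)
  let ?N = "{q \<in> fst c. snd c q \<in> ball ?x (r / 2)}"
  let ?K = "{q \<in> fst c. snd c q \<in> cball ?x (r / 2) \<inter> halfspace}"
  have hs: "snd c q \<in> halfspace" if "q \<in> fst c" for q
    using chart_image_halfspace[OF c(1) that] by (simp add: halfspace_def)
  show thesis
  proof (rule that)
    show "openin M ?N" by (rule openin_chart_vimage[OF c(1) open_ball])
    show "p \<in> ?N" using c(2) r(1) by simp
    show "?N \<subseteq> ?K" using hs by auto
    show "closedin M ?K"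
    proof (rule closedin_chart_vimage[OF c(1)])
      have "closed (halfspace :: (real ^ 'n option) set)"
        unfolding halfspace_def by (rule closed_halfspace_component_ge_cart)
      then show "compact (cball ?x (r / 2) \<inter> halfspace)" by (intro compact_Int_closed compact_cball)
      have "cball ?x (r / 2) \<subseteq> cball ?x (2 * r)" using r(1) by (intro subset_cball) simp
      then show "cball ?x (r / 2) \<inter> halfspace \<subseteq> chart_image c" using r(2) by blast
    qed
    fix g e assume g: "g \<in> metrics" "0 < (e :: real)"
    obtain g' where g': "tensor_dist g' g < e" "g' \<in> nondegenerate_metrics_on {q \<in> fst c. snd c q \<in> ball ?x r}"
      by (rule nondegenerate_perturbation[OF g(1) m c(1) r g(2)])
    have "cball ?x (r / 2) \<subseteq> ball ?x r" using r(1) by auto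
    then have "g' \<in> nondegenerate_metrics_on ?K"
      using g'(2) unfolding nondegenerate_metrics_on_def by blast
    with g'(1) show "\<exists>g'. tensor_dist g' g < e \<and> g' \<in> nondegenerate_metrics_on ?K" by blast
  qed
qed

lemma density_finite_union:
  assumes m: "3 \<le> m" and F: "finite F" and K: "\<And>p. p \<in> F \<Longrightarrow> closedin M (K p)"
    and dense: "\<And>p g e. p \<in> F \<Longrightarrow> g \<in> metrics \<Longrightarrow> 0 < e \<Longrightarrow> \<exists>g'. tensor_dist g' g < e \<and> g' \<in> nondegenerate_metrics_on (K p)"
    and g: "g \<in> metrics" and e: "0 < e"
  shows "\<exists>g'. tensor_dist g' g < e \<and> g' \<in> nondegenerate_metrics_on (\<Union>p\<in>F. K p)"
  using F K dense e
proof (induction F arbitrary: e rule: finite_induct)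
  case empty
  have "tensor_dist g g = 0" using Metric_space.mdist_zero[OF Metric_space_tensors] metric_sym_tensor[OF g] by blast
  then show ?case using g empty.prems(3) by (intro exI[of _ g]) (simp add: nondegenerate_metrics_on_def)
next
  case (insert p F)
  let ?U = "\<Union>p\<in>F. K p"
  have "0 < e / 2" using insert.prems(3) by simp
  with insert.IH[of "e / 2"] insert.prems(1,2) obtain g1 where
    g1: "tensor_dist g1 g < e / 2" "g1 \<in> nondegenerate_metrics_on ?U" by auto
  have "closedin M ?U" by (rule closedin_Union) (use insert in auto)
  from nondegenerate_metrics_on_open[OF m this g1(2)] obtain d where
    d: "0 < d" "\<And>g'. g' \<in> metrics \<Longrightarrow> tensor_dist g' g1 < d \<Longrightarrow> g' \<in> nondegenerate_metrics_on ?U" by blast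
  have g1m: "g1 \<in> metrics" using g1(2) by (simp add: nondegenerate_metrics_on_def)
  \<comment> \<open>The bound d protects the nondegeneracy already achieved on the union, and e / 2
    is what remains of the allowed distance.\<close>
  have "0 < min d (e / 2)" using d(1) insert.prems(3) by simp
  from insert.prems(2)[OF insertI1 g1m this] obtain g2 where
    g2: "tensor_dist g2 g1 < min d (e / 2)" "g2 \<in> nondegenerate_metrics_on (K p)" by blast
  have g2m: "g2 \<in> metrics" using g2(2) by (simp add: nondegenerate_metrics_on_def)
  have "g2 \<in> nondegenerate_metrics_on ?U" by (rule d(2)[OF g2m]) (use g2(1) in simp)
  then have "g2 \<in> nondegenerate_metrics_on (\<Union>p\<in>insert p F. K p)"
    using g2(2) unfolding nondegenerate_metrics_on_def by blast
  moreover have "tensor_dist g2 g < e"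
    using tensor_dist_triangle[OF metric_sym_tensor[OF g2m] metric_sym_tensor[OF g1m] metric_sym_tensor[OF g]] g1(1) g2(1)
    by simp
  ultimately show ?case by blast
qed

lemma nondegenerate_metrics_dense:
  assumes m: "3 \<le> m" and g: "g \<in> metrics" and e: "0 < e"
  shows "\<exists>g'. tensor_dist g' g < e \<and> g' \<in> nondegenerate_metrics m A"
proof -
  have "\<forall>p. \<exists>N K. p \<in> topspace M \<longrightarrow> openin M N \<and> p \<in> N \<and> N \<subseteq> K \<and> closedin M K \<and>
    (\<forall>g e. g \<in> metrics \<longrightarrow> 0 < e \<longrightarrow> (\<exists>g'. tensor_dist g' g < e \<and> g' \<in> nondegenerate_metrics_on K))"
  proof (intro allI)
    fix p
    show "\<exists>N K. p \<in> topspace M \<longrightarrow> openin M N \<and> p \<in> N \<and> N \<subseteq> K \<and> closedin M K \<and>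
      (\<forall>g e. g \<in> metrics \<longrightarrow> 0 < e \<longrightarrow> (\<exists>g'. tensor_dist g' g < e \<and> g' \<in> nondegenerate_metrics_on K))"
    proof (cases "p \<in> topspace M")
      case True
      show ?thesis by (rule local_density[OF m True]) blast
    qed blast
  qed
  from this[THEN choice] obtain N where "\<forall>p. \<exists>K. p \<in> topspace M \<longrightarrow> openin M (N p) \<and> p \<in> N p \<and> N p \<subseteq> K \<and> closedin M K \<and>
    (\<forall>g e. g \<in> metrics \<longrightarrow> 0 < e \<longrightarrow> (\<exists>g'. tensor_dist g' g < e \<and> g' \<in> nondegenerate_metrics_on K))" ..
  from this[THEN choice] obtain K where NK: "\<forall>p. p \<in> topspace M \<longrightarrow> openin M (N p) \<and> p \<in> N p \<and> N p \<subseteq> K p \<and> closedin M (K p) \<and>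
    (\<forall>g e. g \<in> metrics \<longrightarrow> 0 < e \<longrightarrow> (\<exists>g'. tensor_dist g' g < e \<and> g' \<in> nondegenerate_metrics_on (K p)))" ..
  have "compactin M (topspace M)" using compact by (simp add: compact_space_def)
  moreover have "\<forall>U\<in>N ` topspace M. openin M U" using NK by blast
  moreover have "topspace M \<subseteq> \<Union>(N ` topspace M)" using NK by blast
  ultimately obtain \<F> where \<F>: "finite \<F>" "\<F> \<subseteq> N ` topspace M" "topspace M \<subseteq> \<Union>\<F>"
    unfolding compactin_def by meson
  obtain F where F: "finite F" "F \<subseteq> topspace M" "\<F> = N ` F"
    using finite_subset_image[OF \<F>(1,2)] by blast
  have cov: "topspace M \<subseteq> (\<Union>p\<in>F. K p)"
  proof
    fix q assume "q \<in> topspace M"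
    then obtain p where "p \<in> F" "q \<in> N p" using \<F>(3) F(3) by blast
    then show "q \<in> (\<Union>p\<in>F. K p)" using NK F(2) by blast
  qed
  have "\<exists>g'. tensor_dist g' g < e \<and> g' \<in> nondegenerate_metrics_on (\<Union>p\<in>F. K p)"
  proof (rule density_finite_union[OF m F(1) _ _ g e])
    show "closedin M (K p)" if "p \<in> F" for p using NK F(2) that by blast
    show "\<exists>g'. tensor_dist g' g < e \<and> g' \<in> nondegenerate_metrics_on (K p)"
      if "p \<in> F" "g \<in> metrics" "0 < e" for p g e using NK F(2) that by blast
  qed
  moreover have "nondegenerate_metrics_on (\<Union>p\<in>F. K p) \<subseteq> nondegenerate_metrics_on (topspace M)"
    using cov unfolding nondegenerate_metrics_on_def by blast
  ultimately show ?thesis unfolding nondegenerate_metrics_on_topspace by blast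
qed

text \<open>Positive definiteness is an open condition on tensors, so the set is open even in the
  space of all symmetric tensors: the smaller of the two radii first makes a nearby tensor a metric
  and then keeps it nondegenerate.\<close>

lemma openin_nondegenerate_metrics:
  assumes m: "3 \<le> m"
  shows "openin (metric_topology m A L V \<phi>) (nondegenerate_metrics m A)"
proof -
  let ?T = "nondegenerate_metrics m A"
  have sub: "?T \<subseteq> metrics" by (auto simp: nondegenerate_metrics_def)
  have "openin (tensor_topology m A L V \<phi>) ?T"
    unfolding tensor_topology_def Metric_space.openin_mtopology[OF Metric_space_tensors]
  proof (intro conjI allI impI)
    show "?T \<subseteq> tensors" using sub metrics_subset by blast
    fix g assume g: "g \<in> ?T"
    then have gm: "g \<in> metrics" using sub by blast
    obtain r0 where r0: "r0 > 0" "\<And>g'. g' \<in> tensors \<Longrightarrow> tensor_dist g' g < r0 \<Longrightarrow> g' \<in> metrics"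
      using metrics_open[OF gm] by blast
    obtain r1 where r1: "r1 > 0" "\<And>g'. g' \<in> metrics \<Longrightarrow> tensor_dist g' g < r1 \<Longrightarrow> g' \<in> ?T"
      using nondegenerate_metrics_on_open[OF m closedin_topspace, unfolded nondegenerate_metrics_on_topspace, OF g] by blast
    have "Metric_space.mball tensors tensor_dist g (min r0 r1) \<subseteq> ?T"
    proof
      fix g' assume "g' \<in> Metric_space.mball tensors tensor_dist g (min r0 r1)"
      then have "g' \<in> tensors" "tensor_dist g' g < min r0 r1"
        by (simp_all add: Metric_space.in_mball[OF Metric_space_tensors] Metric_space.commute[OF Metric_space_tensors, of g' g])
      then show "g' \<in> ?T" using r0(2) r1(2) by simp
    qed
    then show "\<exists>r>0. Metric_space.mball tensors tensor_dist g r \<subseteq> ?T"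
      using r0(1) r1(1) by (intro exI[of _ "min r0 r1"]) simp
  qed
  then have "openin (metric_topology m A L V \<phi>) (?T \<inter> metrics)"
    unfolding metric_topology_def by (rule openin_subtopology_Int)
  then show ?thesis using sub by (simp add: Int_absorb2)
qed

lemma closure_nondegenerate_metrics:
  assumes m: "3 \<le> m"
  shows "metric_topology m A L V \<phi> closure_of nondegenerate_metrics m A = metrics"
proof -
  have top: "topspace (metric_topology m A L V \<phi>) = metrics"
    unfolding metric_topology_def tensor_topology_def
    using metrics_subset by (simp add: Metric_space.topspace_mtopology[OF Metric_space_tensors] Int_absorb1)
  have "g \<in> metric_topology m A L V \<phi> closure_of nondegenerate_metrics m A" if g: "g \<in> metrics" for g
    unfolding in_closure_of top
  proof (intro conjI allI impI g)
    fix U assume U: "g \<in> U \<and> openin (metric_topology m A L V \<phi>) U"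
    then obtain U' where U': "openin (tensor_topology m A L V \<phi>) U'" "U = U' \<inter> metrics"
      unfolding metric_topology_def by (auto simp: openin_subtopology)
    have "g \<in> U'" using U U'(2) by blast
    with U'(1) obtain r where r: "r > 0" "Metric_space.mball tensors tensor_dist g r \<subseteq> U'"
      unfolding tensor_topology_def Metric_space.openin_mtopology[OF Metric_space_tensors] by blast
    obtain g' where g': "tensor_dist g' g < r" "g' \<in> nondegenerate_metrics m A"
      using nondegenerate_metrics_dense[OF m g r(1)] by blast
    have g'm: "g' \<in> metrics" using g'(2) by (simp add: nondegenerate_metrics_def)
    have "g' \<in> Metric_space.mball tensors tensor_dist g r"
      using g'(1) metric_sym_tensor[OF g] metric_sym_tensor[OF g'm]
      by (simp add: Metric_space.in_mball[OF Metric_space_tensors] Metric_space.commute[OF Metric_space_tensors, of g g'])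
    then have "g' \<in> U" using r(2) U'(2) g'm by blast
    with g'(2) show "\<exists>y. y \<in> nondegenerate_metrics m A \<and> y \<in> U" by blast
  qed
  then show ?thesis using closure_of_subset_topspace[of "metric_topology m A L V \<phi>"] unfolding top by blast
qed

end

theorem theorem1:
  fixes M :: "'a topology"
    and A :: "('a, 'n::finite) chart set"
    and L :: "'l set"
    and V :: "'l \<Rightarrow> 'a set"
    and \<phi> :: "'l \<Rightarrow> ('a, 'n) chart"
    and m :: nat
  assumes "3 \<le> m"
    and "smooth_manifold_with_boundary M A"
    and "compact_space M"
    and "connected_space M"
    and "norm_cover M A L V \<phi>"
  shows "openin (metric_topology m A L V \<phi>) (nondegenerate_metrics m A) \<and>
         metric_topology m A L V \<phi> closure_of nondegenerate_metrics m A = riemannian_metrics m A"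
proof -
  interpret normed_manifold M A L V \<phi> m
    using assms(2,3,5) by unfold_locales
  show ?thesis
    using openin_nondegenerate_metrics[OF assms(1)] closure_nondegenerate_metrics[OF assms(1)] by blast
qed

end
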